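(* Let $k\ge2$, let $(X_i,T_i)$ ($1\le i\le k$) be full shifts with one-block factor maps $\pi_i:X_i\to X_{i+1}$ ($1\le i\le k-1$), write $(X,T)=(X_1,T_1)$, let $\mathbf a=(a_1,\dots,a_k)\in\mathbb R^k$ with $a_1>0$ and $a_i\ge0$ for $i>1$, and endow $X$ with the metric $d_{\mathbf a}$. Let $\mu\in\mathcal M(X,T)$. Then $\mathcal G(\mu)\ne\emptyset$ and $\dim_H\mathcal G(\mu)=h^{\mathbf a}_\mu(T)$.
   Context: $X_i=\mathcal A_i^{\mathbb N}$ with $\mathcal A_i$ a finite alphabet and $T_i$ the left shift. A one-block factor map $\pi_i:X_i\to X_{i+1}$ is a continuous surjection with $\pi_iT_i=T_{i+1}\pi_i$ induced letter by letter by a map $\mathcal A_i\to\mathcal A_{i+1}$. $\pi_0$ is the identity of $X_1$ and $\tau_i=\pi_i\circ\pi_{i-1}\circ\cdots\circ\pi_0:X_1\to X_{i+1}$ for $0\le i\le k-1$. $\mathcal M(X,T)$ is the set of $T$-invariant Borel probability measures. The $\mathbf a$-weighted entropy is $h^{\mathbf a}_\mu(T)=\sum_{i=1}^ka_ih_{\mu\circ\tau_{i-1}^{-1}}(T_i)$, where $h$ on the right is measure-theoretic entropy. The metric on $X$ is $d_{\mathbf a}(x,y)=\max\big(e^{-|\tau_{i-1}(x)\wedge\tau_{i-1}(y)|/(a_1+\cdots+a_i)}:1\le i\le k\big)$, where $|u\wedge v|=\inf\{m\ge1:u_m\ne v_m\}-1$ ($\inf\emptyset=\infty$, $e^{-\infty}=0$).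 $\dim_H$ is Hausdorff dimension with respect to $d_{\mathbf a}$. $\mathcal G(\mu)=\{x\in X:\lim_{n\to\infty}\frac1n\sum_{i=0}^{n-1}g(T^ix)=\int g\,d\mu\ \ \forall g\in C(X)\}$, where $C(X)$ is the set of real continuous functions on $X$. *)

theory Defs
  imports "HOL-Probability.Probability"
begin

section \<open>Full shifts and one-block factor maps\<close>

text \<open>
  Sequences are indexed from 0 instead of 1.  All alphabets are finite subsets of one
  (arbitrary) type.  The alphabet is given the discrete topology.
\<close>

definition shift_top :: "'a set \<Rightarrow> (nat \<Rightarrow> 'a) topology" where
  "shift_top A = product_topology (\<lambda>_. discrete_topology A) UNIV"

abbreviation full_shift :: "'a set \<Rightarrow> (nat \<Rightarrow> 'a) set" where
  "full_shift A \<equiv> topspace (shift_top A)"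

lemma full_shift_eq: "full_shift A = {x. \<forall>n. x n \<in> A}"
  by (auto simp: shift_top_def PiE_def Pi_def)

definition left_shift :: "(nat \<Rightarrow> 'a) \<Rightarrow> nat \<Rightarrow> 'a" where
  "left_shift x = (\<lambda>n. x (Suc n))"

definition one_block_factor_map ::
    "'a set \<Rightarrow> 'b set \<Rightarrow> ((nat \<Rightarrow> 'a) \<Rightarrow> nat \<Rightarrow> 'b) \<Rightarrow> bool" where
  "one_block_factor_map A B f \<longleftrightarrow>
     continuous_map (shift_top A) (shift_top B) f \<and>
     f ` full_shift A = full_shift B \<and>
     (\<forall>x\<in>full_shift A. f (left_shift x) = left_shift (f x)) \<and>
     (\<exists>\<phi>. \<phi> ` A \<subseteq> B \<and> (\<forall>x\<in>full_shift A. \<forall>n. f x n = \<phi> (x n)))"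

text \<open>\<open>factor_comp \<pi> i = \<pi>\<^sub>i \<circ> \<dots> \<circ> \<pi>\<^sub>1\<close>, a map from the first shift space to
  the shift space number \<open>i + 1\<close>.\<close>

primrec factor_comp ::
    "(nat \<Rightarrow> (nat \<Rightarrow> 'a) \<Rightarrow> nat \<Rightarrow> 'a) \<Rightarrow> nat \<Rightarrow> (nat \<Rightarrow> 'a) \<Rightarrow> nat \<Rightarrow> 'a" where
  "factor_comp \<pi> 0 = id"
| "factor_comp \<pi> (Suc i) = \<pi> (Suc i) \<circ> factor_comp \<pi> i"

section \<open>Invariant measures and generic points\<close>

definition borel_on :: "'b topology \<Rightarrow> 'b measure" where
  "borel_on X = sigma (topspace X) {U. openin X U}"

definition invariant_measures :: "'b topology \<Rightarrow> ('b \<Rightarrow> 'b) \<Rightarrow> 'b measure set" where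
  "invariant_measures X T =
     {M. prob_space M \<and> space M = topspace X \<and> sets M = sets (borel_on X) \<and>
         (\<forall>B\<in>sets M. emeasure M (T -` B \<inter> space M) = emeasure M B)}"

definition generic_points :: "'b topology \<Rightarrow> ('b \<Rightarrow> 'b) \<Rightarrow> 'b measure \<Rightarrow> 'b set" where
  "generic_points X T M =
     {x \<in> topspace X. \<forall>g. continuous_map X euclideanreal g \<longrightarrow>
        (\<lambda>n. (1 / real n) * (\<Sum>i<n. g ((T ^^ i) x))) \<longlonglongrightarrow> (\<integral>y. g y \<partial>M)}"

section \<open>Measure-theoretic entropy\<close>

definition partition_entropy :: "'b measure \<Rightarrow> 'b set set \<Rightarrow> real" where
  "partition_entropy M P = - (\<Sum>B\<in>P. measure M B * ln (measure M B))"

definition pullback_partition :: "'b measure \<Rightarrow> ('b \<Rightarrow> 'b) \<Rightarrow> 'b set set \<Rightarrow> 'b set set" where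
  "pullback_partition M f P = (\<lambda>B. f -` B \<inter> space M) ` P - {{}}"

definition iterated_partition :: "'b measure \<Rightarrow> ('b \<Rightarrow> 'b) \<Rightarrow> 'b set set \<Rightarrow> nat \<Rightarrow> 'b set set" where
  "iterated_partition M T P n =
     common_refinement ((\<lambda>i. pullback_partition M (T ^^ i) P) ` {..<n})"

text \<open>The natural logarithm matches the base \<open>e\<close> in the metric below.\<close>

definition measure_entropy :: "'b measure \<Rightarrow> ('b \<Rightarrow> 'b) \<Rightarrow> ereal" where
  "measure_entropy M T =
     (SUP P\<in>{P. finite P \<and> partition_on (space M) P \<and> P \<subseteq> sets M}.
        ereal (lim (\<lambda>n. (1 / real n) * partition_entropy M (iterated_partition M T P n))))"

definition weighted_entropy ::
    "nat \<Rightarrow> (nat \<Rightarrow> 'a set) \<Rightarrow> (nat \<Rightarrow> (nat \<Rightarrow> 'a) \<Rightarrow> nat \<Rightarrow> 'a) \<Rightarrow> (nat \<Rightarrow> real) \<Rightarrow>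
     (nat \<Rightarrow> 'a) measure \<Rightarrow> ereal" where
  "weighted_entropy k A \<pi> a M =
     (\<Sum>i=1..k. ereal (a i) *
        measure_entropy (distr M (borel_on (shift_top (A i))) (factor_comp \<pi> (i - 1))) left_shift)"

section \<open>The weighted metric\<close>

text \<open>Length of the longest common prefix; the infimum of the empty set is \<open>\<infinity>\<close>.
  No 1 is subtracted, because the indices start at 0.\<close>

definition agreement :: "(nat \<Rightarrow> 'a) \<Rightarrow> (nat \<Rightarrow> 'a) \<Rightarrow> enat" where
  "agreement u v = Inf (enat ` {m. u m \<noteq> v m})"

definition exp_neg_div :: "enat \<Rightarrow> real \<Rightarrow> real" where
  "exp_neg_div m c = (case m of enat j \<Rightarrow> exp (- (real j / c)) | \<infinity> \<Rightarrow> 0)"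

definition weighted_dist ::
    "nat \<Rightarrow> (nat \<Rightarrow> (nat \<Rightarrow> 'a) \<Rightarrow> nat \<Rightarrow> 'a) \<Rightarrow> (nat \<Rightarrow> real) \<Rightarrow>
     (nat \<Rightarrow> 'a) \<Rightarrow> (nat \<Rightarrow> 'a) \<Rightarrow> real" where
  "weighted_dist k \<pi> a x y =
     Max ((\<lambda>i. exp_neg_div (agreement (factor_comp \<pi> (i - 1) x) (factor_comp \<pi> (i - 1) y))
                 (\<Sum>j=1..i. a j)) ` {1..k})"

section \<open>Hausdorff dimension with respect to a distance on a carrier set\<close>

text \<open>\<open>diam_powr d s U\<close> is \<open>diam(U)\<^sup>s\<close>, with the conventions \<open>diam({})\<^sup>s = 0\<close> and
  \<open>diam(U)\<^sup>0 = 1\<close> for nonempty \<open>U\<close> (whereas \<open>0 powr 0 = 0\<close>).  It is only used for sets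
  of bounded diameter, where the real supremum is meaningful.\<close>

definition diam_powr :: "('b \<Rightarrow> 'b \<Rightarrow> real) \<Rightarrow> real \<Rightarrow> 'b set \<Rightarrow> ennreal" where
  "diam_powr d s U =
     (if U = {} then 0 else if s = 0 then 1
      else ennreal ((SUP (x, y)\<in>U \<times> U. d x y) powr s))"

definition delta_covers ::
    "'b set \<Rightarrow> ('b \<Rightarrow> 'b \<Rightarrow> real) \<Rightarrow> real \<Rightarrow> 'b set \<Rightarrow> (nat \<Rightarrow> 'b set) set" where
  "delta_covers X d \<delta> E =
     {U. (\<forall>i. U i \<subseteq> X \<and> (\<forall>x\<in>U i. \<forall>y\<in>U i. d x y \<le> \<delta>)) \<and> E \<subseteq> (\<Union>i. U i)}"

definition hausdorff_measure ::
    "'b set \<Rightarrow> ('b \<Rightarrow> 'b \<Rightarrow> real) \<Rightarrow> real \<Rightarrow> 'b set \<Rightarrow> ennreal" where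
  "hausdorff_measure X d s E =
     (SUP \<delta>\<in>{0<..}. INF U\<in>delta_covers X d \<delta> E. \<Sum>i. diam_powr d s (U i))"

definition hausdorff_dim :: "'b set \<Rightarrow> ('b \<Rightarrow> 'b \<Rightarrow> real) \<Rightarrow> 'b set \<Rightarrow> ereal" where
  "hausdorff_dim X d E = Inf (ereal ` {s. 0 \<le> s \<and> hausdorff_measure X d s E = 0})"

end

theory Submission
  imports Defs "HOL-Real_Asymp.Real_Asymp"
begin

text \<open>
  A ball of radius \<open>e\<^sup>-\<^sup>n\<close> fixes \<open>\<tau>\<^sub>i(x)\<close> up to time \<open>n(a\<^sub>1 + \<dots> + a\<^sub>i\<^sub>+\<^sub>1)\<close> for every \<open>i\<close>.  So it is
  described by a word whose letters are those of \<open>\<tau>\<^sub>i(x)\<close> in a window of length about \<open>n a\<^sub>i\<^sub>+\<^sub>1\<close>.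

  Upper bound: predict each letter of this word by the conditional probability of \<open>\<mu> \<circ> \<tau>\<^sub>i\<^sup>-\<^sup>1\<close> given
  the last \<open>l\<close> letters.  The products of the predictions over all words sum up to at most 1, and at
  a generic point the product is about \<open>exp(- n h)\<close> with \<open>h\<close> the weighted entropy, because each
  window is itself generic.  Hence about \<open>exp(n h)\<close> balls suffice.

  Lower bound: concatenate independent \<open>\<mu>\<close>-random blocks whose lengths grow slowly.  By the law of
  large numbers the resulting point is almost surely generic, and since the blocks are independent,
  the mass of a ball around it is at most the product of the \<open>\<mu> \<circ> \<tau>\<^sub>i\<^sup>-\<^sup>1\<close>-measures of its blocks, which
  is about \<open>exp(- n h)\<close>.

  Both estimates use the entropy of words; the Kolmogorov--Sinai theorem identifies its growth rate
  with the entropy of the system.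
\<close>

text \<open>The measure \<open>\<mu>\<close> need not be ergodic. If it is not, information per
  letter need not have a constant almost sure limit, and the generic points of \<open>\<mu>\<close>
  form a \<open>\<mu>\<close>-null set, so neither bound can look at \<open>\<mu>\<close>-typical
  points. In the upper bound a predictor with finite memory depends on finitely many letters; mixing
  in a little of the uniform distribution keeps its logarithm finite, and genericity alone fixes the
  average of this continuous function. In the lower bound independence replaces ergodicity, and the
  law of large numbers also shows that a generic point exists. Block lengths have to tend to
  infinity, so that the entropy per letter of a block approaches \<open>h\<close>; but they are
  chosen so slowly that the largest information of a block stays below a multiple of the fourth root
  of the block index, which makes Hoeffding's inequality summable. Since the factor maps act letter
  by letter, one sequence of blocks serves all levels; and since finer letters determine coarser
  ones, the windows of the different levels can be read as one word.\<close>

lemma subadditive_limit: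
  fixes u :: "nat \<Rightarrow> real"
  assumes sub: "\<And>m n. u (m + n) \<le> u m + u n" and nonneg: "\<And>n. 0 \<le> u n"
  obtains h where "0 \<le> h" "\<And>n. n > 0 \<Longrightarrow> h \<le> u n / real n" "(\<lambda>n. u n / real n) \<longlonglongrightarrow> h"
proof -
  \<comment> \<open>Fekete's lemma. The limit is the infimum, so only an upper estimate is left; it
    comes from division with remainder by a nearly optimal \<open>p\<close>.\<close>
  define h where "h = (INF n\<in>{0<..}. u n / real n)"
  have bdd: "bdd_below ((\<lambda>n. u n / real n) ` {0<..})"
    using nonneg by (auto intro!: bdd_belowI[of _ 0])
  have h_le: "h \<le> u n / real n" if "n > 0" for n
    unfolding h_def using that by (intro cINF_lower[OF bdd]) auto
  have h_nonneg: "0 \<le> h"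
    unfolding h_def using nonneg by (intro cINF_greatest) auto
  have mult: "u (q * p) \<le> real q * u p" if "q > 0" for p q
    using that
  proof (induction q rule: nat_induct_non_zero)
    case (Suc q)
    have "u (Suc q * p) \<le> u p + u (q * p)" using sub[of p "q * p"] by simp
    with Suc show ?case by (simp add: algebra_simps)
  qed simp
  have "(\<lambda>n. u n / real n) \<longlonglongrightarrow> h"
  proof (rule LIMSEQ_I)
    fix e :: real assume e: "0 < e"
    have "\<exists>p\<in>{0<..}. u p / real p < h + e / 2"
      using cINF_less_iff[OF _ bdd, of "h + e / 2"] e unfolding h_def by auto
    then obtain p where p: "p > 0" "u p / real p < h + e / 2" by auto
    \<comment> \<open>\<open>K\<close> bounds the remainder term \<open>u (n mod p)\<close> for all
      \<open>n\<close> at once and vanishes after division by \<open>n\<close>.\<close>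
    define K where "K = (\<Sum>r<p. u r) + u p"
    have K: "u r \<le> K" if "r < p" for r
      unfolding K_def using that nonneg member_le_sum[of r "{..<p}" u] by (simp add: add_increasing2)
    have K0: "0 \<le> K" unfolding K_def by (intro add_nonneg_nonneg sum_nonneg nonneg)
    obtain N where N: "real N > 2 * K / e" using reals_Archimedean2 by blast
    have "norm (u n / real n - h) < e" if n: "n \<ge> N + p" for n
    proof -
      have n0: "n > 0" using n p by simp
      have q0: "n div p > 0" using n p by (simp add: div_greater_zero_iff)
      have "u n \<le> u (n div p * p) + u (n mod p)"
        using sub[of "n div p * p" "n mod p"] by simp
      also have "\<dots> \<le> real (n div p) * u p + K"
        using mult[OF q0] K[of "n mod p"] p by (intro add_mono) auto
      also have "real (n div p) * u p \<le> real n / real p * u p"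
        using p nonneg by (intro mult_right_mono of_nat_div_le_of_nat) auto
      finally have "u n / real n \<le> (real n / real p * u p + K) / real n"
        by (intro divide_right_mono) auto
      also have "\<dots> = u p / real p + K / real n"
        using n0 p by (simp add: field_simps)
      also have "K / real n < e / 2"
      proof -
        have "2 * K / e < real n" using N n by linarith
        then have "2 * K < real n * e" using e by (simp add: pos_divide_less_eq)
        then show ?thesis using n0 by (simp add: field_simps)
      qed
      finally have "u n / real n < h + e" using p by linarith
      then show ?thesis using h_le[OF n0] e by simp
    qed
    then show "\<exists>no. \<forall>n\<ge>no. norm (u n / real n - h) < e" by blast
  qed
  with h_nonneg h_le that show ?thesis by blast
qed

section \<open>Entropy of finite-valued functions\<close>

text \<open>The level set of \<open>f\<close> through \<open>x\<close> is the block of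
  \<open>x\<close> in the partition given by \<open>f\<close>, so
  \<open>- ln (fiber_measure M f x)\<close> is the information function and its mean the Shannon
  entropy. With functions in place of partitions, a join is a pair and a pullback is a
  composition.\<close>

definition fiber_measure :: "'b measure \<Rightarrow> ('b \<Rightarrow> 'c) \<Rightarrow> 'b \<Rightarrow> real" where
  "fiber_measure M f x = measure M {y\<in>space M. f y = f x}"

definition fiber_entropy :: "'b measure \<Rightarrow> ('b \<Rightarrow> 'c) \<Rightarrow> real" where
  "fiber_entropy M f = (\<integral>x. - ln (fiber_measure M f x) \<partial>M)"

lemma simple_function_fiber_sets:
  assumes "simple_function M f"
  shows "{y\<in>space M. f y = v} \<in> sets M"
proof -
  have "{y\<in>space M. f y = v} = f -` {v} \<inter> space M" by auto
  then show ?thesis using simple_functionD(2)[OF assms, of "{v}"] by simp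
qed

lemma simple_function_restrict_family:
  assumes "\<And>i. i \<in> I \<Longrightarrow> simple_function M (f i)" "finite I"
  shows "simple_function M (\<lambda>x. \<lambda>i\<in>I. f i x)"
proof -
  have "(\<lambda>x. \<lambda>i\<in>I. f i x) ` space M \<subseteq> PiE I (\<lambda>i. f i ` space M)" by auto
  moreover have "finite (PiE I (\<lambda>i. f i ` space M))"
    using assms by (intro finite_PiE) (auto dest: simple_functionD)
  ultimately have "finite ((\<lambda>x. \<lambda>i\<in>I. f i x) ` space M)" by (rule finite_subset)
  moreover have "(\<lambda>x. \<lambda>i\<in>I. f i x) -` {\<lambda>i\<in>I. f i x} \<inter> space M \<in> sets M" for x
  proof -
    have "(\<lambda>x. \<lambda>i\<in>I. f i x) -` {\<lambda>i\<in>I. f i x} \<inter> space M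
        = {y\<in>space M. \<forall>i\<in>I. f i y = f i x}"
      by (auto simp: fun_eq_iff) metis
    also have "\<dots> \<in> sets M"
      using assms by (intro sets.sets_Collect_finite_All) (auto intro: simple_function_fiber_sets)
    finally show ?thesis .
  qed
  ultimately show ?thesis unfolding simple_function_def by blast
qed

context prob_space
begin

lemma integral_simple_function:
  fixes F :: "'c \<Rightarrow> real"
  assumes f: "simple_function M f"
  shows "integrable M (\<lambda>x. F (f x))"
    and "(\<integral>x. F (f x) \<partial>M) = (\<Sum>v\<in>f ` space M. prob {y\<in>space M. f y = v} * F v)"
proof -
  have fin: "finite (f ` space M)" using f by (rule simple_functionD)
  have eq: "F (f x) = (\<Sum>v\<in>f ` space M. F v * indicator {y\<in>space M. f y = v} x)"
    if "x \<in> space M" for x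
  proof -
    have "(\<Sum>v\<in>f ` space M. F v * indicator {y\<in>space M. f y = v} x)
      = (\<Sum>v\<in>f ` space M. if v = f x then F v else 0)"
      using that by (intro sum.cong) auto
    then show ?thesis using fin that by simp
  qed
  have int: "integrable M (\<lambda>x. F v * indicator {y\<in>space M. f y = v} x :: real)" for v
    using simple_function_fiber_sets[OF f] by (intro integrable_mult_right integrable_real_indicator)
       (auto simp: emeasure_eq_measure)
  show "integrable M (\<lambda>x. F (f x))"
    by (subst Bochner_Integration.integrable_cong[OF refl eq]) (auto intro!: Bochner_Integration.integrable_sum int)
  have "(\<integral>x. F (f x) \<partial>M) = (\<integral>x. (\<Sum>v\<in>f ` space M. F v * indicator {y\<in>space M. f y = v} x) \<partial>M)"
    by (intro Bochner_Integration.integral_cong eq refl)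
  also have "\<dots> = (\<Sum>v\<in>f ` space M. F v * prob {y\<in>space M. f y = v})"
    using int by (subst Bochner_Integration.integral_sum)
      (auto intro!: sum.cong arg_cong2[where f=times] arg_cong[where f=prob])
  finally show "(\<integral>x. F (f x) \<partial>M) = (\<Sum>v\<in>f ` space M. prob {y\<in>space M. f y = v} * F v)"
    by (simp add: mult.commute)
qed

lemma sum_prob_fibers:
  assumes f: "simple_function M f"
  shows "(\<Sum>v\<in>f ` space M. prob {y\<in>space M. f y = v}) = 1"
  using integral_simple_function(2)[OF f, of "\<lambda>_. 1"] prob_space by simp

lemma fiber_entropy_eq:
  assumes f: "simple_function M f"
  shows "fiber_entropy M f
    = - (\<Sum>v\<in>f ` space M. prob {y\<in>space M. f y = v} * ln (prob {y\<in>space M. f y = v}))"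
  unfolding fiber_entropy_def fiber_measure_def
  using integral_simple_function(2)[OF f, of "\<lambda>v. - ln (prob {y\<in>space M. f y = v})"]
  by (simp add: sum_negf)

lemma fiber_measure_bounds: "0 \<le> fiber_measure M f x" "fiber_measure M f x \<le> 1"
  by (auto simp: fiber_measure_def)

lemma ln_fiber_measure_nonpos: "ln (fiber_measure M f x) \<le> 0"
  using fiber_measure_bounds[of f x] by (cases "fiber_measure M f x = 0") auto

lemma fiber_entropy_nonneg: "0 \<le> fiber_entropy M f"
  unfolding fiber_entropy_def
  by (intro Bochner_Integration.integral_nonneg) (simp add: ln_fiber_measure_nonpos)

lemma fiber_entropy_cong:
  assumes "\<And>x y. x \<in> space M \<Longrightarrow> y \<in> space M \<Longrightarrow> f x = f y \<longleftrightarrow> g x = g y"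
  shows "fiber_entropy M f = fiber_entropy M g"
proof -
  have "{y\<in>space M. f y = f x} = {y\<in>space M. g y = g x}" if "x \<in> space M" for x
    using assms that by auto
  then show ?thesis
    unfolding fiber_entropy_def fiber_measure_def by (intro Bochner_Integration.integral_cong) auto
qed

text \<open>Gibbs' inequality, from \<open>ln t \<le> t - 1\<close>.\<close>

lemma fiber_entropy_le_cross_entropy:
  assumes f: "simple_function M f"
    and Q: "\<And>v. v \<in> f ` space M \<Longrightarrow> 0 \<le> Q v" "(\<Sum>v\<in>f ` space M. Q v) \<le> 1"
    and pos: "\<And>v. v \<in> f ` space M \<Longrightarrow> 0 < prob {y\<in>space M. f y = v} \<Longrightarrow> 0 < Q v"
  shows "fiber_entropy M f \<le> (\<integral>x. - ln (Q (f x)) \<partial>M)"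
proof -
  let ?p = "\<lambda>v. prob {y\<in>space M. f y = v}"
  have "?p v * ln (Q v) - ?p v * ln (?p v) \<le> Q v - ?p v" if v: "v \<in> f ` space M" for v
  proof (cases "?p v = 0")
    case False
    then have p: "0 < ?p v" by (simp add: zero_less_measure_iff)
    note q = pos[OF v p]
    have "?p v * ln (Q v) - ?p v * ln (?p v) = ?p v * ln (Q v / ?p v)"
      using p q by (simp add: ln_div algebra_simps)
    also have "\<dots> \<le> ?p v * (Q v / ?p v - 1)"
      using p q by (intro mult_left_mono ln_le_minus_one) auto
    also have "\<dots> = Q v - ?p v" using p by (simp add: field_simps)
    finally show ?thesis .
  qed (use Q v in auto)
  then have "(\<Sum>v\<in>f ` space M. ?p v * ln (Q v) - ?p v * ln (?p v)) \<le> (\<Sum>v\<in>f ` space M. Q v - ?p v)"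
    by (rule sum_mono)
  also have "\<dots> \<le> 0"
    using Q sum_prob_fibers[OF f] by (simp add: sum_subtractf)
  finally show ?thesis
    using fiber_entropy_eq[OF f] integral_simple_function(2)[OF f, of "\<lambda>v. - ln (Q v)"]
    by (simp add: sum_subtractf sum_negf)
qed

text \<open>The conventional value of \<open>ln\<close> at 0 breaks the logarithm laws on fibers of
  measure 0. There are only finitely many fibers, so such points form a null set.\<close>

lemma AE_fiber_measure_pos:
  assumes f: "simple_function M f"
  shows "AE x in M. 0 < fiber_measure M f x"
proof -
  let ?p = "\<lambda>v. prob {y\<in>space M. f y = v}"
  have "AE x in M. \<forall>v\<in>f ` space M. ?p v = 0 \<longrightarrow> f x \<noteq> v"
  proof (rule AE_finite_allI[OF simple_functionD(1)[OF f]])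
    fix v
    show "AE x in M. ?p v = 0 \<longrightarrow> f x \<noteq> v"
    proof (cases "?p v = 0")
      case True
      then have "{y\<in>space M. f y = v} \<in> null_sets M"
        using simple_function_fiber_sets[OF f] by (auto simp: null_sets_def emeasure_eq_measure)
      then show ?thesis by (rule AE_I') auto
    qed auto
  qed
  then show ?thesis
    by (rule AE_mp[OF _ AE_I2]) (auto simp: fiber_measure_def zero_less_measure_iff)
qed

text \<open>Gibbs' inequality for the weights \<open>prob {g = u} * K u v\<close>. Here
  \<open>K u\<close> is any guess, of total mass at most 1, at the law of \<open>f\<close> given
  \<open>g = u\<close>; a wrong guess only increases the bound. Everything later is a choice of
  \<open>K\<close>.\<close>

lemma fiber_entropy_pair_le:
  assumes f: "simple_function M f" and g: "simple_function M g"
    and K: "\<And>u v. u \<in> g ` space M \<Longrightarrow> v \<in> f ` space M \<Longrightarrow> 0 \<le> K u v"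
      "\<And>u. u \<in> g ` space M \<Longrightarrow> (\<Sum>v\<in>f ` space M. K u v) \<le> 1"
    and pos: "\<And>u v. u \<in> g ` space M \<Longrightarrow> v \<in> f ` space M \<Longrightarrow>
      0 < prob {y\<in>space M. f y = v} \<Longrightarrow> 0 < K u v"
  shows "fiber_entropy M (\<lambda>x. (g x, f x)) \<le> fiber_entropy M g + (\<integral>x. - ln (K (g x) (f x)) \<partial>M)"
proof -
  let ?pf = "\<lambda>v. prob {y\<in>space M. f y = v}" and ?pg = "\<lambda>v. prob {y\<in>space M. g y = v}"
  let ?Q = "\<lambda>(u, v). ?pg u * K u v"
  have gf: "simple_function M (\<lambda>x. (g x, f x))" using f g by (rule simple_function_Pair[rotated])
  have sub: "(\<lambda>x. (g x, f x)) ` space M \<subseteq> g ` space M \<times> f ` space M" by auto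
  have fin: "finite (g ` space M \<times> f ` space M)" using f g by (auto dest: simple_functionD)
  have "(\<Sum>v\<in>(\<lambda>x. (g x, f x)) ` space M. ?Q v) \<le> (\<Sum>v\<in>g ` space M \<times> f ` space M. ?Q v)"
    using K(1) by (intro sum_mono2 fin sub) auto
  also have "\<dots> = (\<Sum>u\<in>g ` space M. ?pg u * (\<Sum>v\<in>f ` space M. K u v))"
    by (simp add: sum.cartesian_product[symmetric] sum_distrib_left)
  also have "\<dots> \<le> (\<Sum>u\<in>g ` space M. ?pg u * 1)"
    using K(2) by (intro sum_mono mult_left_mono) auto
  also have "\<dots> = 1" using sum_prob_fibers[OF g] by simp
  finally have sum: "(\<Sum>v\<in>(\<lambda>x. (g x, f x)) ` space M. ?Q v) \<le> 1" .
  have pos': "0 < ?pg u" "0 < ?pf v" if "0 < prob {y\<in>space M. (g y, f y) = (u, v)}" for u v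
  proof -
    have "prob {y\<in>space M. (g y, f y) = (u, v)} \<le> ?pg u" "prob {y\<in>space M. (g y, f y) = (u, v)} \<le> ?pf v"
      using simple_function_fiber_sets[OF f] simple_function_fiber_sets[OF g]
      by (auto intro!: finite_measure_mono)
    with that show "0 < ?pg u" "0 < ?pf v" by linarith+
  qed
  have "fiber_entropy M (\<lambda>x. (g x, f x)) \<le> (\<integral>x. - ln (?Q (g x, f x)) \<partial>M)"
  proof (rule fiber_entropy_le_cross_entropy[OF gf _ sum])
    fix v assume "v \<in> (\<lambda>x. (g x, f x)) ` space M" "0 < prob {y\<in>space M. (g y, f y) = v}"
    then show "0 < ?Q v" using pos pos' by (cases v) (auto intro!: mult_pos_pos)
  qed (use K(1) in auto)
  also have "\<dots> = (\<integral>x. - ln (?pg (g x)) + - ln (K (g x) (f x)) \<partial>M)"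
  proof (rule integral_cong_AE)
    show "AE x in M. - ln (?Q (g x, f x)) = - ln (?pg (g x)) + - ln (K (g x) (f x))"
      using AE_fiber_measure_pos[OF g] AE_fiber_measure_pos[OF f] AE_space
    proof eventually_elim
      case (elim x)
      then have "0 < K (g x) (f x)" by (intro pos) (auto simp: fiber_measure_def)
      then show ?case using elim by (simp add: fiber_measure_def ln_mult)
    qed
  qed (use borel_measurable_integrable[OF integral_simple_function(1)[OF gf, of "\<lambda>w. - ln (?Q w)"]]
      borel_measurable_integrable[OF integral_simple_function(1)[OF gf,
        of "\<lambda>(u, v). - ln (?pg u) + - ln (K u v)"]] in simp_all)
  also have "\<dots> = fiber_entropy M g + (\<integral>x. - ln (K (g x) (f x)) \<partial>M)"
    unfolding fiber_entropy_def fiber_measure_def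
    using integral_simple_function(1)[OF gf, of "\<lambda>(u, v). - ln (K u v)"]
      integral_simple_function(1)[OF g, of "\<lambda>u. - ln (?pg u)"]
    by (subst Bochner_Integration.integral_add[symmetric]) auto
  finally show ?thesis .
qed

text \<open>The guess that ignores \<open>g\<close> and uses the law of \<open>f\<close>
  itself.\<close>

lemma fiber_entropy_pair_subadditive:
  assumes f: "simple_function M f" and g: "simple_function M g"
  shows "fiber_entropy M (\<lambda>x. (g x, f x)) \<le> fiber_entropy M g + fiber_entropy M f"
  using fiber_entropy_pair_le[OF f g, of "\<lambda>_ v. prob {y\<in>space M. f y = v}"] sum_prob_fibers[OF f]
  by (simp add: fiber_entropy_def[of M f] fiber_measure_def)

lemma fiber_entropy_le_pair:
  assumes f: "simple_function M f" and g: "simple_function M g"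
  shows "fiber_entropy M f \<le> fiber_entropy M (\<lambda>x. (g x, f x))"
proof -
  have gf: "simple_function M (\<lambda>x. (g x, f x))" using f g by (rule simple_function_Pair[rotated])
  show ?thesis
    unfolding fiber_entropy_def
  proof (rule integral_mono_AE)
    show "AE x in M. - ln (fiber_measure M f x) \<le> - ln (fiber_measure M (\<lambda>x. (g x, f x)) x)"
      using AE_fiber_measure_pos[OF gf]
    proof eventually_elim
      case (elim x)
      have "fiber_measure M (\<lambda>x. (g x, f x)) x \<le> fiber_measure M f x"
        unfolding fiber_measure_def
        by (intro finite_measure_mono simple_function_fiber_sets[OF f]) auto
      with elim show ?case by simp
    qed
  qed (use integral_simple_function(1)[OF f, of "\<lambda>v. - ln (prob {y\<in>space M. f y = v})"]
      integral_simple_function(1)[OF gf, of "\<lambda>v. - ln (prob {y\<in>space M. (g y, f y) = v})"] in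
      \<open>auto simp: fiber_measure_def\<close>)
qed

end

text \<open>Applied to powers of \<open>T\<close> it expresses invariance of entropy; applied to the
  factor maps it brings the entropies of all image measures back to the first shift.\<close>

lemma fiber_entropy_distr:
  assumes T: "T \<in> measurable M N" and f: "simple_function N f"
  shows "fiber_entropy (distr M N T) f = fiber_entropy M (f \<circ> T)"
proof -
  have eq: "fiber_measure (distr M N T) f (T x) = fiber_measure M (f \<circ> T) x" for x
  proof -
    have "T -` {y \<in> space N. f y = f (T x)} \<inter> space M = {y \<in> space M. (f \<circ> T) y = (f \<circ> T) x}"
      using measurable_space[OF T] by auto
    then show ?thesis
      unfolding fiber_measure_def using measure_distr[OF T simple_function_fiber_sets[OF f]] by simp
  qed
  have "(\<lambda>x. - ln (fiber_measure (distr M N T) f x)) \<in> borel_measurable N"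
  proof -
    have "simple_function N (\<lambda>x. - ln (measure (distr M N T) {y\<in>space N. f y = f x}))"
      using simple_function_compose[OF f, of "\<lambda>v. - ln (measure (distr M N T) {y\<in>space N. f y = v})"]
      by (simp add: comp_def)
    from borel_measurable_simple_function[OF this] show ?thesis
      unfolding fiber_measure_def by simp
  qed
  then show ?thesis
    unfolding fiber_entropy_def by (subst integral_distr[OF T]) (auto simp: eq)
qed

section \<open>Entropy rate of a measure-preserving map\<close>

definition itinerary :: "('b \<Rightarrow> 'c) \<Rightarrow> ('b \<Rightarrow> 'b) \<Rightarrow> nat \<Rightarrow> 'b \<Rightarrow> nat \<Rightarrow> 'c" where
  "itinerary f T n x = (\<lambda>i\<in>{..<n}. f ((T ^^ i) x))"

lemma itinerary_eq_iff:
  "itinerary f T n x = itinerary f T n y \<longleftrightarrow> (\<forall>i<n. f ((T ^^ i) x) = f ((T ^^ i) y))"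
  by (auto simp: itinerary_def fun_eq_iff)

locale measure_preserving = prob_space +
  fixes T :: "'a \<Rightarrow> 'a"
  assumes measurable_T [measurable]: "T \<in> measurable M M"
    and distr_T: "distr M M T = M"
begin

lemma measurable_funpow_T [measurable]: "(T ^^ n) \<in> measurable M M"
  by (induction n) (auto intro: measurable_comp measurable_T simp: id_def)

lemma funpow_T_space: "x \<in> space M \<Longrightarrow> (T ^^ n) x \<in> space M"
  using measurable_space[OF measurable_funpow_T] .

lemma distr_funpow_T: "distr M M (T ^^ n) = M"
proof (induction n)
  case 0
  then show ?case by (simp add: distr_id id_def)
next
  case (Suc n)
  have "distr M M (T ^^ Suc n) = distr (distr M M (T ^^ n)) M T"
    using distr_distr[OF measurable_T measurable_funpow_T, of n] by (simp only: funpow.simps)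
  with Suc show ?case by (simp only: distr_T)
qed

lemma integral_funpow_T:
  fixes g :: "'a \<Rightarrow> real"
  assumes "g \<in> borel_measurable M"
  shows "(\<integral>x. g ((T ^^ n) x) \<partial>M) = (\<integral>x. g x \<partial>M)"
  using integral_distr[OF measurable_funpow_T assms, of n] by (simp add: distr_funpow_T)

lemma simple_function_itinerary:
  assumes f: "simple_function M f"
  shows "simple_function M (itinerary f T n)"
proof -
  have "simple_function M (\<lambda>x. f ((T ^^ i) x))" for i
    by (rule simple_function_comp[OF measurable_funpow_T f])
  then show ?thesis
    unfolding itinerary_def by (intro simple_function_restrict_family) auto
qed

text \<open>An itinerary of length \<open>m + n\<close> carries the same information as its first
  \<open>m\<close> entries together with the itinerary of length \<open>n\<close> started at
  \<open>T ^^ m\<close>, and invariance gives the latter the entropy of an unshifted one.\<close>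

lemma itinerary_entropy_subadditive:
  assumes f: "simple_function M f"
  shows "fiber_entropy M (itinerary f T (m + n))
    \<le> fiber_entropy M (itinerary f T m) + fiber_entropy M (itinerary f T n)"
proof -
  note sf = simple_function_itinerary[OF f]
  have sf': "simple_function M (itinerary f T n \<circ> (T ^^ m))"
    using simple_function_comp[OF measurable_funpow_T sf] by (simp add: comp_def)
  have "fiber_entropy M (itinerary f T (m + n))
      = fiber_entropy M (\<lambda>x. (itinerary f T m x, (itinerary f T n \<circ> (T ^^ m)) x))"
  proof (rule fiber_entropy_cong)
    fix x y
    have "(\<forall>i<m+n. P i) \<longleftrightarrow> (\<forall>i<m. P i) \<and> (\<forall>i<n. P (i + m))" for P :: "nat \<Rightarrow> bool"
    proof safe
      fix i assume "\<forall>i<m. P i" "\<forall>i<n. P (i + m)" "i < m + n"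
      then have "i < m \<or> (i - m < n \<and> i = i - m + m)" by linarith
      then show "P i" using \<open>\<forall>i<m. P i\<close> \<open>\<forall>i<n. P (i + m)\<close> by metis
    qed auto
    then show "itinerary f T (m + n) x = itinerary f T (m + n) y \<longleftrightarrow>
      (itinerary f T m x, (itinerary f T n \<circ> (T ^^ m)) x) =
      (itinerary f T m y, (itinerary f T n \<circ> (T ^^ m)) y)"
      by (simp add: itinerary_eq_iff funpow_add)
  qed
  also have "\<dots> \<le> fiber_entropy M (itinerary f T m) + fiber_entropy M (itinerary f T n \<circ> (T ^^ m))"
    by (rule fiber_entropy_pair_subadditive[OF sf' sf])
  also have "fiber_entropy M (itinerary f T n \<circ> (T ^^ m)) = fiber_entropy M (itinerary f T n)"
    using fiber_entropy_distr[OF measurable_funpow_T sf, of m] by (simp add: distr_funpow_T)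
  finally show ?thesis .
qed

lemma itinerary_entropy_rate:
  assumes f: "simple_function M f"
  obtains h where "0 \<le> h" "\<And>n. n > 0 \<Longrightarrow> h \<le> fiber_entropy M (itinerary f T n) / real n"
    "(\<lambda>n. fiber_entropy M (itinerary f T n) / real n) \<longlonglongrightarrow> h"
  using subadditive_limit[of "\<lambda>n. fiber_entropy M (itinerary f T n)",
      OF itinerary_entropy_subadditive[OF f] fiber_entropy_nonneg] by blast

end

section \<open>Partitions as fibers\<close>

text \<open>The equivalence relation of a partition. For it a common refinement is a conjunction, so
  a partition can be matched with any function that has the same classes as fibers.\<close>

definition same_block :: "'b set set \<Rightarrow> 'b \<Rightarrow> 'b \<Rightarrow> bool" where
  "same_block P x y \<longleftrightarrow> (\<exists>B\<in>P. x \<in> B \<and> y \<in> B)"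

lemma (in prob_space) partition_entropy_eq_fiber_entropy:
  assumes P: "partition_on (space M) P" "finite P" "P \<subseteq> sets M"
    and f: "\<And>x y. x \<in> space M \<Longrightarrow> y \<in> space M \<Longrightarrow> f x = f y \<longleftrightarrow> same_block P x y"
  shows "partition_entropy M P = fiber_entropy M f"
proof -
  have eq: "- ln (fiber_measure M f x) = (\<Sum>B\<in>P. - ln (prob B) * indicator B x)" if x: "x \<in> space M" for x
  proof -
    obtain B where B: "B \<in> P" "x \<in> B" using x P(1) by (auto simp: partition_on_def)
    have uniq: "C = B" if "C \<in> P" "x \<in> C" for C
      using P(1) B that unfolding partition_on_def disjoint_def by blast
    have "{y\<in>space M. f y = f x} = B"
    proof (intro equalityI subsetI)
      fix y assume "y \<in> {y\<in>space M. f y = f x}"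
      then have "same_block P x y" using f[of x y] x by simp
      then show "y \<in> B" using uniq unfolding same_block_def by blast
    next
      fix y assume y: "y \<in> B"
      then have "y \<in> space M" using P(1) B unfolding partition_on_def by blast
      moreover have "same_block P y x" using y B unfolding same_block_def by blast
      ultimately show "y \<in> {y\<in>space M. f y = f x}" using f[of y x] x by simp
    qed
    then have "- ln (fiber_measure M f x) = - ln (prob B)" by (simp add: fiber_measure_def)
    also have "\<dots> = (\<Sum>C\<in>P. if C = B then - ln (prob C) else 0)" using P(2) B by simp
    also have "\<dots> = (\<Sum>B\<in>P. - ln (prob B) * indicator B x)"
    proof (rule sum.cong)
      fix C assume "C \<in> P"
      then have "C = B \<longleftrightarrow> x \<in> C" using uniq B by blast
      then show "(if C = B then - ln (prob C) else 0) = - ln (prob C) * indicator C x"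
        by (simp add: indicator_def)
    qed simp
    finally show ?thesis .
  qed
  have int: "integrable M (\<lambda>x. - ln (prob B) * indicator B x :: real)" if "B \<in> P" for B
    using that P(3) by (intro integrable_mult_right integrable_real_indicator)
      (auto simp: emeasure_eq_measure)
  have "fiber_entropy M f = (\<integral>x. (\<Sum>B\<in>P. - ln (prob B) * indicator B x) \<partial>M)"
    unfolding fiber_entropy_def using eq by (intro Bochner_Integration.integral_cong) simp_all
  also have "\<dots> = (\<Sum>B\<in>P. \<integral>x. - ln (prob B) * indicator B x \<partial>M)"
    by (rule Bochner_Integration.integral_sum) (rule int)
  also have "\<dots> = (\<Sum>B\<in>P. - (prob B * ln (prob B)))"
  proof (rule sum.cong)
    fix B assume "B \<in> P"
    then have "B \<inter> space M = B" using P(3) sets.sets_into_space by auto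
    then show "(\<integral>x. - ln (prob B) * indicator B x \<partial>M) = - (prob B * ln (prob B))" by simp
  qed simp
  finally show ?thesis by (simp add: partition_entropy_def sum_negf)
qed

lemma same_block_common_refinement:
  "same_block (common_refinement \<P>) x y \<longleftrightarrow> (\<forall>P\<in>\<P>. same_block P x y)"
proof
  assume "same_block (common_refinement \<P>) x y"
  then show "\<forall>P\<in>\<P>. same_block P x y"
  proof (intro ballI)
    fix P assume P: "P \<in> \<P>"
    from \<open>same_block (common_refinement \<P>) x y\<close> obtain X
      where X: "X \<in> common_refinement \<P>" "x \<in> X" "y \<in> X" unfolding same_block_def by blast
    obtain R where "R \<in> P" "X \<subseteq> R" using common_refinement_exists[OF X(1) P] by blast
    with X show "same_block P x y" unfolding same_block_def by blast
  qed
next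
  assume "\<forall>P\<in>\<P>. same_block P x y"
  \<comment> \<open>One block is chosen from each partition. Their intersection contains
    \<open>x\<close>, so it is not among the empty sets that \<open>common_refinement\<close>
    discards.\<close>
  then have "\<exists>f. \<forall>P\<in>\<P>. f P \<in> P \<and> x \<in> f P \<and> y \<in> f P"
    unfolding same_block_def by (intro bchoice) blast
  then obtain f where f: "\<And>P. P \<in> \<P> \<Longrightarrow> f P \<in> P \<and> x \<in> f P \<and> y \<in> f P" by blast
  then have fx: "x \<in> \<Inter> (f ` \<P>)" "y \<in> \<Inter> (f ` \<P>)" and "f \<in> (\<Pi> P\<in>\<P>. P)" by auto
  then have "\<Inter> (f ` \<P>) \<in> common_refinement \<P>"
    unfolding common_refinement by blast
  with fx show "same_block (common_refinement \<P>) x y" unfolding same_block_def by (intro bexI conjI)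
qed

context measure_preserving
begin

lemma pullback_partition_funpow:
  assumes P: "partition_on (space M) P" "finite P" "P \<subseteq> sets M"
  shows "partition_on (space M) (pullback_partition M (T ^^ i) P)"
    and "finite (pullback_partition M (T ^^ i) P)"
    and "pullback_partition M (T ^^ i) P \<subseteq> sets M"
    and "x \<in> space M \<Longrightarrow> y \<in> space M \<Longrightarrow>
      same_block (pullback_partition M (T ^^ i) P) x y \<longleftrightarrow> same_block P ((T ^^ i) x) ((T ^^ i) y)"
proof -
  show "partition_on (space M) (pullback_partition M (T ^^ i) P)"
  proof (rule partition_onI)
    show "\<Union> (pullback_partition M (T ^^ i) P) = space M"
    proof
      show "space M \<subseteq> \<Union> (pullback_partition M (T ^^ i) P)"
      proof
        fix x assume x: "x \<in> space M"
        then obtain B where "B \<in> P" "(T ^^ i) x \<in> B"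
          using P(1) funpow_T_space[OF x, of i] unfolding partition_on_def by blast
        then have "x \<in> (T ^^ i) -` B \<inter> space M" "(T ^^ i) -` B \<inter> space M \<in> pullback_partition M (T ^^ i) P"
          using x by (auto simp: pullback_partition_def)
        then show "x \<in> \<Union> (pullback_partition M (T ^^ i) P)" by (rule UnionI[rotated])
      qed
    qed (auto simp: pullback_partition_def)
    show "disjnt X Y"
      if "X \<in> pullback_partition M (T ^^ i) P" "Y \<in> pullback_partition M (T ^^ i) P" "X \<noteq> Y" for X Y
    proof -
      from that obtain B C where BC: "B \<in> P" "C \<in> P" "X = (T ^^ i) -` B \<inter> space M" "Y = (T ^^ i) -` C \<inter> space M"
        unfolding pullback_partition_def by auto
      with that have "B \<noteq> C" by auto
      then have "B \<inter> C = {}" using P(1) BC by (auto simp: partition_on_def disjoint_def)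
      then show ?thesis using BC by (auto simp: disjnt_def)
    qed
  qed (simp add: pullback_partition_def)
  show "finite (pullback_partition M (T ^^ i) P)" using P by (simp add: pullback_partition_def)
  show "pullback_partition M (T ^^ i) P \<subseteq> sets M"
    using P(3) measurable_sets[OF measurable_funpow_T] by (auto simp: pullback_partition_def)
  show "same_block (pullback_partition M (T ^^ i) P) x y \<longleftrightarrow> same_block P ((T ^^ i) x) ((T ^^ i) y)"
    if "x \<in> space M" "y \<in> space M"
  proof
    assume "same_block (pullback_partition M (T ^^ i) P) x y"
    then show "same_block P ((T ^^ i) x) ((T ^^ i) y)"
      unfolding same_block_def pullback_partition_def by blast
  next
    assume "same_block P ((T ^^ i) x) ((T ^^ i) y)"
    then obtain B where B: "B \<in> P" "(T ^^ i) x \<in> B" "(T ^^ i) y \<in> B" unfolding same_block_def by blast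
    then have "(T ^^ i) -` B \<inter> space M \<in> pullback_partition M (T ^^ i) P"
      using that by (auto simp: pullback_partition_def)
    then show "same_block (pullback_partition M (T ^^ i) P) x y"
      unfolding same_block_def using B that by (intro bexI) auto
  qed
qed

text \<open>Positivity of \<open>n\<close> matters: the refinement of the empty family is
  \<open>{UNIV}\<close>, which need not be a partition of \<open>space M\<close>.\<close>

lemma iterated_partition_entropy:
  assumes P: "partition_on (space M) P" "finite P" "P \<subseteq> sets M"
    and f: "\<And>x y. x \<in> space M \<Longrightarrow> y \<in> space M \<Longrightarrow> f x = f y \<longleftrightarrow> same_block P x y"
    and n: "n > 0"
  shows "partition_entropy M (iterated_partition M T P n) = fiber_entropy M (itinerary f T n)"
proof (rule partition_entropy_eq_fiber_entropy)
  let ?\<P> = "(\<lambda>i. pullback_partition M (T ^^ i) P) ` {..<n}"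
  note pb = pullback_partition_funpow[OF P]
  show "partition_on (space M) (iterated_partition M T P n)"
    unfolding iterated_partition_def using n
    by (intro partition_on_common_refinement) (auto simp: pb(1))
  show "finite (iterated_partition M T P n)"
    unfolding iterated_partition_def
    by (intro finite_common_refinement) (auto simp: pb(2))
  show "iterated_partition M T P n \<subseteq> sets M"
  proof
    fix X assume "X \<in> iterated_partition M T P n"
    then obtain g where "g \<in> (\<Pi> Q\<in>?\<P>. Q)" and X: "X = \<Inter> (g ` ?\<P>)"
      unfolding iterated_partition_def common_refinement by blast
    have g: "g Q \<in> Q" if "Q \<in> ?\<P>" for Q
      using Pi_mem[OF \<open>g \<in> _\<close> that] .
    show "X \<in> sets M"
      unfolding X
    proof (rule sets.finite_INT)
      show "g Q \<in> sets M" if "Q \<in> ?\<P>" for Q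
      proof -
        from that obtain i where "Q = pullback_partition M (T ^^ i) P" by auto
        with g[OF that] pb(3)[of i] show ?thesis by auto
      qed
    qed (use n in auto)
  qed
  show "itinerary f T n x = itinerary f T n y \<longleftrightarrow> same_block (iterated_partition M T P n) x y"
    if "x \<in> space M" "y \<in> space M" for x y
  proof -
    have "same_block (iterated_partition M T P n) x y
        \<longleftrightarrow> (\<forall>i\<in>{..<n}. same_block (pullback_partition M (T ^^ i) P) x y)"
      unfolding iterated_partition_def same_block_common_refinement by simp
    also have "\<dots> \<longleftrightarrow> (\<forall>i\<in>{..<n}. f ((T ^^ i) x) = f ((T ^^ i) y))"
      using pb(4)[OF that] f[OF funpow_T_space[OF that(1)] funpow_T_space[OF that(2)]]
      by (intro ball_cong) auto
    finally show ?thesis unfolding itinerary_eq_iff by auto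
  qed
qed

end

section \<open>Cylinders in a full shift\<close>

definition cylinder :: "'a set \<Rightarrow> nat \<Rightarrow> (nat \<Rightarrow> 'a) \<Rightarrow> (nat \<Rightarrow> 'a) set" where
  "cylinder A n x = {y \<in> full_shift A. \<forall>i<n. y i = x i}"

text \<open>The locally constant functions, with an explicit number of coordinates. Over a finite
  alphabet they are continuous and finitely valued, hence simple functions for every invariant
  measure.\<close>

definition determined :: "'a set \<Rightarrow> nat \<Rightarrow> ((nat \<Rightarrow> 'a) \<Rightarrow> 'c) \<Rightarrow> bool" where
  "determined A m f \<longleftrightarrow>
     (\<forall>x\<in>full_shift A. \<forall>y\<in>full_shift A. (\<forall>i<m. x i = y i) \<longrightarrow> f x = f y)"

lemma determinedD:
  "determined A m f \<Longrightarrow> x \<in> full_shift A \<Longrightarrow> y \<in> full_shift A \<Longrightarrow> (\<And>i. i < m \<Longrightarrow> x i = y i) \<Longrightarrow> f x = f y"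
  unfolding determined_def by blast

lemma determinedI:
  "(\<And>x y. x \<in> full_shift A \<Longrightarrow> y \<in> full_shift A \<Longrightarrow> (\<And>i. i < m \<Longrightarrow> x i = y i) \<Longrightarrow> f x = f y) \<Longrightarrow>
    determined A m f"
  unfolding determined_def by blast

lemma determined_compose: "determined A m f \<Longrightarrow> determined A m (\<lambda>x. h (f x))"
  unfolding determined_def by metis

lemma determined_compose2:
  "determined A m f \<Longrightarrow> determined A m g \<Longrightarrow> determined A m (\<lambda>x. h (f x) (g x))"
  unfolding determined_def by metis

lemma determined_mono: "determined A m f \<Longrightarrow> m \<le> n \<Longrightarrow> determined A n f"
  unfolding determined_def by (meson order_less_le_trans)

lemma funpow_left_shift: "(left_shift ^^ n) x = (\<lambda>i. x (n + i))"
  by (induction n arbitrary: x) (auto simp: left_shift_def fun_eq_iff)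

lemma openin_shift_top_iff:
  "openin (shift_top A) S \<longleftrightarrow> S \<subseteq> full_shift A \<and> (\<forall>x\<in>S. \<exists>n. cylinder A n x \<subseteq> S)"
proof safe
  fix x assume S: "openin (shift_top A) S"
  { assume "x \<in> S"
    then show "x \<in> full_shift A" using openin_subset[OF S] by auto }
  assume "x \<in> S"
  with S obtain U where U: "finite {i. U i \<noteq> A}" "x \<in> Pi\<^sub>E UNIV U" "Pi\<^sub>E UNIV U \<subseteq> S"
    unfolding shift_top_def openin_product_topology_alt by force
  from U(1) obtain n where n: "\<And>i. U i \<noteq> A \<Longrightarrow> i < n"
    unfolding finite_nat_set_iff_bounded by auto
  have "cylinder A n x \<subseteq> Pi\<^sub>E UNIV U"
  proof
    fix y assume y: "y \<in> cylinder A n x"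
    have "y i \<in> U i" for i
    proof (cases "i < n")
      case True
      then show ?thesis using y U(2) by (auto simp: cylinder_def)
    next
      case False
      then have "U i = A" using n by blast
      then show ?thesis using y by (auto simp: cylinder_def full_shift_eq)
    qed
    then show "y \<in> Pi\<^sub>E UNIV U" by auto
  qed
  with U(3) show "\<exists>n. cylinder A n x \<subseteq> S" by blast
next
  assume S: "S \<subseteq> full_shift A" and *: "\<forall>x\<in>S. \<exists>n. cylinder A n x \<subseteq> S"
  show "openin (shift_top A) S"
    unfolding shift_top_def openin_product_topology_alt
  proof
    fix x assume x: "x \<in> S"
    then obtain n where n: "cylinder A n x \<subseteq> S" using * by blast
    have xA: "x i \<in> A" for i using x S by (auto simp: full_shift_eq)
    define U where "U = (\<lambda>i. if i < n then {x i} else A)"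
    have "finite {i. U i \<noteq> A}"
      by (rule finite_subset[of _ "{..<n}"]) (auto simp: U_def)
    moreover have "U i \<subseteq> A" for i using xA by (auto simp: U_def)
    moreover have "x \<in> Pi\<^sub>E UNIV U" using xA by (auto simp: U_def)
    moreover have "Pi\<^sub>E UNIV U \<subseteq> cylinder A n x"
    proof
      fix y assume "y \<in> Pi\<^sub>E UNIV U"
      then have y: "y i \<in> U i" for i by auto
      have "y i \<in> A" for i using y[of i] \<open>U i \<subseteq> A\<close> by auto
      moreover have "y i = x i" if "i < n" for i using y[of i] that by (simp add: U_def)
      ultimately show "y \<in> cylinder A n x" by (auto simp: cylinder_def full_shift_eq)
    qed
    ultimately show "\<exists>U. finite {i \<in> UNIV. U i \<noteq> topspace (discrete_topology A)} \<and>
        (\<forall>i\<in>UNIV. openin (discrete_topology A) (U i)) \<and> x \<in> Pi\<^sub>E UNIV U \<and> Pi\<^sub>E UNIV U \<subseteq> S"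
      using n by (intro exI[of _ U]) auto
  qed
qed

lemma openin_determined:
  assumes "determined A m P"
  shows "openin (shift_top A) {x \<in> full_shift A. P x}"
  unfolding openin_shift_top_iff
proof (intro conjI ballI exI)
  fix x assume x: "x \<in> {x \<in> full_shift A. P x}"
  show "cylinder A m x \<subseteq> {x \<in> full_shift A. P x}"
  proof
    fix y assume "y \<in> cylinder A m x"
    then show "y \<in> {x \<in> full_shift A. P x}"
      using x determinedD[OF assms, of y x] by (auto simp: cylinder_def)
  qed
qed auto

lemma finite_image_determined:
  assumes A: "finite A" and f: "determined A m f"
  shows "finite (f ` full_shift A)"
proof -
  define r where "r = (\<lambda>x::nat \<Rightarrow> 'a. restrict x {..<m})"
  have "finite (r ` full_shift A)"
  proof (rule finite_subset)
    show "r ` full_shift A \<subseteq> PiE {..<m} (\<lambda>_. A)"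
    proof
      fix w assume "w \<in> r ` full_shift A"
      then obtain x where "x \<in> full_shift A" "w = restrict x {..<m}" by (auto simp: r_def)
      then show "w \<in> PiE {..<m} (\<lambda>_. A)" by (simp add: full_shift_eq)
    qed
    show "finite (PiE {..<m} (\<lambda>_. A))" using A by (intro finite_PiE) auto
  qed
  moreover have "f ` full_shift A \<subseteq> (\<lambda>w. f (inv_into (full_shift A) r w)) ` r ` full_shift A"
  proof
    fix v assume "v \<in> f ` full_shift A"
    then obtain x where x: "x \<in> full_shift A" "v = f x" by auto
    let ?y = "inv_into (full_shift A) r (r x)"
    have y: "?y \<in> full_shift A" "r ?y = r x"
      using x by (simp_all add: inv_into_into f_inv_into_f)
    have "f ?y = f x"
    proof (rule determinedD[OF f y(1) x(1)])
      show "?y i = x i" if "i < m" for i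
        using fun_cong[OF y(2), of i] that by (simp add: r_def)
    qed
    with x show "v \<in> (\<lambda>w. f (inv_into (full_shift A) r w)) ` r ` full_shift A" by force
  qed
  ultimately show ?thesis by (meson finite_imageI finite_subset)
qed

text \<open>Uniform continuity by compactness: finitely many cylinders, on each of which
  \<open>g\<close> stays within \<open>e / 2\<close> of its value at the centre, cover the shift,
  and \<open>m\<close> is the greatest of their lengths.\<close>

lemma continuous_map_shift_top_imp_determined_approx:
  assumes A: "finite A" and g: "continuous_map (shift_top A) euclideanreal g" and e: "e > 0"
  obtains m where "\<And>x y. x \<in> full_shift A \<Longrightarrow> y \<in> full_shift A \<Longrightarrow> (\<And>i. i < m \<Longrightarrow> x i = y i) \<Longrightarrow>
    \<bar>g x - g y\<bar> < e"
proof -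
  have "compact_space (shift_top A)"
    unfolding shift_top_def using A by (simp add: compact_space_product_topology compact_space_discrete_topology)
  have "\<exists>n. \<forall>y\<in>cylinder A n x. \<bar>g y - g x\<bar> < e / 2" if x: "x \<in> full_shift A" for x
  proof -
    have "openin (shift_top A) {y \<in> full_shift A. g y \<in> ball (g x) (e / 2)}"
      by (rule openin_continuous_map_preimage[OF g]) simp
    moreover have "x \<in> {y \<in> full_shift A. g y \<in> ball (g x) (e / 2)}" using x e by simp
    ultimately obtain n where "cylinder A n x \<subseteq> {y \<in> full_shift A. g y \<in> ball (g x) (e / 2)}"
      unfolding openin_shift_top_iff by blast
    then show ?thesis by (intro exI[of _ n]) (auto simp: dist_real_def abs_minus_commute)
  qed
  then obtain n where n: "\<And>x y. x \<in> full_shift A \<Longrightarrow> y \<in> cylinder A (n x) x \<Longrightarrow> \<bar>g y - g x\<bar> < e / 2"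
    by metis
  let ?U = "(\<lambda>x. cylinder A (n x) x) ` full_shift A"
  have "openin (shift_top A) U" if "U \<in> ?U" for U
  proof -
    from that obtain x where "U = cylinder A (n x) x" by auto
    then show ?thesis
      unfolding cylinder_def by (auto intro!: openin_determined[of A "n x"] simp: determined_def)
  qed
  moreover have "full_shift A \<subseteq> \<Union> ?U" by (auto simp: cylinder_def)
  ultimately obtain F where F: "finite F" "F \<subseteq> ?U" "full_shift A \<subseteq> \<Union> F"
    using \<open>compact_space (shift_top A)\<close> unfolding compact_space_alt by meson
  then obtain C where C: "C \<subseteq> full_shift A" "finite C" "F = (\<lambda>x. cylinder A (n x) x) ` C"
    by (meson finite_subset_image)
  define m where "m = Max (insert 0 (n ` C))"
  have m: "n c \<le> m" if "c \<in> C" for c unfolding m_def using C that by (intro Max_ge) auto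
  show ?thesis
  proof (rule that[of m])
    fix x y assume xy: "x \<in> full_shift A" "y \<in> full_shift A" "\<And>i. i < m \<Longrightarrow> x i = y i"
    then obtain c where c: "c \<in> C" "x \<in> cylinder A (n c) c" using F C by blast
    then have "y \<in> cylinder A (n c) c" using xy m[OF c(1)] by (auto simp: cylinder_def)
    then have "\<bar>g y - g c\<bar> < e / 2" "\<bar>g x - g c\<bar> < e / 2" using n c C by blast+
    then show "\<bar>g x - g y\<bar> < e" by linarith
  qed
qed

lemma continuous_map_left_shift: "continuous_map (shift_top A) (shift_top A) left_shift"
  unfolding continuous_map_def
proof (intro conjI allI impI)
  fix S assume "openin (shift_top A) S"
  then have S: "\<And>x. x \<in> S \<Longrightarrow> \<exists>n. cylinder A n x \<subseteq> S" by (simp add: openin_shift_top_iff)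
  show "openin (shift_top A) {x \<in> full_shift A. left_shift x \<in> S}"
    unfolding openin_shift_top_iff
  proof (intro conjI ballI)
    fix x assume x: "x \<in> {x \<in> full_shift A. left_shift x \<in> S}"
    then obtain n where n: "cylinder A n (left_shift x) \<subseteq> S" using S by auto
    have "cylinder A (Suc n) x \<subseteq> {x \<in> full_shift A. left_shift x \<in> S}"
    proof
      fix y assume y: "y \<in> cylinder A (Suc n) x"
      then have "left_shift y \<in> cylinder A n (left_shift x)"
        by (auto simp: cylinder_def left_shift_def full_shift_eq)
      with n y show "y \<in> {x \<in> full_shift A. left_shift x \<in> S}" by (auto simp: cylinder_def)
    qed
    then show "\<exists>n. cylinder A n x \<subseteq> {x \<in> full_shift A. left_shift x \<in> S}" ..
  qed auto
qed (auto simp: full_shift_eq left_shift_def)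

lemma sets_borel_on: "sets (borel_on X) = sigma_sets (topspace X) {U. openin X U}"
  unfolding borel_on_def by (rule sets_measure_of) (auto dest: openin_subset)

lemma space_borel_on: "space (borel_on X) = topspace X"
  unfolding borel_on_def by (rule space_measure_of) (auto dest: openin_subset)

lemma measurable_borel_on:
  assumes f: "continuous_map X Y f" and N: "space N = topspace X" "sets N = sets (borel_on X)"
  shows "f \<in> measurable N (borel_on Y)"
proof (rule measurable_sigma_sets[OF sets_borel_on])
  show "{U. openin Y U} \<subseteq> Pow (topspace Y)" by (auto dest: openin_subset)
  show "f \<in> space N \<rightarrow> topspace Y" using f N(1) by (auto simp: continuous_map_def)
  fix S assume "S \<in> {U. openin Y U}"
  then have "openin X {x \<in> topspace X. f x \<in> S}" using f by (auto simp: continuous_map_def)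
  moreover have "f -` S \<inter> space N = {x \<in> topspace X. f x \<in> S}" using N(1) by auto
  ultimately show "f -` S \<inter> space N \<in> sets N" unfolding N(2) sets_borel_on by auto
qed

section \<open>Invariant measures on full shifts\<close>

locale shift_measure =
  fixes A :: "'a set" and M :: "(nat \<Rightarrow> 'a) measure"
  assumes finite_A: "finite A"
    and invariant: "M \<in> invariant_measures (shift_top A) left_shift"
begin

lemma space_M: "space M = full_shift A"
  using invariant by (simp add: invariant_measures_def)

lemma sets_M: "sets M = sigma_sets (full_shift A) {U. openin (shift_top A) U}"
  using invariant by (simp add: invariant_measures_def sets_borel_on)

lemma open_sets_M: "openin (shift_top A) U \<Longrightarrow> U \<in> sets M"
  unfolding sets_M by auto

lemma measurable_left_shift: "left_shift \<in> measurable M M"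
proof -
  have "sets M = sets (borel_on (shift_top A))" using invariant by (simp add: invariant_measures_def)
  then show ?thesis
    using measurable_borel_on[OF continuous_map_left_shift[of A] space_M]
    by (subst measurable_cong_sets[of M M M "borel_on (shift_top A)"]) auto
qed

sublocale measure_preserving M left_shift
proof -
  interpret prob_space M using invariant by (simp add: invariant_measures_def)
  have "distr M M left_shift = M"
  proof (rule measure_eqI)
    fix B assume "B \<in> sets (distr M M left_shift)"
    then have B: "B \<in> sets M" by simp
    then show "emeasure (distr M M left_shift) B = emeasure M B"
      using invariant unfolding emeasure_distr[OF measurable_left_shift B] invariant_measures_def by blast
  qed simp
  then show "measure_preserving M left_shift"
    by unfold_locales (rule measurable_left_shift)
qed

lemma determined_sets: "determined A m P \<Longrightarrow> {x \<in> space M. P x} \<in> sets M"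
  unfolding space_M by (intro open_sets_M openin_determined)

lemma determined_simple_function:
  assumes "determined A m f"
  shows "simple_function M f"
  unfolding simple_function_def
proof (intro conjI ballI)
  show "finite (f ` space M)" unfolding space_M using finite_A assms by (rule finite_image_determined)
  fix v
  have "f -` {v} \<inter> space M = {x \<in> space M. f x = v}" by auto
  also have "\<dots> \<in> sets M" by (rule determined_sets[OF determined_compose[OF assms, of "\<lambda>w. w = v"]])
  finally show "f -` {v} \<inter> space M \<in> sets M" .
qed

abbreviation prefix :: "nat \<Rightarrow> (nat \<Rightarrow> 'a) \<Rightarrow> nat \<Rightarrow> 'a" where
  "prefix \<equiv> itinerary (\<lambda>x. x 0) left_shift"

lemma prefix_eq_iff: "prefix n x = prefix n y \<longleftrightarrow> (\<forall>i<n. x i = y i)"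
  by (simp add: itinerary_eq_iff funpow_left_shift)

lemma determined_prefix: "determined A n (prefix n)"
  by (simp add: determined_def prefix_eq_iff)

lemma simple_function_prefix: "simple_function M (prefix n)"
  by (rule determined_simple_function[OF determined_prefix])

section \<open>Approximation of measurable sets by cylinder sets\<close>

definition approximable :: "(nat \<Rightarrow> 'a) set \<Rightarrow> bool" where
  "approximable B \<longleftrightarrow> B \<in> sets M \<and> (\<forall>e>0. \<exists>m D. D \<subseteq> space M \<and> determined A m (\<lambda>x. x \<in> D) \<and>
     prob (B - D \<union> (D - B)) < e)"

lemma determined_sets': "D \<subseteq> space M \<Longrightarrow> determined A m (\<lambda>x. x \<in> D) \<Longrightarrow> D \<in> sets M"
  using determined_sets[of m "\<lambda>x. x \<in> D"] by (simp add: Int_absorb1 Collect_conj_eq)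

text \<open>Half of the error pays for stopping at a finite stage, by continuity of the measure from
  below, and half for approximating that stage.\<close>

lemma approximable_incseq:
  assumes B: "incseq B" "\<And>n. approximable (B n)"
  shows "approximable (\<Union>n. B n)"
  unfolding approximable_def
proof (intro conjI allI impI)
  have s: "B n \<in> sets M" for n using B(2) by (simp add: approximable_def)
  then show U: "(\<Union>n. B n) \<in> sets M" by auto
  fix e :: real assume e: "e > 0"
  have "(\<lambda>n. prob (B n)) \<longlonglongrightarrow> prob (\<Union>n. B n)"
    using s by (intro finite_Lim_measure_incseq B(1)) auto
  from LIMSEQ_D[OF this, of "e / 2"] e obtain n where "\<bar>prob (B n) - prob (\<Union>n. B n)\<bar> < e / 2" by auto
  moreover have "prob ((\<Union>n. B n) - B n) = prob (\<Union>n. B n) - prob (B n)"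
    using s U by (intro finite_measure_Diff) auto
  ultimately have n: "prob ((\<Union>n. B n) - B n) < e / 2" by linarith
  from e B(2)[of n] obtain m D where D: "D \<subseteq> space M" "determined A m (\<lambda>x. x \<in> D)"
      "prob (B n - D \<union> (D - B n)) < e / 2"
    unfolding approximable_def by (meson half_gt_zero)
  note Ds = determined_sets'[OF D(1,2)]
  have "prob ((\<Union>n. B n) - D \<union> (D - (\<Union>n. B n))) \<le> prob (((\<Union>n. B n) - B n) \<union> (B n - D \<union> (D - B n)))"
    using s U Ds by (intro finite_measure_mono) auto
  also have "\<dots> \<le> prob ((\<Union>n. B n) - B n) + prob (B n - D \<union> (D - B n))"
    using s U Ds by (intro measure_Un_le) auto
  also have "\<dots> < e" using n D(3) by linarith
  finally show "\<exists>m D. D \<subseteq> space M \<and> determined A m (\<lambda>x. x \<in> D) \<and>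
      prob ((\<Union>n. B n) - D \<union> (D - (\<Union>n. B n))) < e"
    using D by blast
qed

lemma approximable_Un:
  assumes "approximable B" "approximable C"
  shows "approximable (B \<union> C)"
  unfolding approximable_def
proof (intro conjI allI impI)
  show s: "B \<union> C \<in> sets M" using assms by (auto simp: approximable_def)
  fix e :: real assume "e > 0"
  then have e: "e / 2 > 0" by simp
  from e assms(1) obtain m D where D: "D \<subseteq> space M" "determined A m (\<lambda>x. x \<in> D)"
      "prob (B - D \<union> (D - B)) < e / 2"
    unfolding approximable_def by meson
  from e assms(2) obtain n E where E: "E \<subseteq> space M" "determined A n (\<lambda>x. x \<in> E)"
      "prob (C - E \<union> (E - C)) < e / 2"
    unfolding approximable_def by meson
  have BC: "B \<in> sets M" "C \<in> sets M" using assms by (auto simp: approximable_def)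
  note Ds = determined_sets'[OF D(1,2)] determined_sets'[OF E(1,2)]
  have "determined A (max m n) (\<lambda>x. x \<in> D \<union> E)"
    using determined_mono[OF D(2), of "max m n"] determined_mono[OF E(2), of "max m n"]
    unfolding Un_iff by (rule determined_compose2[where h = "(\<or>)"]) auto
  moreover have "prob (B \<union> C - (D \<union> E) \<union> (D \<union> E - (B \<union> C)))
      \<le> prob ((B - D \<union> (D - B)) \<union> (C - E \<union> (E - C)))"
    using BC Ds by (intro finite_measure_mono) auto
  moreover have "\<dots> \<le> prob (B - D \<union> (D - B)) + prob (C - E \<union> (E - C))"
    using BC Ds by (intro measure_Un_le) auto
  ultimately show "\<exists>m F. F \<subseteq> space M \<and> determined A m (\<lambda>x. x \<in> F) \<and>
      prob (B \<union> C - F \<union> (F - (B \<union> C))) < e"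
    using D E by (intro exI[of _ "max m n"] exI[of _ "D \<union> E"]) auto
qed

lemma approximable_determined:
  assumes "D \<subseteq> space M" "determined A m (\<lambda>x. x \<in> D)"
  shows "approximable D"
  unfolding approximable_def using determined_sets'[OF assms] assms by (auto intro!: exI[of _ m] exI[of _ D])

text \<open>The approximable sets form a sigma-algebra containing the open sets: taking complements
  leaves the symmetric difference unchanged, and countable unions are increasing limits of finite
  ones.\<close>

lemma sets_imp_approximable:
  assumes "B \<in> sets M"
  shows "approximable B"
  using assms[unfolded sets_M]
proof (induction rule: sigma_sets.induct)
  case (Basic S)
  then have S: "S \<subseteq> full_shift A" "\<And>x. x \<in> S \<Longrightarrow> \<exists>n. cylinder A n x \<subseteq> S"
    by (auto simp: openin_shift_top_iff)
  \<comment> \<open>The union of the cylinders of length \<open>n\<close> inside \<open>S\<close>;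
    these sets increase to \<open>S\<close> because \<open>S\<close> is open.\<close>
  define D where "D = (\<lambda>n. {x \<in> full_shift A. cylinder A n x \<subseteq> S})"
  have "approximable (D n)" for n
  proof (rule approximable_determined)
    show "determined A n (\<lambda>x. x \<in> D n)"
      by (auto simp: determined_def D_def cylinder_def)
  qed (auto simp: D_def space_M)
  moreover have "incseq D"
    unfolding incseq_def D_def cylinder_def by auto
  moreover have "(\<Union>n. D n) = S"
  proof
    show "(\<Union>n. D n) \<subseteq> S" by (auto simp: D_def cylinder_def)
    show "S \<subseteq> (\<Union>n. D n)" using S by (auto simp: D_def)
  qed
  ultimately show ?case using approximable_incseq[of D] by simp
next
  case Empty
  show ?case by (rule approximable_determined[of _ 0]) (auto simp: determined_def)
next
  case (Compl B)
  then have Bs: "B \<in> sets M" by (simp add: approximable_def)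
  then have Bsub: "B \<subseteq> full_shift A" using sets.sets_into_space space_M by blast
  show ?case
    unfolding approximable_def
  proof (intro conjI allI impI)
    show "full_shift A - B \<in> sets M" using sets.compl_sets[OF Bs] by (simp add: space_M)
    fix e :: real assume "e > 0"
    with Compl obtain m D where D: "D \<subseteq> space M" "determined A m (\<lambda>x. x \<in> D)"
        "prob (B - D \<union> (D - B)) < e"
      unfolding approximable_def by meson
    have "determined A m (\<lambda>x. x \<in> full_shift A - D)"
    proof (rule determinedI)
      fix x y assume xy: "x \<in> full_shift A" "y \<in> full_shift A" "\<And>i. i < m \<Longrightarrow> x i = y i"
      show "(x \<in> full_shift A - D) = (y \<in> full_shift A - D)"
        using determinedD[OF D(2) xy] xy(1,2) by simp
    qed
    moreover have "(full_shift A - B) - (full_shift A - D) \<union> ((full_shift A - D) - (full_shift A - B))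
        = B - D \<union> (D - B)"
      using D(1) Bsub by (auto simp: space_M)
    ultimately show "\<exists>m D. D \<subseteq> space M \<and> determined A m (\<lambda>x. x \<in> D) \<and>
        prob ((full_shift A - B) - D \<union> (D - (full_shift A - B))) < e"
      using D(3) by (intro exI[of _ m] exI[of _ "full_shift A - D"]) (auto simp: space_M)
  qed
next
  case (Union B)
  have "approximable (\<Union>i<n. B i)" for n
  proof (induction n)
    case 0
    show ?case by (rule approximable_determined[of _ 0]) (auto simp: determined_def)
  next
    case (Suc n)
    have "(\<Union>i<Suc n. B i) = (\<Union>i<n. B i) \<union> B n" by (auto simp: less_Suc_eq)
    then show ?case using approximable_Un[OF Suc Union.IH[of n]] by simp
  qed
  moreover have "incseq (\<lambda>n. \<Union>i<n. B i)" unfolding incseq_def by (intro allI impI UN_mono) auto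
  ultimately have "approximable (\<Union>n. \<Union>i<n. B i)" by (intro approximable_incseq) auto
  also have "(\<Union>n. \<Union>i<n. B i) = (\<Union>i. B i)" by auto
  finally show ?case .
qed

end

section \<open>The Kolmogorov--Sinai theorem for the coordinate partition\<close>

definition block_of :: "'b set set \<Rightarrow> 'b \<Rightarrow> 'b set" where
  "block_of P x = (THE B. B \<in> P \<and> x \<in> B)"

lemma block_of:
  assumes P: "partition_on X P" and x: "x \<in> X"
  shows "block_of P x \<in> P" "x \<in> block_of P x"
    and "B \<in> P \<Longrightarrow> x \<in> B \<Longrightarrow> block_of P x = B"
proof -
  have uniq: "B = C" if "B \<in> P" "x \<in> B" "C \<in> P" "x \<in> C" for B C
    using P that unfolding partition_on_def disjoint_def by blast
  obtain C where C: "C \<in> P" "x \<in> C" using P x unfolding partition_on_def by blast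
  have eq: "block_of P x = B" if "B \<in> P" "x \<in> B" for B
    unfolding block_of_def using that uniq by (intro the_equality) blast+
  show "block_of P x \<in> P" "x \<in> block_of P x" using eq[OF C] C by auto
  show "B \<in> P \<Longrightarrow> x \<in> B \<Longrightarrow> block_of P x = B" by (rule eq)
qed

lemma block_of_eq_iff:
  assumes P: "partition_on X P" and x: "x \<in> X" and y: "y \<in> X"
  shows "block_of P x = block_of P y \<longleftrightarrow> same_block P x y"
proof
  assume "block_of P x = block_of P y"
  then show "same_block P x y"
    unfolding same_block_def using block_of(1,2)[OF P x] block_of(2)[OF P y] by auto
next
  assume "same_block P x y"
  then obtain B where "B \<in> P" "x \<in> B" "y \<in> B" unfolding same_block_def by blast
  then show "block_of P x = block_of P y"
    using block_of(3)[OF P x, of B] block_of(3)[OF P y, of B] by simp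
qed

context shift_measure
begin

lemma simple_function_block_of:
  assumes P: "partition_on (space M) P" "finite P" "P \<subseteq> sets M"
  shows "simple_function M (block_of P)" and "block_of P ` space M \<subseteq> P"
proof -
  show sub: "block_of P ` space M \<subseteq> P" using block_of(1)[OF P(1)] by auto
  have "block_of P -` {B} \<inter> space M \<in> sets M" if "B \<in> P" for B
  proof -
    have "B \<subseteq> space M" using P(1) that unfolding partition_on_def by blast
    have "block_of P -` {B} \<inter> space M = B"
    proof (intro equalityI subsetI)
      fix x assume "x \<in> block_of P -` {B} \<inter> space M"
      then show "x \<in> B" using block_of(2)[OF P(1), of x] by auto
    next
      fix x assume "x \<in> B"
      then show "x \<in> block_of P -` {B} \<inter> space M"
        using block_of(3)[OF P(1) _ that, of x] \<open>B \<subseteq> space M\<close> by auto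
    qed
    then show ?thesis using P(3) that by auto
  qed
  then show "simple_function M (block_of P)"
    unfolding simple_function_def using sub finite_subset[OF sub P(2)] by blast
qed

lemma approximate_partition:
  assumes P: "partition_on (space M) P" "finite P" "P \<subseteq> sets M" and e: "e > 0"
  obtains m g where "determined A m g" "\<And>x. x \<in> space M \<Longrightarrow> g x \<in> P"
    "prob {x\<in>space M. g x \<noteq> block_of P x} < e"
proof -
  define d where "d = e / (real (card P) + 1)"
  have d: "d > 0" using e by (simp add: d_def)
  have "\<exists>m D. D \<subseteq> space M \<and> determined A m (\<lambda>x. x \<in> D) \<and> prob (B - D \<union> (D - B)) < d" if "B \<in> P" for B
    using sets_imp_approximable[of B] P(3) that d unfolding approximable_def by blast
  then obtain m D where D: "\<And>B. B \<in> P \<Longrightarrow> D B \<subseteq> space M" "\<And>B. B \<in> P \<Longrightarrow> determined A (m B) (\<lambda>x. x \<in> D B)"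
      "\<And>B. B \<in> P \<Longrightarrow> prob (B - D B \<union> (D B - B)) < d"
    by metis
  have Ds: "D B \<in> sets M" if "B \<in> P" for B using determined_sets'[OF D(1,2)[OF that]] .
  obtain x0 where "x0 \<in> space M" using not_empty by auto
  then have "P \<noteq> {}" using P(1) unfolding partition_on_def by blast
  then obtain B0 where B0: "B0 \<in> P" by auto
  \<comment> \<open>The sets \<open>D B\<close> may overlap or miss points, so \<open>pick\<close>
    settles ties arbitrarily and falls back on \<open>B0\<close>. Outside the symmetric differences
    of the \<open>B\<close> and \<open>D B\<close>, exactly one \<open>D B\<close> contains
    \<open>x\<close>, namely that of its own block.\<close>
  define S where "S = (\<lambda>x. {B\<in>P. x \<in> D B})"
  define pick where "pick = (\<lambda>S. if S = {} then B0 else (SOME B. B \<in> S))"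
  define g where "g = (\<lambda>x. pick (S x))"
  define n where "n = Max (m ` P)"
  have mn: "m B \<le> n" if "B \<in> P" for B unfolding n_def using P(2) that by simp
  have "determined A n S"
  proof (rule determinedI)
    fix x y assume xy: "x \<in> full_shift A" "y \<in> full_shift A" "\<And>i. i < n \<Longrightarrow> x i = y i"
    have "x \<in> D B \<longleftrightarrow> y \<in> D B" if "B \<in> P" for B
      using determinedD[OF determined_mono[OF D(2)[OF that] mn[OF that]] xy] .
    then show "S x = S y" unfolding S_def by blast
  qed
  then have "determined A n g" unfolding g_def by (rule determined_compose)
  moreover have "g x \<in> P" for x
  proof (cases "S x = {}")
    case False
    then have "(SOME B. B \<in> S x) \<in> S x" by (simp add: some_in_eq)
    then have "(SOME B. B \<in> S x) \<in> P" by (simp add: S_def)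
    then show ?thesis using False by (simp add: g_def pick_def)
  qed (simp add: g_def pick_def B0)
  moreover have "prob {x\<in>space M. g x \<noteq> block_of P x} < e"
  proof -
    have "{x\<in>space M. g x \<noteq> block_of P x} \<subseteq> (\<Union>B\<in>P. B - D B \<union> (D B - B))"
    proof
      fix x assume "x \<in> {x\<in>space M. g x \<noteq> block_of P x}"
      then have x: "x \<in> space M" and ne: "g x \<noteq> block_of P x" by auto
      show "x \<in> (\<Union>B\<in>P. B - D B \<union> (D B - B))"
      proof (rule ccontr)
        assume "x \<notin> (\<Union>B\<in>P. B - D B \<union> (D B - B))"
        then have "x \<in> D B \<longleftrightarrow> x \<in> B" if "B \<in> P" for B using that by blast
        then have "S x = {block_of P x}"
          unfolding S_def using block_of[OF P(1) x] by blast
        then have "g x = block_of P x" by (simp add: g_def pick_def)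
        with ne show False ..
      qed
    qed
    then have "prob {x\<in>space M. g x \<noteq> block_of P x} \<le> prob (\<Union>B\<in>P. B - D B \<union> (D B - B))"
      using P Ds by (intro finite_measure_mono sets.finite_UN) auto
    also have "\<dots> \<le> (\<Sum>B\<in>P. prob (B - D B \<union> (D B - B)))"
      using P Ds by (intro finite_measure_subadditive_finite) auto
    also have "\<dots> \<le> (\<Sum>B\<in>P. d)" using D(3) by (intro sum_mono) (rule less_imp_le)
    also have "\<dots> < e" using e unfolding d_def by (simp add: field_simps)
    finally show ?thesis .
  qed
  ultimately show ?thesis using that by blast
qed

text \<open>Each further symbol of the itinerary of \<open>f\<close> costs at most the cross entropy of \<open>f\<close>
  given its approximation \<open>g\<close>, which can be read off the prefix.\<close>

lemma itinerary_entropy_le_prefix_entropy: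
  assumes f: "simple_function M f" and g: "determined A m g"
    and K: "\<And>u v. u \<in> g ` space M \<Longrightarrow> v \<in> f ` space M \<Longrightarrow> 0 < K u v"
      "\<And>u. u \<in> g ` space M \<Longrightarrow> (\<Sum>v\<in>f ` space M. K u v) \<le> 1"
  shows "fiber_entropy M (itinerary f left_shift n)
    \<le> fiber_entropy M (prefix (n + m)) + real n * (\<integral>x. - ln (K (g x) (f x)) \<partial>M)"
proof -
  let ?c = "\<integral>x. - ln (K (g x) (f x)) \<partial>M" and ?N = "n + m"
  note gs = determined_simple_function[OF g]
  \<comment> \<open>The whole prefix is kept next to the growing itinerary. Since
    \<open>j < n\<close>, a prefix of length \<open>n + m\<close> determines \<open>g\<close> after
    \<open>j\<close> shifts, so adjoining that value costs no entropy and \<open>K\<close> can use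
    it to guess the next symbol.\<close>
  have step: "fiber_entropy M (\<lambda>x. (prefix ?N x, itinerary f left_shift j x))
      \<le> fiber_entropy M (prefix ?N) + real j * ?c" if "j \<le> n" for j
    using that
  proof (induction j)
    case 0
    have "fiber_entropy M (\<lambda>x. (prefix ?N x, itinerary f left_shift 0 x)) = fiber_entropy M (prefix ?N)"
      by (rule fiber_entropy_cong) (auto simp: itinerary_eq_iff)
    then show ?case by simp
  next
    case (Suc j)
    let ?T = "\<lambda>x. (left_shift ^^ j) x"
    let ?q = "\<lambda>x. (prefix ?N x, itinerary f left_shift j x)"
    have q: "simple_function M ?q"
      by (rule simple_function_Pair[OF simple_function_prefix simple_function_itinerary[OF f]])
    have fT: "simple_function M (\<lambda>x. f (?T x))" and gT: "simple_function M (\<lambda>x. g (?T x))"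
      by (rule simple_function_comp[OF measurable_funpow_T]; rule f gs)+
    have g_eq: "g (?T x) = g (?T y)" if "x \<in> space M" "y \<in> space M" "prefix ?N x = prefix ?N y" for x y
      using that Suc.prems funpow_T_space[of x j] funpow_T_space[of y j]
      by (intro determinedD[OF g]) (auto simp: prefix_eq_iff funpow_left_shift space_M)
    have "fiber_entropy M (\<lambda>x. (prefix ?N x, itinerary f left_shift (Suc j) x))
        = fiber_entropy M (\<lambda>x. ((?q x, g (?T x)), f (?T x)))"
    proof (rule fiber_entropy_cong)
      fix x y assume "x \<in> space M" "y \<in> space M"
      moreover have "itinerary f left_shift (Suc j) x = itinerary f left_shift (Suc j) y \<longleftrightarrow>
          itinerary f left_shift j x = itinerary f left_shift j y \<and> f (?T x) = f (?T y)"
        unfolding itinerary_eq_iff less_Suc_eq by blast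
      ultimately show "((prefix ?N x, itinerary f left_shift (Suc j) x) = (prefix ?N y, itinerary f left_shift (Suc j) y))
        \<longleftrightarrow> (((?q x, g (?T x)), f (?T x)) = ((?q y, g (?T y)), f (?T y)))"
        using g_eq[of x y] unfolding prod.inject by blast
    qed
    also have "\<dots> \<le> fiber_entropy M (\<lambda>x. (?q x, g (?T x)))
        + (\<integral>x. - ln (K (snd (?q x, g (?T x))) (f (?T x))) \<partial>M)"
    proof (rule fiber_entropy_pair_le[OF fT simple_function_Pair[OF q gT], of "\<lambda>u. K (snd u)"])
      have sub: "(\<lambda>x. f (?T x)) ` space M \<subseteq> f ` space M" "(\<lambda>x. g (?T x)) ` space M \<subseteq> g ` space M"
        using funpow_T_space by auto
      fix u assume "u \<in> (\<lambda>x. (?q x, g (?T x))) ` space M"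
      then have u: "snd u \<in> g ` space M" using sub(2) by auto
      show "0 \<le> K (snd u) v" "0 < K (snd u) v" if "v \<in> (\<lambda>x. f (?T x)) ` space M" for v
        using K(1)[OF u, of v] that sub(1) by auto
      have "(\<Sum>v\<in>(\<lambda>x. f (?T x)) ` space M. K (snd u) v) \<le> (\<Sum>v\<in>f ` space M. K (snd u) v)"
        using K(1)[OF u] sub(1) simple_functionD(1)[OF f] by (intro sum_mono2) (auto simp: less_imp_le)
      then show "(\<Sum>v\<in>(\<lambda>x. f (?T x)) ` space M. K (snd u) v) \<le> 1" using K(2)[OF u] by linarith
    qed
    also have "fiber_entropy M (\<lambda>x. (?q x, g (?T x))) = fiber_entropy M ?q"
    proof (rule fiber_entropy_cong)
      fix x y assume "x \<in> space M" "y \<in> space M"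
      then show "((?q x, g (?T x)) = (?q y, g (?T y))) \<longleftrightarrow> ?q x = ?q y"
        using g_eq[of x y] unfolding prod.inject by blast
    qed
    also have "(\<integral>x. - ln (K (snd (?q x, g (?T x))) (f (?T x))) \<partial>M) = ?c"
    proof -
      have "simple_function M (\<lambda>x. - ln (K (g x) (f x)))"
        using simple_function_compose2[OF gs f, of "\<lambda>u v. - ln (K u v)"] .
      from integral_funpow_T[OF borel_measurable_simple_function[OF this], of j] show ?thesis by simp
    qed
    also have "fiber_entropy M ?q \<le> fiber_entropy M (prefix ?N) + real j * ?c"
      using Suc by simp
    finally show ?case by (simp add: algebra_simps)
  qed
  have "fiber_entropy M (itinerary f left_shift n) \<le> fiber_entropy M (\<lambda>x. (prefix ?N x, itinerary f left_shift n x))"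
    by (rule fiber_entropy_le_pair[OF simple_function_itinerary[OF f] simple_function_prefix])
  also have "\<dots> \<le> fiber_entropy M (prefix ?N) + real n * ?c" by (rule step) simp
  finally show ?thesis .
qed

text \<open>A Fano-type estimate. The guess puts mass \<open>1 - t\<close> on the approximating
  block and spreads \<open>t\<close> evenly over all blocks. A correct guess costs at most
  \<open>- ln (1 - t)\<close>, a wrong one exactly \<open>ln (r / t)\<close>, and wrong guesses are
  made rare only after \<open>t\<close> is fixed.\<close>

lemma partition_cross_entropy_small:
  assumes P: "partition_on (space M) P" "finite P" "P \<subseteq> sets M" and e: "e > 0"
  obtains m c where "c \<le> e" "\<forall>n. fiber_entropy M (itinerary (block_of P) left_shift n)
    \<le> fiber_entropy M (prefix (n + m)) + real n * c"
proof -
  let ?f = "block_of P"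
  define r where "r = real (card P)"
  obtain x0 where "x0 \<in> space M" using not_empty by auto
  then have "P \<noteq> {}" using P(1) unfolding partition_on_def by blast
  then have r: "r \<ge> 1" using P(2) unfolding r_def by (simp add: Suc_leI card_gt_0_iff)
  \<comment> \<open>Chosen so that a correct guess costs at most \<open>e / 2\<close>.\<close>
  define t where "t = 1 - exp (- (e / 2))"
  have t: "0 < t" "t < 1" "- ln (1 - t) = e / 2" using e by (auto simp: t_def)
  define L where "L = ln (r / t)"
  have L: "L \<ge> 0" unfolding L_def using r t by (intro ln_ge_zero) (simp add: field_simps)
  \<comment> \<open>With failure probability below \<open>d\<close> the wrong guesses contribute at
    most \<open>L * d \<le> e / 2\<close>; the summand 1 keeps the denominator positive.\<close>
  define d where "d = e / 2 / (L + 1)"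
  have d: "d > 0" using e L by (simp add: d_def)
  obtain m g where g: "determined A m g" "\<And>x. x \<in> space M \<Longrightarrow> g x \<in> P"
      and pd: "prob {x\<in>space M. g x \<noteq> ?f x} < d"
    using approximate_partition[OF P d] by blast
  define K :: "(nat \<Rightarrow> 'a) set \<Rightarrow> (nat \<Rightarrow> 'a) set \<Rightarrow> real" where
    "K = (\<lambda>u v. (if v = u then 1 - t else 0) + t / r)"
  note f = simple_function_block_of(1)[OF P] and fP = simple_function_block_of(2)[OF P]
  note gs = determined_simple_function[OF g(1)]
  have Kpos: "0 < K u v" for u v unfolding K_def using t r by (simp add: add_nonneg_pos)
  have Ksum: "(\<Sum>v\<in>?f ` space M. K u v) \<le> 1" if "u \<in> g ` space M" for u
  proof -
    have u: "u \<in> P" using that g(2) by auto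
    have "(\<Sum>v\<in>?f ` space M. K u v) \<le> (\<Sum>v\<in>P. K u v)"
      using Kpos by (intro sum_mono2 P(2) fP) (simp add: less_imp_le)
    also have "\<dots> = 1" using u P(2) r \<open>P \<noteq> {}\<close> by (simp add: K_def sum.distrib r_def)
    finally show ?thesis .
  qed
  define c where "c = (\<integral>x. - ln (K (g x) (?f x)) \<partial>M)"
  have "{x\<in>space M. g x \<noteq> ?f x} \<in> sets M"
  proof -
    have "simple_function M (\<lambda>x. g x \<noteq> ?f x)" using simple_function_compose2[OF gs f] .
    from simple_function_fiber_sets[OF this, of True] show ?thesis by simp
  qed
  then have ind: "integrable M (\<lambda>x. e / 2 + L * indicator {x\<in>space M. g x \<noteq> ?f x} x)"
    by (intro Bochner_Integration.integrable_add integrable_mult_right integrable_real_indicator)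
      (auto simp: emeasure_eq_measure)
  have "c \<le> (\<integral>x. e / 2 + L * indicator {x\<in>space M. g x \<noteq> ?f x} x \<partial>M)"
    unfolding c_def
  proof (rule integral_mono[OF _ ind])
    show "integrable M (\<lambda>x. - ln (K (g x) (?f x)))"
      using integral_simple_function(1)[OF simple_function_Pair[OF gs f], of "\<lambda>(u, v). - ln (K u v)"] by simp
    fix x assume x: "x \<in> space M"
    show "- ln (K (g x) (?f x)) \<le> e / 2 + L * indicator {x\<in>space M. g x \<noteq> ?f x} x"
    proof (cases "g x = ?f x")
      case True
      have "ln (1 - t) \<le> ln (K (g x) (?f x))"
        using t r True by (intro ln_mono) (auto simp: K_def)
      then show ?thesis using t True by simp
    next
      case False
      then have "- ln (K (g x) (?f x)) = L"
        using r t by (simp add: K_def L_def ln_div)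
      then show ?thesis using False e x by simp
    qed
  qed
  also have "\<dots> = e / 2 + L * prob {x\<in>space M. g x \<noteq> ?f x}"
  proof -
    have "integrable M (\<lambda>x. L * indicator {x\<in>space M. g x \<noteq> ?f x} x)"
      using \<open>{x\<in>space M. g x \<noteq> ?f x} \<in> sets M\<close>
      by (intro integrable_mult_right integrable_real_indicator) (auto simp: emeasure_eq_measure)
    moreover have "{x\<in>space M. g x \<noteq> ?f x} \<inter> space M = {x\<in>space M. g x \<noteq> ?f x}" by auto
    ultimately show ?thesis by (simp add: prob_space)
  qed
  also have "L * prob {x\<in>space M. g x \<noteq> ?f x} \<le> L * d" using pd L by (intro mult_left_mono) auto
  also have "L * d \<le> e / 2"
  proof -
    have "L * (e / 2) \<le> e / 2 * (L + 1)" using e by (simp add: algebra_simps)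
    then show ?thesis unfolding d_def using L by (simp add: field_simps)
  qed
  finally have "c \<le> e" by simp
  then show ?thesis
    using that itinerary_entropy_le_prefix_entropy[OF f g(1), of K, OF Kpos Ksum] unfolding c_def by blast
qed

lemma coordinate_partition:
  defines "P \<equiv> (\<lambda>b. {x\<in>space M. x 0 = b}) ` A - {{}}"
  shows "partition_on (space M) P" "finite P" "P \<subseteq> sets M"
    and "x \<in> space M \<Longrightarrow> y \<in> space M \<Longrightarrow> x 0 = y 0 \<longleftrightarrow> same_block P x y"
proof -
  show "finite P" unfolding P_def using finite_A by simp
  have "determined A 1 (\<lambda>x. x 0 = b)" for b by (simp add: determined_def)
  then show "P \<subseteq> sets M" unfolding P_def using determined_sets by blast
  have blk: "{z\<in>space M. z 0 = x 0} \<in> P" if "x \<in> space M" for x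
  proof -
    have "x 0 \<in> A" using that by (simp add: space_M full_shift_eq)
    then show ?thesis unfolding P_def using that by blast
  qed
  show "partition_on (space M) P"
  proof (rule partition_onI)
    show "\<Union> P = space M" using blk unfolding P_def by blast
    show "disjnt X Y" if "X \<in> P" "Y \<in> P" "X \<noteq> Y" for X Y
    proof -
      obtain b c where "X = {x\<in>space M. x 0 = b}" "Y = {x\<in>space M. x 0 = c}"
        using \<open>X \<in> P\<close> \<open>Y \<in> P\<close> unfolding P_def by blast
      with \<open>X \<noteq> Y\<close> show ?thesis by (auto simp: disjnt_def)
    qed
  qed (simp add: P_def)
  show "x 0 = y 0 \<longleftrightarrow> same_block P x y" if "x \<in> space M" "y \<in> space M"
  proof
    assume "x 0 = y 0"
    then show "same_block P x y"
      unfolding same_block_def using blk[OF that(1)] that by (intro bexI) auto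
  next
    assume "same_block P x y"
    then show "x 0 = y 0" by (auto simp: same_block_def P_def)
  qed
qed

lemma lim_partition_entropy:
  assumes P: "partition_on (space M) P" "finite P" "P \<subseteq> sets M"
    and f: "\<And>x y. x \<in> space M \<Longrightarrow> y \<in> space M \<Longrightarrow> f x = f y \<longleftrightarrow> same_block P x y"
    and h: "(\<lambda>n. fiber_entropy M (itinerary f left_shift n) / real n) \<longlonglongrightarrow> h"
  shows "lim (\<lambda>n. (1 / real n) * partition_entropy M (iterated_partition M left_shift P n)) = h"
proof (rule limI)
  have "\<forall>\<^sub>F n in sequentially. fiber_entropy M (itinerary f left_shift n) / real n
      = (1 / real n) * partition_entropy M (iterated_partition M left_shift P n)"
    using eventually_gt_at_top[of 0]
    by eventually_elim (simp add: iterated_partition_entropy[OF P f])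
  then show "(\<lambda>n. (1 / real n) * partition_entropy M (iterated_partition M left_shift P n)) \<longlonglongrightarrow> h"
    using h by (rule Lim_transform_eventually[rotated])
qed

text \<open>The coordinate partition attains the supremum: a cylinder approximation of any other
  partition is read off a prefix longer by a constant \<open>m\<close>, and both this
  \<open>m\<close> and the arbitrarily small cost per symbol disappear in the limit.\<close>

theorem kolmogorov_sinai:
  obtains h where "0 \<le> h" "\<And>n. n > 0 \<Longrightarrow> h \<le> fiber_entropy M (prefix n) / real n"
    "(\<lambda>n. fiber_entropy M (prefix n) / real n) \<longlonglongrightarrow> h"
    "measure_entropy M left_shift = ereal h"
proof -
  have s0: "simple_function M (\<lambda>x. x 0)"
    by (rule determined_simple_function[of 1]) (simp add: determined_def)
  obtain h where h: "0 \<le> h" "\<And>n. n > 0 \<Longrightarrow> h \<le> fiber_entropy M (prefix n) / real n"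
    "(\<lambda>n. fiber_entropy M (prefix n) / real n) \<longlonglongrightarrow> h"
    using itinerary_entropy_rate[OF s0] by blast
  let ?lim = "\<lambda>P. lim (\<lambda>n. (1 / real n) * partition_entropy M (iterated_partition M left_shift P n))"
  have le: "?lim P \<le> h" if P: "partition_on (space M) P" "finite P" "P \<subseteq> sets M" for P
  proof -
    obtain h' where h': "(\<lambda>n. fiber_entropy M (itinerary (block_of P) left_shift n) / real n) \<longlonglongrightarrow> h'"
      using itinerary_entropy_rate[OF simple_function_block_of(1)[OF P]] by blast
    have "h' \<le> h + e" if e: "e > 0" for e
    proof -
      obtain m c where c: "c \<le> e" "\<forall>n. fiber_entropy M (itinerary (block_of P) left_shift n)
          \<le> fiber_entropy M (prefix (n + m)) + real n * c"
        using partition_cross_entropy_small[OF P e] by metis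
      have l1: "(\<lambda>n. fiber_entropy M (prefix (n + m)) / real (n + m)) \<longlonglongrightarrow> h"
        using LIMSEQ_ignore_initial_segment[OF h(3), of m] .
      have l2: "(\<lambda>n. real (n + m) / real n) \<longlonglongrightarrow> 1" by real_asymp
      have "(\<lambda>n. fiber_entropy M (prefix (n + m)) / real (n + m) * (real (n + m) / real n) + e) \<longlonglongrightarrow> h * 1 + e"
        by (rule tendsto_add[OF tendsto_mult[OF l1 l2] tendsto_const])
      moreover have "\<forall>\<^sub>F n in sequentially. fiber_entropy M (itinerary (block_of P) left_shift n) / real n
          \<le> fiber_entropy M (prefix (n + m)) / real (n + m) * (real (n + m) / real n) + e"
        using eventually_gt_at_top[of 0]
      proof eventually_elim
        case (elim n)
        have "fiber_entropy M (itinerary (block_of P) left_shift n) / real n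
            \<le> (fiber_entropy M (prefix (n + m)) + real n * c) / real n"
          using c(2) by (intro divide_right_mono) auto
        also have "\<dots> = fiber_entropy M (prefix (n + m)) / real n + c" using elim by (simp add: field_simps)
        also have "\<dots> \<le> fiber_entropy M (prefix (n + m)) / real (n + m) * (real (n + m) / real n) + e"
          using c(1) elim by simp
        finally show ?case .
      qed
      ultimately have "h' \<le> h * 1 + e" by (intro tendsto_le[OF trivial_limit_sequentially _ h'])
      then show ?thesis by simp
    qed
    then have "h' \<le> h" by (rule field_le_epsilon)
    then show ?thesis using lim_partition_entropy[OF P block_of_eq_iff[OF P(1)] h'] by simp
  qed
  have "measure_entropy M left_shift = ereal h"
    unfolding measure_entropy_def
  proof (rule antisym)
    show "(SUP P\<in>{P. finite P \<and> partition_on (space M) P \<and> P \<subseteq> sets M}. ereal (?lim P)) \<le> ereal h"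
      using le by (intro SUP_least) auto
    let ?C = "(\<lambda>b. {x\<in>space M. x 0 = b}) ` A - {{}}"
    have "?lim ?C = h"
      by (rule lim_partition_entropy[OF coordinate_partition h(3)])
    moreover have "?C \<in> {P. finite P \<and> partition_on (space M) P \<and> P \<subseteq> sets M}"
      using coordinate_partition(1-3) by simp
    ultimately show "ereal h \<le> (SUP P\<in>{P. finite P \<and> partition_on (space M) P \<and> P \<subseteq> sets M}. ereal (?lim P))"
      by (intro SUP_upper2[of ?C]) auto
  qed
  with h that show ?thesis by blast
qed

end

section \<open>Hausdorff dimension\<close>

lemma diam_powr_le:
  assumes d: "\<And>x y. x \<in> U \<Longrightarrow> y \<in> U \<Longrightarrow> 0 \<le> d x y" "\<And>x y. x \<in> U \<Longrightarrow> y \<in> U \<Longrightarrow> d x y \<le> r"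
    and r: "0 < r" and s: "0 \<le> s"
  shows "diam_powr d s U \<le> ennreal (r powr s)"
proof (cases "U = {} \<or> s = 0")
  case True
  then show ?thesis using r by (auto simp: diam_powr_def)
next
  case False
  then obtain x where x: "x \<in> U" by auto
  have bdd: "bdd_above ((\<lambda>(x, y). d x y) ` (U \<times> U))" using d(2) by (auto intro!: bdd_aboveI[of _ r])
  have "(SUP (x, y)\<in>U \<times> U. d x y) \<le> r" using x d(2) by (intro cSUP_least) auto
  moreover have "0 \<le> (SUP (x, y)\<in>U \<times> U. d x y)"
    using x d(1)[OF x x] by (intro cSUP_upper2[OF bdd, of "(x, x)"]) auto
  ultimately show ?thesis
    using False s by (auto simp: diam_powr_def intro!: ennreal_leI powr_mono2)
qed

lemma hausdorff_measure_eq_0I: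
  assumes "\<And>\<delta> \<epsilon>. \<delta> > 0 \<Longrightarrow> \<epsilon> > 0 \<Longrightarrow>
    \<exists>U\<in>delta_covers X d \<delta> E. (\<Sum>i. diam_powr d s (U i)) \<le> ennreal \<epsilon>"
  shows "hausdorff_measure X d s E = 0"
proof -
  have "(INF U\<in>delta_covers X d \<delta> E. \<Sum>i. diam_powr d s (U i)) = 0" if \<delta>: "\<delta> > 0" for \<delta>
  proof -
    have "(INF U\<in>delta_covers X d \<delta> E. \<Sum>i. diam_powr d s (U i)) \<le> 0 + ennreal \<epsilon>" if "\<epsilon> > 0" for \<epsilon>
    proof -
      obtain U where U: "U \<in> delta_covers X d \<delta> E" "(\<Sum>i. diam_powr d s (U i)) \<le> ennreal \<epsilon>"
        using assms[OF \<delta> \<open>\<epsilon> > 0\<close>] by blast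
      show ?thesis by (rule INF_lower2[OF U(1)]) (use U(2) in simp)
    qed
    then have "(INF U\<in>delta_covers X d \<delta> E. \<Sum>i. diam_powr d s (U i)) \<le> 0"
      by (rule ennreal_le_epsilon)
    then show ?thesis by simp
  qed
  then show ?thesis unfolding hausdorff_measure_def by simp
qed

text \<open>A point belongs to the covers from some index on, so the union of all \<open>V n\<close>
  with \<open>n \<ge> N\<close> covers \<open>E\<close> for every \<open>N\<close>. In dimension
  \<open>s + \<eta>\<close> it costs at most the tail of a geometric series with ratio
  \<open>exp (- \<eta>)\<close>.\<close>

lemma hausdorff_dim_le:
  assumes V: "\<And>n. finite (V n)" "\<And>n. real (card (V n)) \<le> exp (real n * s)"
    and sub: "\<And>n U. U \<in> V n \<Longrightarrow> U \<subseteq> X"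
    and diam: "\<And>n U x y. U \<in> V n \<Longrightarrow> x \<in> U \<Longrightarrow> y \<in> U \<Longrightarrow> d x y \<le> exp (- real n)"
    and nonneg: "\<And>x y. x \<in> X \<Longrightarrow> y \<in> X \<Longrightarrow> 0 \<le> d x y"
    and cover: "\<And>x. x \<in> E \<Longrightarrow> \<forall>\<^sub>F n in sequentially. x \<in> \<Union> (V n)"
    and s: "0 \<le> s"
  shows "hausdorff_dim X d E \<le> ereal s"
proof -
  have "hausdorff_dim X d E \<le> ereal s + ereal \<eta>" if \<eta>: "\<eta> > 0" for \<eta>
  proof -
    have "hausdorff_measure X d (s + \<eta>) E = 0"
    proof (rule hausdorff_measure_eq_0I)
      fix \<delta> \<epsilon> :: real assume \<delta>: "\<delta> > 0" and \<epsilon>: "\<epsilon> > 0"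
      define q where "q = exp (- \<eta>)"
      have q: "0 < q" "q < 1" using \<eta> by (auto simp: q_def)
      have "(\<lambda>N. q ^ N / (1 - q)) \<longlonglongrightarrow> 0 / (1 - q)"
        using q by (intro tendsto_intros LIMSEQ_power_zero) auto
      then have "\<forall>\<^sub>F N in sequentially. q ^ N / (1 - q) < \<epsilon>"
        using \<epsilon> by (intro order_tendstoD(2)) auto
      moreover have "\<forall>\<^sub>F N in sequentially. exp (- real N) < \<delta>"
      proof (rule order_tendstoD(2)[OF _ \<delta>])
        show "(\<lambda>N. exp (- real N)) \<longlonglongrightarrow> 0" by real_asymp
      qed
      ultimately have "\<forall>\<^sub>F N in sequentially. q ^ N / (1 - q) < \<epsilon> \<and> exp (- real N) < \<delta>"
        by (rule eventually_conj)
      then obtain N where N: "q ^ N / (1 - q) < \<epsilon>" "exp (- real N) < \<delta>"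
        by (auto simp: eventually_sequentially)
      have "\<exists>f. bij_betw f {0..<card (V n)} (V n)" for n using V(1) by (rule ex_bij_betw_nat_finite)
      then obtain f where f: "\<And>n. bij_betw (f n) {0..<card (V n)} (V n)" by metis
      \<comment> \<open>Each finite cover is padded by empty sets, which have
        \<open>diam_powr\<close> 0, to an infinite row.\<close>
      define W where "W = (\<lambda>n m. if m < card (V (N + n)) then f (N + n) m else {})"
      have W: "W n m \<in> V (N + n)" if "m < card (V (N + n))" for n m
        using bij_betwE[OF f[of "N + n"]] that by (auto simp: W_def)
      have Wd: "d x y \<le> exp (- real (N + n))" if "x \<in> W n m" "y \<in> W n m" for n m x y
        using diam[OF W] that by (cases "m < card (V (N + n))") (auto simp: W_def)
      \<comment> \<open>The rows are merged into one sequence, as \<open>delta_covers\<close>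
        requires; the sum becomes a double sum.\<close>
      define U where "U = (\<lambda>i. case prod_decode i of (n, m) \<Rightarrow> W n m)"
      have U: "U (prod_encode (n, m)) = W n m" for n m by (simp add: U_def)
      have "U \<in> delta_covers X d \<delta> E"
      proof -
        have "U i \<subseteq> X \<and> (\<forall>x\<in>U i. \<forall>y\<in>U i. d x y \<le> \<delta>)" for i
        proof -
          obtain n m where i: "i = prod_encode (n, m)" by (metis prod_decode_inverse surj_pair)
          have "W n m \<subseteq> X" using sub[OF W] by (cases "m < card (V (N + n))") (auto simp: W_def)
          moreover have "exp (- real (N + n)) \<le> exp (- real N)" by simp
          ultimately show ?thesis unfolding i U using Wd[of _ n m] N(2) by (meson order_trans less_imp_le)
        qed
        moreover have "E \<subseteq> (\<Union>i. U i)"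
        proof
          fix x assume "x \<in> E"
          from cover[OF this] obtain N' where N': "\<And>n. n \<ge> N' \<Longrightarrow> x \<in> \<Union> (V n)"
            by (auto simp: eventually_sequentially)
          obtain B where B: "B \<in> V (N + N')" "x \<in> B" using N'[of "N + N'"] by auto
          then have "B \<in> f (N + N') ` {0..<card (V (N + N'))}"
            using f[of "N + N'"] by (simp add: bij_betw_def)
          then obtain m where "m < card (V (N + N'))" "f (N + N') m = B" by auto
          then have "x \<in> W N' m" using B by (simp add: W_def)
          then show "x \<in> (\<Union>i. U i)" unfolding U[symmetric] by blast
        qed
        ultimately show ?thesis unfolding delta_covers_def by blast
      qed
      moreover have "(\<Sum>i. diam_powr d (s + \<eta>) (U i)) \<le> ennreal \<epsilon>"
      proof -
        have W_le: "diam_powr d (s + \<eta>) (W n m) \<le> ennreal (exp (- real (N + n)) powr (s + \<eta>))"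
          if "m < card (V (N + n))" for n m
        proof (rule diam_powr_le)
          show "0 \<le> d x y" if "x \<in> W n m" "y \<in> W n m" for x y
            using sub[OF W[OF \<open>m < _\<close>]] that nonneg by blast
        qed (use s \<eta> Wd in auto)
        have "(\<Sum>m. diam_powr d (s + \<eta>) (W n m)) \<le> ennreal (q ^ N * q ^ n)" for n
        proof -
          have "(\<Sum>m. diam_powr d (s + \<eta>) (W n m)) = (\<Sum>m<card (V (N + n)). diam_powr d (s + \<eta>) (W n m))"
            by (intro suminf_finite) (auto simp: W_def diam_powr_def)
          also have "\<dots> \<le> (\<Sum>m<card (V (N + n)). ennreal (exp (- real (N + n)) powr (s + \<eta>)))"
            using W_le by (intro sum_mono) auto
          also have "\<dots> = ennreal (real (card (V (N + n))) * exp (- real (N + n)) powr (s + \<eta>))"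
            by (simp add: ennreal_mult ennreal_of_nat_eq_real_of_nat)
          also have "\<dots> \<le> ennreal (exp (real (N + n) * s) * exp (- real (N + n)) powr (s + \<eta>))"
            using V(2)[of "N + n"] by (intro ennreal_leI mult_right_mono) auto
          also have "exp (real (N + n) * s) * exp (- real (N + n)) powr (s + \<eta>) = exp (real (N + n) * (- \<eta>))"
            by (simp add: powr_def exp_add[symmetric] algebra_simps)
          also have "\<dots> = q ^ N * q ^ n"
            unfolding q_def by (simp add: exp_of_nat_mult[symmetric] exp_add[symmetric] algebra_simps)
          finally show ?thesis .
        qed
        then have "(\<Sum>n. \<Sum>m. diam_powr d (s + \<eta>) (W n m)) \<le> (\<Sum>n. ennreal (q ^ N * q ^ n))"
          by (intro suminf_le) auto
        also have "\<dots> = ennreal (\<Sum>n. q ^ N * q ^ n)"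
          using q by (intro suminf_ennreal2 summable_mult summable_geometric) auto
        also have "(\<Sum>n. q ^ N * q ^ n) = q ^ N / (1 - q)"
          using q by (simp add: suminf_mult suminf_geometric summable_geometric)
        also have "ennreal \<dots> \<le> ennreal \<epsilon>" using N(1) by (intro ennreal_leI) simp
        finally have le: "(\<Sum>n. \<Sum>m. diam_powr d (s + \<eta>) (W n m)) \<le> ennreal \<epsilon>" .
        have "(\<Sum>i. diam_powr d (s + \<eta>) (U i)) = (\<Sum>n. \<Sum>m. diam_powr d (s + \<eta>) (W n m))"
        proof -
          have "(\<Sum>i. (\<lambda>(n, m). diam_powr d (s + \<eta>) (W n m)) (prod_decode i))
              = (\<Sum>n. \<Sum>m. diam_powr d (s + \<eta>) (W n m))"
            by (rule suminf_ennreal_2dimen[unfolded comp_def]) simp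
          then show ?thesis by (simp add: U_def case_prod_beta)
        qed
        with le show ?thesis by simp
      qed
      ultimately show "\<exists>U\<in>delta_covers X d \<delta> E. (\<Sum>i. diam_powr d (s + \<eta>) (U i)) \<le> ennreal \<epsilon>" by blast
    qed
    moreover have "ereal s + ereal \<eta> = ereal (s + \<eta>)" by simp
    ultimately show ?thesis
      unfolding hausdorff_dim_def using s \<eta> by (auto intro!: Inf_lower simp del: plus_ereal.simps)
  qed
  then show ?thesis by (simp add: ereal_le_epsilon2)
qed

text \<open>The mass distribution principle for the law of \<open>\<xi>\<close>; the sets \<open>B\<close> take the place of
  preimages of balls, so that \<open>\<xi>\<close> need not be measurable.\<close>

lemma (in prob_space) hausdorff_dim_ge:
  assumes xi: "AE \<omega> in M. \<xi> \<omega> \<in> E" and EX: "E \<subseteq> X"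
    and nonneg: "\<And>x y. x \<in> X \<Longrightarrow> y \<in> X \<Longrightarrow> 0 \<le> d x y"
    and mass: "\<And>s. 0 \<le> s \<Longrightarrow> s < D \<Longrightarrow> AE \<omega> in M. \<forall>\<^sub>F n in sequentially. \<exists>B\<in>sets M.
      {\<omega>'\<in>space M. \<xi> \<omega>' \<in> X \<and> d (\<xi> \<omega>) (\<xi> \<omega>') \<le> exp (- real n)} \<subseteq> B \<and> prob B \<le> exp (- real n * s)"
  shows "ereal D \<le> hausdorff_dim X d E"
  unfolding hausdorff_dim_def
proof (rule Inf_greatest, safe)
  fix s assume s: "0 \<le> s" and H: "hausdorff_measure X d s E = 0"
  show "ereal D \<le> ereal s"
  proof (rule ccontr)
    assume "\<not> ereal D \<le> ereal s"
    then have sD: "s < D" by simp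
    define good where "good = (\<lambda>n \<omega>. \<exists>B\<in>sets M.
      {\<omega>'\<in>space M. \<xi> \<omega>' \<in> X \<and> d (\<xi> \<omega>) (\<xi> \<omega>') \<le> exp (- real n)} \<subseteq> B \<and> prob B \<le> exp (- real n * s))"
    \<comment> \<open>The mass bound holds from an index depending on \<open>\<omega>\<close>;
      fixing this index makes it uniform on \<open>G N\<close>.\<close>
    define G where "G = (\<lambda>N. {\<omega>\<in>space M. \<xi> \<omega> \<in> E \<and> (\<forall>n\<ge>N. good n \<omega>)})"
    \<comment> \<open>\<open>G N\<close> need not be measurable, so it is enclosed in measurable
      sets. The part that \<open>\<xi>\<close> maps into \<open>U i\<close> lies in the set
      \<open>B\<close> belonging to any one of its points, at the scale of the diameter of
      \<open>U i\<close>.\<close>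
    have cov: "\<exists>C\<in>sets M. G N \<subseteq> C \<and> emeasure M C \<le> ennreal (exp s) * ennreal \<epsilon>" if \<epsilon>: "\<epsilon> > 0" for N \<epsilon>
    proof -
      have "(INF U\<in>delta_covers X d (exp (- real N)) E. \<Sum>i. diam_powr d s (U i)) \<le> hausdorff_measure X d s E"
        unfolding hausdorff_measure_def by (rule SUP_upper) simp
      then have "(INF U\<in>delta_covers X d (exp (- real N)) E. \<Sum>i. diam_powr d s (U i)) < ennreal \<epsilon>"
        using H \<epsilon> by simp
      then obtain U where U: "U \<in> delta_covers X d (exp (- real N)) E"
        and sum: "(\<Sum>i. diam_powr d s (U i)) < ennreal \<epsilon>" unfolding INF_less_iff by blast
      have UX: "U i \<subseteq> X" and Ud: "\<And>x y. x \<in> U i \<Longrightarrow> y \<in> U i \<Longrightarrow> d x y \<le> exp (- real N)" for i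
        using U unfolding delta_covers_def by blast+
      have "\<exists>B\<in>sets M. {\<omega>\<in>G N. \<xi> \<omega> \<in> U i} \<subseteq> B \<and> emeasure M B \<le> ennreal (exp s) * diam_powr d s (U i)" for i
      proof (cases "{\<omega>\<in>G N. \<xi> \<omega> \<in> U i} = {}")
        case True
        then show ?thesis by (intro bexI[of _ "{}"]) auto
      next
        case False
        then obtain \<omega>0 where w: "\<omega>0 \<in> G N" "\<xi> \<omega>0 \<in> U i" by auto
        define D0 where "D0 = (SUP (x, y)\<in>U i \<times> U i. d x y)"
        have bdd: "bdd_above ((\<lambda>(x, y). d x y) ` (U i \<times> U i))"
          using Ud by (auto intro!: bdd_aboveI[of _ "exp (- real N)"])
        have D0: "d x y \<le> D0" if "x \<in> U i" "y \<in> U i" for x y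
          unfolding D0_def using that by (intro cSUP_upper2[OF bdd, of "(x, y)"]) auto
        have D0N: "D0 \<le> exp (- real N)" unfolding D0_def using w Ud by (intro cSUP_least) auto
        have "0 \<le> D0" using D0[OF w(2) w(2)] nonneg[of "\<xi> \<omega>0" "\<xi> \<omega>0"] w(2) UX by fastforce
        have B: "\<exists>B\<in>sets M. {\<omega>\<in>G N. \<xi> \<omega> \<in> U i} \<subseteq> B \<and> prob B \<le> exp (- real n * s)"
          if n: "n \<ge> N" "D0 \<le> exp (- real n)" for n
        proof -
          have "good n \<omega>0" using w(1) n by (simp add: G_def)
          then obtain B where B: "B \<in> sets M" "prob B \<le> exp (- real n * s)"
            "{\<omega>'\<in>space M. \<xi> \<omega>' \<in> X \<and> d (\<xi> \<omega>0) (\<xi> \<omega>') \<le> exp (- real n)} \<subseteq> B" unfolding good_def by blast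
          have "{\<omega>\<in>G N. \<xi> \<omega> \<in> U i} \<subseteq> B"
          proof
            fix \<omega> assume \<omega>: "\<omega> \<in> {\<omega>\<in>G N. \<xi> \<omega> \<in> U i}"
            then have "d (\<xi> \<omega>0) (\<xi> \<omega>) \<le> exp (- real n)" using D0[OF w(2), of "\<xi> \<omega>"] n by simp
            then show "\<omega> \<in> B" using B(3) \<omega> UX by (auto simp: G_def)
          qed
          with B show ?thesis by blast
        qed
        show ?thesis
        proof (cases "s = 0")
          case True
          \<comment> \<open>For \<open>s = 0\<close> every nonempty set counts 1, so the whole space
            is a sufficient enclosure.\<close>
          then have "diam_powr d s (U i) = 1" using w by (auto simp: diam_powr_def)
          then show ?thesis using True by (intro bexI[of _ "space M"]) (auto simp: G_def emeasure_space_1)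
        next
          case False
          then have s: "s > 0" using s by simp
          then have dp: "diam_powr d s (U i) = ennreal (D0 powr s)"
            using w unfolding diam_powr_def D0_def by auto
          show ?thesis
          \<comment> \<open>A set of diameter 0 fits into balls of every radius, so no scale is the
            right one; intersecting the enclosures of all scales gives a null set.\<close>
          proof (cases "D0 = 0")
            case True
            have "\<forall>n\<in>{N..}. \<exists>B\<in>sets M. {\<omega>\<in>G N. \<xi> \<omega> \<in> U i} \<subseteq> B \<and> prob B \<le> exp (- real n * s)"
              using B True by simp
            then obtain B where B: "\<And>n. n \<ge> N \<Longrightarrow> B n \<in> sets M \<and> {\<omega>\<in>G N. \<xi> \<omega> \<in> U i} \<subseteq> B n \<and> prob (B n) \<le> exp (- real n * s)"
              by (metis atLeast_iff)
            let ?B = "\<Inter>n\<in>{N..}. B n"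
            have sB: "?B \<in> sets M" using B by (intro sets.countable_INT') auto
            have "prob ?B \<le> exp (- real n * s)" if "n \<ge> N" for n
              using B[OF that] that by (intro order_trans[OF finite_measure_mono[of ?B "B n"]]) auto
            moreover have "(\<lambda>n. exp (- real n * s)) \<longlonglongrightarrow> 0" using s by real_asymp
            ultimately have "prob ?B \<le> 0" by (intro tendsto_lowerbound[of _ 0 sequentially]) (auto simp: eventually_sequentially)
            then have "emeasure M ?B = 0" by (simp add: emeasure_eq_measure measure_le_0_iff)
            then show ?thesis using sB B by (intro bexI[of _ ?B]) auto
          next
            case False
            with \<open>0 \<le> D0\<close> have D0p: "D0 > 0" by simp
            \<comment> \<open>The last scale with \<open>D0 \<le> exp (- real n)\<close>. Rounding
              enlarges the radius by a factor of at most \<open>exp 1\<close>, which is the origin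
              of the constant \<open>exp s\<close>.\<close>
            define n where "n = nat \<lfloor>- ln D0\<rfloor>"
            have "ln D0 \<le> - real N" using D0N D0p by (metis exp_le_cancel_iff exp_ln)
            then have nN: "n \<ge> N" unfolding n_def by (simp add: le_nat_iff le_floor_iff)
            have n1: "real n \<le> - ln D0" "- ln D0 < real n + 1"
              using \<open>ln D0 \<le> - real N\<close> unfolding n_def by auto
            have "D0 \<le> exp (- real n)"               using n1(1) exp_le_cancel_iff[of "ln D0" "- real n"] D0p by simp
            from B[OF nN this] obtain B where B: "B \<in> sets M" "{\<omega>\<in>G N. \<xi> \<omega> \<in> U i} \<subseteq> B"
                "prob B \<le> exp (- real n * s)" by blast
            have "- real n * s \<le> (1 + ln D0) * s" using n1(2) s by (intro mult_right_mono) auto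
            then have "exp (- real n * s) \<le> exp s * D0 powr s"
              using D0p by (simp add: powr_def exp_add[symmetric] algebra_simps)
            with B(3) have "prob B \<le> exp s * D0 powr s" by linarith
            then have "emeasure M B \<le> ennreal (exp s) * ennreal (D0 powr s)"
              by (simp add: emeasure_eq_measure ennreal_mult[symmetric] ennreal_leI)
            with B dp show ?thesis by auto
          qed
        qed
      qed
      then obtain B where B: "\<And>i. B i \<in> sets M" "\<And>i. {\<omega>\<in>G N. \<xi> \<omega> \<in> U i} \<subseteq> B i"
          "\<And>i. emeasure M (B i) \<le> ennreal (exp s) * diam_powr d s (U i)" by metis
      have "G N \<subseteq> (\<Union>i. B i)"
      proof
        fix \<omega> assume w: "\<omega> \<in> G N"
        then have "\<xi> \<omega> \<in> (\<Union>i. U i)" using U by (auto simp: G_def delta_covers_def)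
        then obtain i where "\<xi> \<omega> \<in> U i" by blast
        with w B(2)[of i] show "\<omega> \<in> (\<Union>i. B i)" by blast
      qed
      moreover have "emeasure M (\<Union>i. B i) \<le> ennreal (exp s) * ennreal \<epsilon>"
      proof -
        have "emeasure M (\<Union>i. B i) \<le> (\<Sum>i. emeasure M (B i))"
          using B(1) by (intro emeasure_subadditive_countably) auto
        also have "\<dots> \<le> (\<Sum>i. ennreal (exp s) * diam_powr d s (U i))" using B(3) by (intro suminf_le) auto
        also have "\<dots> = ennreal (exp s) * (\<Sum>i. diam_powr d s (U i))" by simp
        also have "\<dots> \<le> ennreal (exp s) * ennreal \<epsilon>" using sum by (intro mult_left_mono) auto
        finally show ?thesis .
      qed
      ultimately show ?thesis using B(1) by (intro bexI[of _ "\<Union>i. B i"]) auto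
    qed
    have "AE \<omega> in M. \<omega> \<notin> G N" for N
    proof -
      have "\<exists>C\<in>sets M. G N \<subseteq> C \<and> emeasure M C \<le> ennreal (exp s) * ennreal (1 / real (Suc j))" for j
        by (rule cov) simp
      then have "\<exists>C. \<forall>j. C j \<in> sets M \<and> G N \<subseteq> C j \<and>
          emeasure M (C j) \<le> ennreal (exp s) * ennreal (1 / real (Suc j))"
        unfolding Bex_def by (rule choice[OF allI])
      then obtain C where C: "\<And>j. C j \<in> sets M" "\<And>j. G N \<subseteq> C j"
          "\<And>j. emeasure M (C j) \<le> ennreal (exp s) * ennreal (1 / real (Suc j))" by blast
      have le: "prob (\<Inter>j. C j) \<le> exp s * (1 / real (Suc j))" for j
      proof -
        have "prob (\<Inter>j. C j) \<le> prob (C j)" using C(1) by (intro finite_measure_mono) auto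
        also have "prob (C j) \<le> exp s * (1 / real (Suc j))"
        proof -
          have "ennreal (exp s) * ennreal (1 / real (Suc j)) = ennreal (exp s * (1 / real (Suc j)))"
            by (rule ennreal_mult[symmetric]) auto
          then have "ennreal (prob (C j)) \<le> ennreal (exp s * (1 / real (Suc j)))"
            using C(3)[of j] by (simp only: emeasure_eq_measure)
          then show ?thesis by (rule ennreal_le_iff[THEN iffD1, rotated]) auto
        qed
        finally show ?thesis .
      qed
      moreover have "(\<lambda>j. exp s * (1 / real (Suc j))) \<longlonglongrightarrow> 0" by real_asymp
      ultimately have "prob (\<Inter>j. C j) \<le> 0"
        by (intro tendsto_lowerbound[of _ 0 sequentially]) auto
      then have "emeasure M (\<Inter>j. C j) = 0" by (simp add: emeasure_eq_measure measure_le_0_iff)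
      moreover have "(\<Inter>j. C j) \<in> sets M" using C(1) by auto
      ultimately have "(\<Inter>j. C j) \<in> null_sets M" by (rule null_setsI)
      then show ?thesis by (rule AE_I') (use C(2) in auto)
    qed
    then have "AE \<omega> in M. \<forall>N. \<omega> \<notin> G N" by (simp add: AE_all_countable)
    moreover have "AE \<omega> in M. \<forall>\<^sub>F n in sequentially. good n \<omega>"
      using mass[OF s sD] unfolding good_def .
    ultimately have "AE \<omega> in M. False"
      using xi AE_space
    proof eventually_elim
      case (elim \<omega>)
      then obtain N where "\<forall>n\<ge>N. good n \<omega>" by (auto simp: eventually_sequentially)
      with elim have "\<omega> \<in> G N" by (simp add: G_def)
      with elim show False by blast
    qed
    then show False by simp
  qed
qed

section \<open>The weighted metric\<close>

text \<open>Closed balls are cylinders: the first disagreement \<open>j\<close> has to satisfy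
  \<open>c * r \<le> j\<close>. As positions start at 0, the strict inequality on \<open>t\<close>
  is exact even when \<open>c * r\<close> is not an integer.\<close>

lemma exp_neg_div_agreement_le_iff:
  assumes c: "c > 0"
  shows "exp_neg_div (agreement u v) c \<le> exp (- r) \<longleftrightarrow> (\<forall>t. real t < c * r \<longrightarrow> u t = v t)"
proof (cases "\<forall>m. u m = v m")
  case True
  then have "agreement u v = \<infinity>" by (simp add: agreement_def Inf_enat_def)
  then show ?thesis using True by (simp add: exp_neg_div_def)
next
  case False
  define j where "j = (LEAST m. u m \<noteq> v m)"
  have j: "u j \<noteq> v j" unfolding j_def by (rule LeastI_ex) (use False in blast)
  have le: "j \<le> m" if "u m \<noteq> v m" for m unfolding j_def using that by (rule Least_le)
  have "agreement u v = enat j"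
    unfolding agreement_def
  proof (rule antisym)
    show "Inf (enat ` {m. u m \<noteq> v m}) \<le> enat j" by (rule Inf_lower) (use j in simp)
    show "enat j \<le> Inf (enat ` {m. u m \<noteq> v m})" by (rule Inf_greatest) (use le in auto)
  qed
  then have "exp_neg_div (agreement u v) c \<le> exp (- r) \<longleftrightarrow> c * r \<le> real j"
    using c by (simp add: exp_neg_div_def field_simps)
  also have "\<dots> \<longleftrightarrow> (\<forall>t. real t < c * r \<longrightarrow> u t = v t)"
  proof
    assume cr: "c * r \<le> real j"
    show "\<forall>t. real t < c * r \<longrightarrow> u t = v t"
    proof (intro allI impI)
      fix t assume "real t < c * r"
      with cr have "t < j" by simp
      then show "u t = v t" using le[of t] by (cases "u t = v t") auto
    qed
  next
    assume "\<forall>t. real t < c * r \<longrightarrow> u t = v t"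
    with j show "c * r \<le> real j" by (meson not_le)
  qed
  finally show ?thesis .
qed

lemma weighted_dist_le_iff:
  assumes k: "k \<ge> 1" and c: "\<And>i. i \<in> {1..k} \<Longrightarrow> 0 < (\<Sum>j=1..i. a j)"
  shows "weighted_dist k \<pi> a x y \<le> exp (- r) \<longleftrightarrow>
    (\<forall>i\<in>{1..k}. \<forall>t. real t < (\<Sum>j=1..i. a j) * r \<longrightarrow>
      factor_comp \<pi> (i - 1) x t = factor_comp \<pi> (i - 1) y t)"
  unfolding weighted_dist_def using k
  by (subst Max_le_iff) (simp_all add: exp_neg_div_agreement_le_iff[OF c, unfolded One_nat_def])

lemma weighted_dist_nonneg:
  assumes k: "k \<ge> 1"
  shows "0 \<le> weighted_dist k \<pi> a x y"
proof -
  have "exp_neg_div m c \<ge> 0" for m c by (cases m) (auto simp: exp_neg_div_def)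
  then show ?thesis unfolding weighted_dist_def using k by (subst Max_ge_iff) (auto intro!: bexI[of _ 1])
qed

section \<open>Windows\<close>

text \<open>For nondecreasing \<open>u\<close> with \<open>u 0 = 0\<close> this is the number of the
  window \<open>[u i, u (i + 1))\<close> containing \<open>t\<close>, and empty windows are skipped.
  It serves three times: for the level at which a time is observed, for the block containing a time,
  and for the level at which a block is observed. It is meaningful only if \<open>t\<close> lies
  below some \<open>u (Suc i)\<close>.\<close>

definition level :: "(nat \<Rightarrow> nat) \<Rightarrow> nat \<Rightarrow> nat" where
  "level u t = (LEAST i. t < u (Suc i))"

lemma level_le: "t < u (Suc i) \<Longrightarrow> level u t \<le> i"
  unfolding level_def by (rule Least_le)

lemma less_level: "t < u (Suc i) \<Longrightarrow> t < u (Suc (level u t))"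
  unfolding level_def by (rule LeastI)

lemma level_mono: "s \<le> t \<Longrightarrow> t < u (Suc i) \<Longrightarrow> level u s \<le> level u t"
  using less_level[of t u i] by (intro level_le) simp

lemma level_less: "t < u k \<Longrightarrow> u 0 = 0 \<Longrightarrow> level u t < k"
  using level_le[of t u "k - 1"] by (cases k) auto

text \<open>Rewrites a sum whose summand changes from window to window as differences of initial
  sums of one fixed summand, because limits are known only for averages that start at 0.\<close>

lemma sum_level:
  fixes F :: "nat \<Rightarrow> nat \<Rightarrow> real"
  assumes u0: "u 0 = 0" and mono: "\<And>i j. i \<le> j \<Longrightarrow> j \<le> k \<Longrightarrow> u i \<le> u j"
  shows "(\<Sum>t<u k. F (level u t) t) = (\<Sum>i<k. (\<Sum>t<u (Suc i). F i t) - (\<Sum>t<u i. F i t))"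
  using mono
proof (induction k)
  case 0
  then show ?case using u0 by simp
next
  case (Suc k)
  have le: "u k \<le> u (Suc k)" using Suc.prems by simp
  have lev: "level u t = k" if "t \<in> {u k..<u (Suc k)}" for t
  proof (rule antisym)
    show "level u t \<le> k" using that by (intro level_le) auto
    show "k \<le> level u t"
    proof (rule ccontr)
      assume "\<not> k \<le> level u t"
      then have "u (Suc (level u t)) \<le> u k" by (intro Suc.prems) auto
      with less_level[of t u k] that show False by auto
    qed
  qed
  have split: "(\<Sum>t<u (Suc k). G t) = (\<Sum>t<u k. G t) + (\<Sum>t\<in>{u k..<u (Suc k)}. G t)" for G :: "nat \<Rightarrow> real"
    using sum.atLeastLessThan_concat[of 0 "u k" "u (Suc k)" G] le by (simp add: lessThan_atLeast0)
  have "(\<Sum>t<u (Suc k). F (level u t) t) = (\<Sum>t<u k. F (level u t) t) + (\<Sum>t\<in>{u k..<u (Suc k)}. F k t)"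
    unfolding split using lev by simp
  also have "(\<Sum>t\<in>{u k..<u (Suc k)}. F k t) = (\<Sum>t<u (Suc k). F k t) - (\<Sum>t<u k. F k t)"
    unfolding split by simp
  also have "(\<Sum>t<u k. F (level u t) t) = (\<Sum>i<k. (\<Sum>t<u (Suc i). F i t) - (\<Sum>t<u i. F i t))"
    using Suc.prems by (intro Suc.IH) auto
  finally show ?case by simp
qed

section \<open>Predictor weights\<close>

text \<open>\<open>q t\<close> plays the role of the conditional probability of the symbol \<open>f t\<close> given the
  symbols before time \<open>t\<close>.\<close>

lemma sum_prod_predictors_le_1:
  fixes q :: "nat \<Rightarrow> 'x \<Rightarrow> real"
  assumes nonneg: "\<And>t x. t < L \<Longrightarrow> x \<in> X \<Longrightarrow> 0 \<le> q t x"
    and det: "\<And>t x y. t < L \<Longrightarrow> x \<in> X \<Longrightarrow> y \<in> X \<Longrightarrow> (\<And>s. s \<le> t \<Longrightarrow> f s x = f s y) \<Longrightarrow> q t x = q t y"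
    and sum: "\<And>t E. t < L \<Longrightarrow> finite E \<Longrightarrow> E \<subseteq> X \<Longrightarrow>
      (\<And>x y s. x \<in> E \<Longrightarrow> y \<in> E \<Longrightarrow> s < t \<Longrightarrow> f s x = f s y) \<Longrightarrow> inj_on (f t) E \<Longrightarrow> (\<Sum>x\<in>E. q t x) \<le> 1"
    and E: "finite E" "E \<subseteq> X"
    and inj: "\<And>x y. x \<in> E \<Longrightarrow> y \<in> E \<Longrightarrow> (\<And>s. s < L \<Longrightarrow> f s x = f s y) \<Longrightarrow> x = y"
  shows "(\<Sum>x\<in>E. \<Prod>t<L. q t x) \<le> 1"
proof -
  have "(\<Sum>x\<in>E. \<Prod>t<l. q t x) \<le> 1"
    if "l \<le> L" "finite E" "E \<subseteq> X" "\<And>x y. x \<in> E \<Longrightarrow> y \<in> E \<Longrightarrow> (\<And>s. s < l \<Longrightarrow> f s x = f s y) \<Longrightarrow> x = y" for l E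
    using that
  proof (induction l arbitrary: E)
    case 0
    have "is_singleton E \<or> E = {}" using 0(4) by (metis is_singletonI' not_less_zero)
    then show ?case by (auto simp: is_singleton_def)
  next
    case (Suc l)
    define r where "r = (\<lambda>x. \<lambda>s\<in>{..<l}. f s x)"
    have r_eq: "r x = r y \<longleftrightarrow> (\<forall>s<l. f s x = f s y)" for x y
      unfolding r_def restrict_def fun_eq_iff by auto
    \<comment> \<open>One representative for each word of length \<open>l\<close>. The last factor,
      summed over the extensions of one word, is at most 1, and the sum over the representatives is
      the case of length \<open>l\<close>.\<close>
    define rep where "rep = inv_into E r"
    have rep: "rep v \<in> E" "r (rep v) = v" if "v \<in> r ` E" for v
      using that unfolding rep_def by (auto intro: inv_into_into simp: f_inv_into_f)
    have prod_eq: "(\<Prod>t<l. q t x) = (\<Prod>t<l. q t y)" if "x \<in> E" "y \<in> E" "r x = r y" for x y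
    proof (rule prod.cong)
      fix t assume t: "t \<in> {..<l}"
      show "q t x = q t y"
        by (rule det) (use t Suc.prems that in \<open>auto simp: r_eq\<close>)
    qed simp
    have "(\<Sum>x\<in>E. \<Prod>t<Suc l. q t x) = (\<Sum>v\<in>r ` E. \<Sum>x\<in>{x\<in>E. r x = v}. \<Prod>t<Suc l. q t x)"
      using Suc.prems(2) by (rule sum.image_gen)
    also have "\<dots> = (\<Sum>v\<in>r ` E. (\<Prod>t<l. q t (rep v)) * (\<Sum>x\<in>{x\<in>E. r x = v}. q l x))"
    proof (rule sum.cong)
      fix v assume v: "v \<in> r ` E"
      have "(\<Sum>x\<in>{x\<in>E. r x = v}. \<Prod>t<Suc l. q t x) = (\<Sum>x\<in>{x\<in>E. r x = v}. (\<Prod>t<l. q t (rep v)) * q l x)"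
        using rep[OF v] by (intro sum.cong) (auto intro!: arg_cong2[where f = times] prod_eq)
      then show "(\<Sum>x\<in>{x\<in>E. r x = v}. \<Prod>t<Suc l. q t x) = (\<Prod>t<l. q t (rep v)) * (\<Sum>x\<in>{x\<in>E. r x = v}. q l x)"
        by (simp add: sum_distrib_left)
    qed simp
    also have "\<dots> \<le> (\<Sum>v\<in>r ` E. (\<Prod>t<l. q t (rep v)) * 1)"
    proof (intro sum_mono mult_left_mono)
      fix v assume v: "v \<in> r ` E"
      show "0 \<le> (\<Prod>t<l. q t (rep v))"
        using rep(1)[OF v] Suc.prems by (intro prod_nonneg nonneg) auto
      show "(\<Sum>x\<in>{x\<in>E. r x = v}. q l x) \<le> 1"
      proof (rule sum)
        show "f s x = f s y" if "x \<in> {x\<in>E. r x = v}" "y \<in> {x\<in>E. r x = v}" "s < l" for x y s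
        proof -
          have "r x = r y" using that by simp
          with that(3) show ?thesis unfolding r_eq by blast
        qed
        show "inj_on (f l) {x\<in>E. r x = v}"
        proof (rule inj_onI)
          fix x y assume xy: "x \<in> {x\<in>E. r x = v}" "y \<in> {x\<in>E. r x = v}" "f l x = f l y"
          then have "r x = r y" by simp
          then have "f s x = f s y" if "s < Suc l" for s
            using that xy(3) unfolding r_eq by (metis less_antisym)
          then show "x = y" using xy by (intro Suc.prems(4)) auto
        qed
      qed (use Suc.prems in auto)
    qed
    also have "\<dots> = (\<Sum>x\<in>rep ` r ` E. \<Prod>t<l. q t x)"
    proof -
      have "inj_on rep (r ` E)" using rep(2) by (metis inj_onI)
      then show ?thesis by (simp add: sum.reindex)
    qed
    also have "\<dots> \<le> 1"
    proof (rule Suc.IH)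
      fix x y assume xy: "x \<in> rep ` r ` E" "y \<in> rep ` r ` E" "\<And>s. s < l \<Longrightarrow> f s x = f s y"
      then obtain v w where vw: "v \<in> r ` E" "w \<in> r ` E" "x = rep v" "y = rep w" by blast
      have "r x = r y" unfolding r_eq using xy(3) by blast
      then show "x = y" using vw rep(2) by simp
    qed (use Suc.prems rep in auto)
    finally show ?case .
  qed
  from this[of L E] show ?thesis using E inj by simp
qed

lemma continuous_map_determined:
  assumes "determined A m g"
  shows "continuous_map (shift_top A) euclideanreal g"
  unfolding continuous_map_def using openin_determined[OF determined_compose[OF assms]] by auto

text \<open>Transfers an average to times \<open>u n\<close> growing like \<open>c * n\<close>. The
  value \<open>R 0 = 0\<close> takes care of \<open>u n = 0\<close>, where the quotient by
  \<open>u n\<close> is 0 by convention.\<close>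

lemma tendsto_ratio_compose:
  fixes R :: "nat \<Rightarrow> real"
  assumes R: "(\<lambda>m. R m / real m) \<longlonglongrightarrow> e" and R0: "R 0 = 0"
    and u: "(\<lambda>n. real (u n) / real n) \<longlonglongrightarrow> c" and c: "c > 0"
  shows "(\<lambda>n. R (u n) / real n) \<longlonglongrightarrow> e * c"
proof -
  have "filterlim (\<lambda>n. real (u n)) at_top sequentially"
  proof -
    have "filterlim (\<lambda>n. real (u n) / real n * real n) at_top sequentially"
      using u c by (rule filterlim_tendsto_pos_mult_at_top) (rule filterlim_real_sequentially)
    moreover have "\<forall>\<^sub>F n in sequentially. real (u n) / real n * real n = real (u n)"
      using eventually_gt_at_top[of 0] by eventually_elim simp
    ultimately show ?thesis by (simp cong: filterlim_cong)
  qed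
  then have "filterlim u sequentially sequentially"
    using filterlim_sequentially_iff_filterlim_real by blast
  from tendsto_mult[OF filterlim_compose[OF R this] u]
  have "(\<lambda>n. R (u n) / real (u n) * (real (u n) / real n)) \<longlonglongrightarrow> e * c" .
  moreover have "(\<lambda>n. R (u n) / real (u n) * (real (u n) / real n)) = (\<lambda>n. R (u n) / real n)"
  proof
    show "R (u n) / real (u n) * (real (u n) / real n) = R (u n) / real n" for n
      using R0 by (cases "u n = 0") auto
  qed
  ultimately show ?thesis by (simp only:)
qed

section \<open>The weighted setting\<close>

text \<open>\<open>\<Phi> i\<close> is the letter map of \<open>\<tau>\<^sub>i\<close> and \<open>c i = a\<^sub>1 + \<dots> + a\<^sub>i\<^sub>+\<^sub>1\<close>; the index starts at 0.\<close>

locale weighted_shift = shift_measure A M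
  for A :: "'a set" and M :: "(nat \<Rightarrow> 'a) measure" +
  fixes k :: nat and \<Phi> :: "nat \<Rightarrow> 'a \<Rightarrow> 'a" and c :: "nat \<Rightarrow> real"
    and d :: "(nat \<Rightarrow> 'a) \<Rightarrow> (nat \<Rightarrow> 'a) \<Rightarrow> real" and h :: "nat \<Rightarrow> real"
  assumes coarser: "\<And>i j b b'. i \<le> j \<Longrightarrow> j < k \<Longrightarrow> b \<in> A \<Longrightarrow> b' \<in> A \<Longrightarrow> \<Phi> i b = \<Phi> i b' \<Longrightarrow> \<Phi> j b = \<Phi> j b'"
    and c_pos: "\<And>i. i < k \<Longrightarrow> 0 < c i"
    and c_mono: "\<And>i j. i \<le> j \<Longrightarrow> j < k \<Longrightarrow> c i \<le> c j"
    and d_nonneg: "\<And>x y. 0 \<le> d x y"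
    and d_le_iff: "\<And>x y r. x \<in> full_shift A \<Longrightarrow> y \<in> full_shift A \<Longrightarrow>
      d x y \<le> exp (- r) \<longleftrightarrow> (\<forall>i<k. \<forall>t. real t < c i * r \<longrightarrow> \<Phi> i (x t) = \<Phi> i (y t))"
    and entropy_rate: "\<And>i. i < k \<Longrightarrow>
      (\<lambda>n. fiber_entropy M (itinerary (\<lambda>x. \<Phi> i (x 0)) left_shift n) / real n) \<longlonglongrightarrow> h i"
begin

text \<open>The partial sums of the weights with a leading 0, so that the first window starts at
  time 0 and \<open>C (Suc i) - C i\<close> is the single weight \<open>a\<close> of level
  \<open>i + 1\<close>. This is why \<open>total\<close> is the weighted entropy.\<close>

definition C :: "nat \<Rightarrow> real" where
  "C i = (if i = 0 then 0 else c (i - 1))"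

definition total :: real where
  "total = (\<Sum>i<k. (C (Suc i) - C i) * h i)"

text \<open>The ceiling makes \<open>t < bound n (Suc i)\<close> equivalent to
  \<open>real t < c i * real n\<close>, so these windows describe balls of radius
  \<open>exp (- n)\<close> exactly.\<close>

definition bound :: "nat \<Rightarrow> nat \<Rightarrow> nat" where
  "bound n i = nat \<lceil>C i * real n\<rceil>"

lemma C_mono: "i \<le> j \<Longrightarrow> j \<le> k \<Longrightarrow> C i \<le> C j"
  using c_mono[of "i - 1" "j - 1"] c_pos[of "j - 1"] by (auto simp: C_def less_imp_le)

lemma C_pos: "0 < i \<Longrightarrow> i \<le> k \<Longrightarrow> 0 < C i"
  using c_pos[of "i - 1"] by (auto simp: C_def)

lemma bound_0: "bound n 0 = 0"
  by (simp add: bound_def C_def)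

lemma bound_mono: "i \<le> j \<Longrightarrow> j \<le> k \<Longrightarrow> bound n i \<le> bound n j"
  unfolding bound_def by (intro nat_mono ceiling_mono mult_right_mono C_mono) auto

lemma less_bound_iff: "t < bound n (Suc i) \<longleftrightarrow> real t < c i * real n"
  unfolding bound_def C_def by (simp add: zless_nat_eq_int_zless less_ceiling_iff)

lemma bound_ratio: "i \<le> k \<Longrightarrow> (\<lambda>n. real (bound n i) / real n) \<longlonglongrightarrow> C i"
proof (cases "i = 0")
  case False
  assume "i \<le> k"
  with False have c: "C i > 0" by (intro C_pos) auto
  have "(\<lambda>n. real_of_int \<lceil>C i * real n\<rceil> / real n) \<longlonglongrightarrow> C i"
  proof (rule real_tendsto_sandwich)
    show "\<forall>\<^sub>F n in sequentially. C i \<le> real_of_int \<lceil>C i * real n\<rceil> / real n"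
      using eventually_gt_at_top[of 0] by eventually_elim (simp add: field_simps)
    show "\<forall>\<^sub>F n in sequentially. real_of_int \<lceil>C i * real n\<rceil> / real n \<le> C i + 1 / real n"
      using eventually_gt_at_top[of 0]
    proof eventually_elim
      case (elim n)
      have "real_of_int \<lceil>C i * real n\<rceil> \<le> C i * real n + 1" by linarith
      then have "real_of_int \<lceil>C i * real n\<rceil> / real n \<le> (C i * real n + 1) / real n"
        by (intro divide_right_mono) auto
      then show ?case using elim by (simp add: add_divide_distrib)
    qed
    have "(\<lambda>n. C i + 1 / real n) \<longlonglongrightarrow> C i + 0"
      by (rule tendsto_add[OF tendsto_const lim_1_over_n])
    then show "(\<lambda>n. C i + 1 / real n) \<longlonglongrightarrow> C i" by simp
  qed simp
  moreover have "real (bound n i) = real_of_int \<lceil>C i * real n\<rceil>" for n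
  proof -
    have "0 \<le> C i * real n" using c by simp
    then have "0 \<le> \<lceil>C i * real n\<rceil>" by linarith
    then show ?thesis unfolding bound_def by simp
  qed
  ultimately show ?thesis by simp
qed (simp add: bound_0 C_def)

lemma h_nonneg: "i < k \<Longrightarrow> 0 \<le> h i"
  by (rule tendsto_lowerbound[OF entropy_rate]) (auto simp: fiber_entropy_nonneg)

lemma total_nonneg: "0 \<le> total"
  unfolding total_def using h_nonneg C_mono by (intro sum_nonneg mult_nonneg_nonneg) auto

text \<open>The common end of both bounds: \<open>R i\<close> is the sum of the log-weights of level
  \<open>i\<close> in the upper bound, and the sum of the log-measures of the blocks in the lower
  bound.\<close>

lemma level_sum_limit:
  fixes R :: "nat \<Rightarrow> nat \<Rightarrow> real"
  assumes "\<And>i j. i < k \<Longrightarrow> j \<le> k \<Longrightarrow> (\<lambda>n. R i (u n j) / real n) \<longlonglongrightarrow> e i * C j"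
  shows "(\<lambda>n. (\<Sum>i<k. R i (u n (Suc i)) - R i (u n i)) / real n) \<longlonglongrightarrow> (\<Sum>i<k. (C (Suc i) - C i) * e i)"
proof -
  have "(\<lambda>n. \<Sum>i<k. R i (u n (Suc i)) / real n - R i (u n i) / real n) \<longlonglongrightarrow> (\<Sum>i<k. e i * C (Suc i) - e i * C i)"
    using assms by (intro tendsto_sum tendsto_diff) auto
  then show ?thesis by (simp add: sum_divide_distrib diff_divide_distrib algebra_simps)
qed

abbreviation obs :: "nat \<Rightarrow> (nat \<Rightarrow> 'a) \<Rightarrow> 'a" where
  "obs i \<equiv> \<lambda>x. \<Phi> i (x 0)"

abbreviation word :: "nat \<Rightarrow> nat \<Rightarrow> (nat \<Rightarrow> 'a) \<Rightarrow> nat \<Rightarrow> 'a" where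
  "word i \<equiv> itinerary (obs i) left_shift"

lemma word_eq_iff: "word i n x = word i n y \<longleftrightarrow> (\<forall>t<n. \<Phi> i (x t) = \<Phi> i (y t))"
  by (simp add: itinerary_eq_iff funpow_left_shift)

lemma determined_word: "determined A n (word i n)"
  by (rule determinedI) (simp add: word_eq_iff)

lemma simple_function_word: "simple_function M (word i n)"
  by (rule determined_simple_function[OF determined_word])

lemma fiber_measure_word_cong:
  "(\<And>t. t < n \<Longrightarrow> \<Phi> i (x t) = \<Phi> i (y t)) \<Longrightarrow> fiber_measure M (word i n) x = fiber_measure M (word i n) y"
proof -
  assume "\<And>t. t < n \<Longrightarrow> \<Phi> i (x t) = \<Phi> i (y t)"
  then have "word i n x = word i n y" by (simp add: word_eq_iff)
  then show ?thesis unfolding fiber_measure_def by simp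
qed

lemma card_A_pos: "0 < card A"
proof -
  obtain x where "x \<in> space M" using not_empty by auto
  then have "A \<noteq> {}" by (auto simp: space_M full_shift_eq)
  then show ?thesis using finite_A by (simp add: card_gt_0_iff)
qed

lemma card_le_card_A:
  assumes "E \<subseteq> full_shift A" "inj_on (\<lambda>x. \<Phi> i (x t)) E"
  shows "card E \<le> card A"
proof -
  have "(\<lambda>x. \<Phi> i (x t)) ` E \<subseteq> \<Phi> i ` A" using assms(1) by (auto simp: full_shift_eq)
  then have "card E \<le> card (\<Phi> i ` A)"
    using assms(2) finite_A by (intro card_inj_on_le[of "\<lambda>x. \<Phi> i (x t)"]) auto
  also have "\<dots> \<le> card A" using finite_A by (rule card_image_le)
  finally show ?thesis .
qed

text \<open>The conditional probability of the last symbol given the first \<open>l\<close> ones, mixed with the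
  uniform distribution to keep it positive.  If the condition has measure 0, the quotient is 0.\<close>

definition predictor :: "nat \<Rightarrow> nat \<Rightarrow> real \<Rightarrow> (nat \<Rightarrow> 'a) \<Rightarrow> real" where
  "predictor i l \<delta> x = (1 - \<delta>) * (fiber_measure M (word i (Suc l)) x / fiber_measure M (word i l) x)
     + \<delta> / real (card A)"

lemma predictor_pos: "0 < \<delta> \<Longrightarrow> \<delta> < 1 \<Longrightarrow> 0 < predictor i l \<delta> x"
  unfolding predictor_def using card_A_pos fiber_measure_bounds
  by (intro add_nonneg_pos mult_nonneg_nonneg divide_nonneg_nonneg) auto

lemma predictor_cong:
  assumes "\<And>t. t \<le> l \<Longrightarrow> \<Phi> i (x t) = \<Phi> i (y t)"
  shows "predictor i l \<delta> x = predictor i l \<delta> y"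
  unfolding predictor_def
  using fiber_measure_word_cong[of l i x y] fiber_measure_word_cong[of "Suc l" i x y] assms by simp

lemma determined_predictor: "determined A (Suc l) (predictor i l \<delta>)"
  by (rule determinedI, rule predictor_cong) simp

text \<open>\<open>E\<close> represents different one-letter extensions of one word. Their fibers
  are disjoint parts of the fiber of that word, which bounds the conditional part by
  \<open>1 - \<delta>\<close>; there are at most \<open>card A\<close> letters, which bounds the
  uniform part by \<open>\<delta>\<close>.\<close>

lemma sum_predictor_le_1:
  assumes \<delta>: "0 < \<delta>" "\<delta> < 1" and E: "finite E" "E \<subseteq> full_shift A"
    and const: "\<And>x y t. x \<in> E \<Longrightarrow> y \<in> E \<Longrightarrow> t < l \<Longrightarrow> \<Phi> i (x t) = \<Phi> i (y t)"
    and inj: "inj_on (\<lambda>x. \<Phi> i (x l)) E"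
  shows "(\<Sum>x\<in>E. predictor i l \<delta> x) \<le> 1"
proof (cases "E = {}")
  case False
  then obtain z where z: "z \<in> E" by auto
  let ?m = "\<lambda>n. fiber_measure M (word i n)"
  have m: "?m l x = ?m l z" if "x \<in> E" for x
    using const[OF that z] by (rule fiber_measure_word_cong)
  have "(\<Sum>x\<in>E. ?m (Suc l) x / ?m l z) \<le> 1"
  proof (cases "?m l z = 0")
    case nz: False
    have "(\<Sum>x\<in>E. ?m (Suc l) x) = prob (\<Union>x\<in>E. {y\<in>space M. word i (Suc l) y = word i (Suc l) x})"
      unfolding fiber_measure_def
    proof (rule finite_measure_finite_Union[symmetric, OF E(1)])
      show "disjoint_family_on (\<lambda>x. {y\<in>space M. word i (Suc l) y = word i (Suc l) x}) E"
      proof (unfold disjoint_family_on_def, intro ballI impI)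
        fix x y assume xy: "x \<in> E" "y \<in> E" "x \<noteq> y"
        then have "\<Phi> i (x l) \<noteq> \<Phi> i (y l)" using inj by (auto dest: inj_onD)
        then have "word i (Suc l) x \<noteq> word i (Suc l) y" unfolding word_eq_iff by blast
        then show "{z\<in>space M. word i (Suc l) z = word i (Suc l) x} \<inter>
          {z\<in>space M. word i (Suc l) z = word i (Suc l) y} = {}" by auto
      qed
    qed (use simple_function_fiber_sets[OF simple_function_word] in auto)
    also have "\<dots> \<le> ?m l z"
      unfolding fiber_measure_def
    proof (rule finite_measure_mono)
      show "(\<Union>x\<in>E. {y\<in>space M. word i (Suc l) y = word i (Suc l) x}) \<subseteq> {y\<in>space M. word i l y = word i l z}"
      proof
        fix y assume "y \<in> (\<Union>x\<in>E. {y\<in>space M. word i (Suc l) y = word i (Suc l) x})"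
        then obtain x where x: "x \<in> E" "y \<in> space M" "\<And>t. t < Suc l \<Longrightarrow> \<Phi> i (y t) = \<Phi> i (x t)"
          unfolding word_eq_iff by blast
        then have "\<Phi> i (y t) = \<Phi> i (z t)" if "t < l" for t using const[OF x(1) z that] x(3)[of t] that by simp
        then show "y \<in> {y\<in>space M. word i l y = word i l z}" using x(2) by (simp add: word_eq_iff)
      qed
    qed (rule simple_function_fiber_sets[OF simple_function_word])
    finally show ?thesis
      using nz fiber_measure_bounds(1)[of "word i l" z] by (simp add: sum_divide_distrib[symmetric] divide_le_eq)
  qed simp
  note a1 = this
  have a2: "(\<Sum>x\<in>E. \<delta> / real (card A)) \<le> \<delta>"
  proof -
    have "real (card E) \<le> real (card A)" using card_le_card_A[OF E(2) inj] by simp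
    then have "real (card E) * \<delta> \<le> real (card A) * \<delta>" using \<delta> by (intro mult_right_mono) auto
    then show ?thesis using card_A_pos by (simp add: field_simps)
  qed
  have a3: "(\<Sum>x\<in>E. predictor i l \<delta> x) =
      (1 - \<delta>) * (\<Sum>x\<in>E. ?m (Suc l) x / ?m l z) + (\<Sum>x\<in>E. \<delta> / real (card A))"
    unfolding predictor_def sum_distrib_left sum.distrib[symmetric] using m by (intro sum.cong) auto
  have "(1 - \<delta>) * (\<Sum>x\<in>E. ?m (Suc l) x / ?m l z) \<le> (1 - \<delta>) * 1"
    using \<delta> a1 by (intro mult_left_mono) auto
  from add_mono[OF this a2] show ?thesis unfolding a3 by (rule order_trans) simp
qed simp

text \<open>Dropping the uniform part leaves \<open>1 - \<delta>\<close> times the conditional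
  probability, whose mean negative logarithm is the conditional entropy of a letter given the
  \<open>l\<close> letters before it.\<close>

lemma predictor_cross_entropy:
  assumes \<delta>: "0 < \<delta>" "\<delta> < 1"
  shows "- (\<integral>x. ln (predictor i l \<delta> x) \<partial>M)
    \<le> fiber_entropy M (word i (Suc l)) - fiber_entropy M (word i l) - ln (1 - \<delta>)"
proof -
  let ?m = "\<lambda>n. fiber_measure M (word i n)"
  have det: "determined A n (\<lambda>x. ln (?m n x))" for n
    by (intro determinedI arg_cong[of _ _ ln] fiber_measure_word_cong arg_cong[of _ _ "\<Phi> i"])
  have int: "integrable M g" if "determined A n g" for g :: "(nat \<Rightarrow> 'a) \<Rightarrow> real" and n
    using integral_simple_function(1)[OF determined_simple_function[OF that], of "\<lambda>x. x"] .
  note i1 = int[OF det[of l]] and i2 = int[OF det[of "Suc l"]]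
  have "(\<integral>x. - ln (predictor i l \<delta> x) \<partial>M) \<le> (\<integral>x. (- ln (?m (Suc l) x) + ln (?m l x)) + (- ln (1 - \<delta>)) \<partial>M)"
  proof (rule integral_mono_AE)
    show "AE x in M. - ln (predictor i l \<delta> x) \<le> (- ln (?m (Suc l) x) + ln (?m l x)) + (- ln (1 - \<delta>))"
      using AE_fiber_measure_pos[OF simple_function_word[of i "Suc l"]]
        AE_fiber_measure_pos[OF simple_function_word[of i l]]
    proof eventually_elim
      case (elim x)
      have "ln ((1 - \<delta>) * (?m (Suc l) x / ?m l x)) \<le> ln (predictor i l \<delta> x)"
        using elim \<delta> by (intro ln_mono) (auto simp: predictor_def)
      then show ?case using elim \<delta> by (simp add: ln_mult ln_div)
    qed
    show "integrable M (\<lambda>x. - ln (predictor i l \<delta> x))"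
      by (rule int[OF determined_compose[OF determined_predictor]])
    show "integrable M (\<lambda>x. (- ln (?m (Suc l) x) + ln (?m l x)) + (- ln (1 - \<delta>)))"
      using i1 i2 by (intro Bochner_Integration.integrable_add Bochner_Integration.integrable_minus) auto
  qed
  also have "\<dots> = fiber_entropy M (word i (Suc l)) - fiber_entropy M (word i l) - ln (1 - \<delta>)"
    unfolding fiber_entropy_def using i1 i2 by (simp add: prob_space)
  finally show ?thesis by simp
qed

text \<open>If all increments exceeded \<open>h i + \<eta>\<close>, summing them up would force the
  rate to be at least \<open>h i + \<eta>\<close>.\<close>

lemma entropy_increment_small:
  assumes i: "i < k" and \<eta>: "\<eta> > 0"
  obtains l where "fiber_entropy M (word i (Suc l)) - fiber_entropy M (word i l) \<le> h i + \<eta>"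
proof -
  let ?H = "\<lambda>n. fiber_entropy M (word i n)"
  have "\<exists>l. ?H (Suc l) - ?H l \<le> h i + \<eta>"
  proof (rule ccontr)
    assume "\<not> ?thesis"
    then have "\<And>l. h i + \<eta> < ?H (Suc l) - ?H l" by (simp add: not_le)
    then have step: "?H (Suc l) \<ge> ?H l + (h i + \<eta>)" for l by (smt (verit))
    have "?H n \<ge> real n * (h i + \<eta>)" for n
    proof (induction n)
      case (Suc n)
      then show ?case using step[of n] by (simp add: algebra_simps)
    qed (simp add: fiber_entropy_nonneg)
    then have "h i + \<eta> \<le> ?H n / real n" if "n > 0" for n
      using that by (simp add: field_simps)
    then have "\<forall>\<^sub>F n in sequentially. h i + \<eta> \<le> ?H n / real n"
      using eventually_gt_at_top[of 0] by (rule eventually_mono[rotated])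
    then have "h i + \<eta> \<le> h i" by (intro tendsto_lowerbound[OF entropy_rate[OF i]]) auto
    with \<eta> show False by simp
  qed
  with that show ?thesis by blast
qed

section \<open>Upper bound\<close>

text \<open>The first \<open>l\<close> letters lack a full context and are guessed uniformly; they
  add a constant to the logarithm, which vanishes in the average.\<close>

definition weight :: "nat \<Rightarrow> nat \<Rightarrow> real \<Rightarrow> nat \<Rightarrow> (nat \<Rightarrow> 'a) \<Rightarrow> real" where
  "weight i l \<delta> t x = (if t < l then 1 / real (card A) else predictor i l \<delta> ((left_shift ^^ (t - l)) x))"

lemma weight_pos: "0 < \<delta> \<Longrightarrow> \<delta> < 1 \<Longrightarrow> 0 < weight i l \<delta> t x"
  unfolding weight_def using card_A_pos predictor_pos by simp

lemma weight_cong: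
  assumes "\<And>s. s \<le> t \<Longrightarrow> \<Phi> i (x s) = \<Phi> i (y s)"
  shows "weight i l \<delta> t x = weight i l \<delta> t y"
  unfolding weight_def using assms by (auto simp: funpow_left_shift intro!: predictor_cong)

lemma sum_weight_le_1:
  assumes \<delta>: "0 < \<delta>" "\<delta> < 1" and E: "finite E" "E \<subseteq> full_shift A"
    and const: "\<And>x y s. x \<in> E \<Longrightarrow> y \<in> E \<Longrightarrow> s < t \<Longrightarrow> \<Phi> i (x s) = \<Phi> i (y s)"
    and inj: "inj_on (\<lambda>x. \<Phi> i (x t)) E"
  shows "(\<Sum>x\<in>E. weight i l \<delta> t x) \<le> 1"
proof (cases "t < l")
  case True
  have "real (card E) \<le> real (card A)" using card_le_card_A[OF E(2) inj] by simp
  then show ?thesis using True card_A_pos by (simp add: weight_def field_simps)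
next
  case False
  let ?T = "left_shift ^^ (t - l)"
  have T: "?T x s = x (t - l + s)" for x :: "nat \<Rightarrow> 'a" and s by (simp add: funpow_left_shift)
  \<comment> \<open>The shift by \<open>t - l\<close> forgets only letters before the context; time
    \<open>t\<close>, where the points of \<open>E\<close> differ, survives as position
    \<open>l\<close>.\<close>
  have injT: "inj_on ?T E"
  proof (rule inj_onI)
    fix x y assume xy: "x \<in> E" "y \<in> E" "?T x = ?T y"
    then have "x t = y t" using T[of x l] T[of y l] False by simp
    then show "x = y" using inj_onD[OF inj _ xy(1,2)] by simp
  qed
  have "(\<Sum>x\<in>E. weight i l \<delta> t x) = (\<Sum>x\<in>?T ` E. predictor i l \<delta> x)"
    using False injT by (simp add: weight_def sum.reindex)
  also have "\<dots> \<le> 1"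
  proof (rule sum_predictor_le_1[OF \<delta>])
    show "?T ` E \<subseteq> full_shift A" using E(2) funpow_T_space unfolding space_M by blast
    show "\<Phi> i (x s) = \<Phi> i (y s)" if "x \<in> ?T ` E" "y \<in> ?T ` E" "s < l" for x y s
    proof -
      from that obtain x' y' where xy: "x' \<in> E" "y' \<in> E" "x = ?T x'" "y = ?T y'" by blast
      have "\<Phi> i (x' (t - l + s)) = \<Phi> i (y' (t - l + s))"
        using that(3) False by (intro const[OF xy(1,2)]) simp
      then show ?thesis by (simp add: xy T)
    qed
    show "inj_on (\<lambda>x. \<Phi> i (x l)) (?T ` E)"
    proof (rule inj_onI)
      fix x y assume "x \<in> ?T ` E" "y \<in> ?T ` E" and eq: "\<Phi> i (x l) = \<Phi> i (y l)"
      then obtain x' y' where xy: "x' \<in> E" "y' \<in> E" "x = ?T x'" "y = ?T y'" by blast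
      then have "\<Phi> i (x' t) = \<Phi> i (y' t)" using eq False by (simp add: T)
      then show "x = y" using inj_onD[OF inj _ xy(1,2)] xy(3,4) by simp
    qed
  qed (use E in auto)
  finally show ?thesis .
qed

text \<open>The logarithm of the predictor depends on finitely many letters and is therefore
  continuous, so it may be inserted directly into the definition of a generic point.\<close>

lemma sum_ln_weight_limit:
  assumes \<delta>: "0 < \<delta>" "\<delta> < 1" and x: "x \<in> generic_points (shift_top A) left_shift M"
  shows "(\<lambda>n. (\<Sum>t<n. ln (weight i l \<delta> t x)) / real n) \<longlonglongrightarrow> (\<integral>x. ln (predictor i l \<delta> x) \<partial>M)"
proof (rule LIMSEQ_offset)
  let ?\<psi> = "\<lambda>x. ln (predictor i l \<delta> x)"
  have "continuous_map (shift_top A) euclideanreal ?\<psi>"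
    by (rule continuous_map_determined[OF determined_compose[OF determined_predictor]])
  with x have B: "(\<lambda>n. (1 / real n) * (\<Sum>t<n. ?\<psi> ((left_shift ^^ t) x))) \<longlonglongrightarrow> (\<integral>x. ?\<psi> x \<partial>M)"
    unfolding generic_points_def by blast
  define K where "K = (\<Sum>t<l. ln (weight i l \<delta> t x))"
  have sum: "(\<Sum>t<n + l. ln (weight i l \<delta> t x)) = K + (\<Sum>t<n. ?\<psi> ((left_shift ^^ t) x))" for n
  proof -
    have "(\<Sum>t<l + n. ln (weight i l \<delta> t x)) = K + (\<Sum>t<n. ln (weight i l \<delta> (l + t) x))"
      unfolding K_def by (induction n) auto
    then show ?thesis by (simp add: weight_def add.commute)
  qed
  have "(\<lambda>n. K / real (n + l) + (1 / real n) * (\<Sum>t<n. ?\<psi> ((left_shift ^^ t) x)) * (real n / real (n + l)))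
      \<longlonglongrightarrow> 0 + (\<integral>x. ?\<psi> x \<partial>M) * 1"
  proof (intro tendsto_add tendsto_mult B)
    show "(\<lambda>n. K / real (n + l)) \<longlonglongrightarrow> 0" by real_asymp
    show "(\<lambda>n. real n / real (n + l)) \<longlonglongrightarrow> 1" by real_asymp
  qed
  moreover have "\<forall>\<^sub>F n in sequentially. K / real (n + l) +
      (1 / real n) * (\<Sum>t<n. ?\<psi> ((left_shift ^^ t) x)) * (real n / real (n + l))
      = (\<Sum>t<n + l. ln (weight i l \<delta> t x)) / real (n + l)"
    using eventually_gt_at_top[of 0] by eventually_elim (simp add: sum add_divide_distrib)
  ultimately show "(\<lambda>n. (\<Sum>t<n + l. ln (weight i l \<delta> t x)) / real (n + l)) \<longlonglongrightarrow> (\<integral>x. ?\<psi> x \<partial>M)"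
    by (simp add: tendsto_cong)
qed

lemma hausdorff_dim_generic_points_less:
  assumes s: "total < s"
  shows "hausdorff_dim (full_shift A) d (generic_points (shift_top A) left_shift M) \<le> ereal s"
proof -
  \<comment> \<open>A letter costs at most \<open>h i + 2 * \<eta>\<close>: one
    \<open>\<eta>\<close> for the finite memory and one for the uniform part. The word has about
    \<open>n * C k\<close> letters, and the total loss must stay below
    \<open>s - total\<close>.\<close>
  define \<eta> where "\<eta> = (s - total) / (2 * (C k + 1))"
  have Ck: "0 \<le> C k" using C_mono[of 0 k] by (simp add: C_def)
  have \<eta>: "\<eta> > 0" unfolding \<eta>_def using s Ck by simp
  have \<eta>s: "total + C k * (2 * \<eta>) < s"
  proof -
    have "C k * (2 * \<eta>) = (s - total) * (C k / (C k + 1))" unfolding \<eta>_def using Ck by (simp add: field_simps)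
    also have "\<dots> < (s - total) * 1" using s Ck by (intro mult_strict_left_mono) auto
    finally show ?thesis by simp
  qed
  define \<delta> where "\<delta> = 1 - exp (- \<eta>)"
  have \<delta>: "0 < \<delta>" "\<delta> < 1" "- ln (1 - \<delta>) = \<eta>" using \<eta> by (auto simp: \<delta>_def)
  have "\<forall>i. \<exists>l. i < k \<longrightarrow> fiber_entropy M (word i (Suc l)) - fiber_entropy M (word i l) \<le> h i + \<eta>"
    using entropy_increment_small[OF _ \<eta>] by blast
  then have "\<exists>l. \<forall>i. i < k \<longrightarrow> fiber_entropy M (word i (Suc (l i))) - fiber_entropy M (word i (l i)) \<le> h i + \<eta>"
    by (rule choice)
  then obtain l where l: "\<And>i. i < k \<Longrightarrow> fiber_entropy M (word i (Suc (l i))) - fiber_entropy M (word i (l i)) \<le> h i + \<eta>"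
    by blast
  define e where "e = (\<lambda>i. \<integral>x. ln (predictor i (l i) \<delta> x) \<partial>M)"
  have e: "e i \<ge> - (h i + 2 * \<eta>)" if "i < k" for i
    using predictor_cross_entropy[OF \<delta>(1,2), of i "l i"] l[OF that] \<delta>(3) unfolding e_def by simp
  \<comment> \<open>At time \<open>t\<close> the ball still sees every level whose window has not
    ended; \<open>level\<close> selects the finest of them.\<close>
  define f where "f = (\<lambda>n t x. \<Phi> (level (bound n) t) (x t) :: 'a)"
  define q where "q = (\<lambda>n t x. weight (level (bound n) t) (l (level (bound n) t)) \<delta> t x)"
  define W where "W = (\<lambda>n x. \<Prod>t<bound n k. q n t x)"
  have qpos: "0 < q n t x" for n t x unfolding q_def by (rule weight_pos[OF \<delta>(1,2)])
  have lev: "level (bound n) t < k" "t < bound n (Suc (level (bound n) t))" if "t < bound n k" for n t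
  proof -
    show *: "level (bound n) t < k" by (rule level_less[OF that bound_0])
    then have "k = Suc (k - 1)" by simp
    with that show "t < bound n (Suc (level (bound n) t))" by (metis less_level)
  qed
  \<comment> \<open>Earlier times are observed at finer levels, so the observed word determines the
    coarser context that the predictor reads, also when this context reaches back across a window
    boundary.\<close>
  have f_coarser: "\<Phi> i (x r) = \<Phi> i (y r)"
    if "x \<in> full_shift A" "y \<in> full_shift A" "level (bound n) r \<le> i" "i < k" "f n r x = f n r y" for n r i x y
    using coarser[OF that(3,4), of "x r" "y r"] that by (auto simp: f_def full_shift_eq)
  have sumW: "(\<Sum>x\<in>E. W n x) \<le> 1"
    if E: "finite E" "E \<subseteq> full_shift A"
      "\<And>x y. x \<in> E \<Longrightarrow> y \<in> E \<Longrightarrow> (\<And>r. r < bound n k \<Longrightarrow> f n r x = f n r y) \<Longrightarrow> x = y" for E n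
    unfolding W_def
  proof (rule sum_prod_predictors_le_1[where f = "f n" and X = "full_shift A"])
    show "0 \<le> q n t x" for t x using qpos by (simp add: less_imp_le)
    show "q n t x = q n t y"
      if t: "t < bound n k" and xy: "x \<in> full_shift A" "y \<in> full_shift A"
        and eq: "\<And>r. r \<le> t \<Longrightarrow> f n r x = f n r y" for t x y
      unfolding q_def
    proof (rule weight_cong)
      fix r assume r: "r \<le> t"
      show "\<Phi> (level (bound n) t) (x r) = \<Phi> (level (bound n) t) (y r)"
        by (rule f_coarser[OF xy _ lev(1)[OF t] eq[OF r]]) (rule level_mono[OF r], rule lev(2)[OF t])
    qed
    show "(\<Sum>x\<in>F. q n t x) \<le> 1"
      if t: "t < bound n k" and F: "finite F" "F \<subseteq> full_shift A"
        and const: "\<And>x y r. x \<in> F \<Longrightarrow> y \<in> F \<Longrightarrow> r < t \<Longrightarrow> f n r x = f n r y"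
        and inj: "inj_on (f n t) F" for t F
      unfolding q_def
    proof (rule sum_weight_le_1[OF \<delta>(1,2) F])
      fix x y r assume r: "x \<in> F" "y \<in> F" "r < t"
      show "\<Phi> (level (bound n) t) (x r) = \<Phi> (level (bound n) t) (y r)"
      proof (rule f_coarser[OF _ _ _ lev(1)[OF t] const[OF r]])
        show "level (bound n) r \<le> level (bound n) t"
          by (rule level_mono[OF less_imp_le[OF r(3)]]) (rule lev(2)[OF t])
      qed (use F r in auto)
    qed (use inj in \<open>simp add: f_def\<close>)
  qed (use E in auto)
  \<comment> \<open>Words of weight at least \<open>exp (- n * s)\<close> number at most
    \<open>exp (n * s)\<close>, because all weights together are at most 1.\<close>
  define G where "G = (\<lambda>n. {x\<in>full_shift A. exp (- real n * s) \<le> W n x})"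
  define sig where "sig = (\<lambda>n x. \<lambda>t\<in>{..<bound n k}. f n t x)"
  have sig_eq: "sig n x = sig n y \<longleftrightarrow> (\<forall>t<bound n k. f n t x = f n t y)" for n x y
    unfolding sig_def restrict_def fun_eq_iff by auto
  have fin: "finite (sig n ` full_shift A)" for n
  proof (rule finite_image_determined[OF finite_A, of "bound n k"], rule determinedI)
    fix x y :: "nat \<Rightarrow> 'a" assume "\<And>i. i < bound n k \<Longrightarrow> x i = y i"
    then show "sig n x = sig n y" unfolding sig_eq f_def by simp
  qed
  then have finG: "finite (sig n ` G n)" for n
    by (rule finite_subset[rotated]) (auto simp: G_def)
  define V where "V = (\<lambda>n. (\<lambda>v. {x\<in>G n. sig n x = v}) ` sig n ` G n)"
  show ?thesis
  proof (rule hausdorff_dim_le)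
    show "finite (V n)" for n unfolding V_def using finG by simp
    show "real (card (V n)) \<le> exp (real n * s)" for n
    proof -
      \<comment> \<open>\<open>sumW\<close> requires points told apart by their words, so one point
        per class is taken.\<close>
      let ?E = "inv_into (G n) (sig n) ` sig n ` G n"
      have inv: "sig n (inv_into (G n) (sig n) v) = v" "inv_into (G n) (sig n) v \<in> G n" if "v \<in> sig n ` G n" for v
        using that by (auto intro: inv_into_into simp: f_inv_into_f)
      have EG: "?E \<subseteq> G n" using inv by auto
      have "inj_on (inv_into (G n) (sig n)) (sig n ` G n)" by (rule inj_on_inv_into) simp
      then have card: "card ?E = card (sig n ` G n)" by (rule card_image)
      have "real (card ?E) * exp (- real n * s) = (\<Sum>x\<in>?E. exp (- real n * s))" by simp
      also have "\<dots> \<le> (\<Sum>x\<in>?E. W n x)"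
      proof (rule sum_mono)
        fix x assume "x \<in> ?E"
        with EG have "x \<in> G n" by (rule subsetD)
        then show "exp (- real n * s) \<le> W n x" by (simp add: G_def)
      qed
      also have "\<dots> \<le> 1"
      proof (rule sumW)
        show "finite ?E" using finG by simp
        show "?E \<subseteq> full_shift A" using EG by (auto simp: G_def)
        fix x y assume xy: "x \<in> ?E" "y \<in> ?E" "\<And>r. r < bound n k \<Longrightarrow> f n r x = f n r y"
        then have "sig n x = sig n y" unfolding sig_eq by blast
        with xy(1,2) inv(1) show "x = y" by (metis imageE)
      qed
      finally have "real (card ?E) \<le> exp (real n * s)" by (simp add: exp_minus field_simps)
      moreover have "card (V n) \<le> card (sig n ` G n)" unfolding V_def by (rule card_image_le[OF finG])
      ultimately show ?thesis using card by linarith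
    qed
    show "U \<subseteq> full_shift A" if "U \<in> V n" for n U using that by (auto simp: V_def G_def)
    show "d x y \<le> exp (- real n)" if U: "U \<in> V n" "x \<in> U" "y \<in> U" for n U x y
    proof -
      have xy: "x \<in> full_shift A" "y \<in> full_shift A" "sig n x = sig n y"
        using U by (auto simp: V_def G_def)
      have "\<Phi> i (x t) = \<Phi> i (y t)" if i: "i < k" and t: "real t < c i * real n" for i t
      proof -
        have ti: "t < bound n (Suc i)" using t by (simp add: less_bound_iff)
        then have "t < bound n k" using bound_mono[of "Suc i" k n] i by simp
        then have "f n t x = f n t y" using xy(3)[unfolded sig_eq] by blast
        show ?thesis by (rule f_coarser[OF xy(1,2) level_le[where u = "bound n", OF ti] i \<open>f n t x = f n t y\<close>])
      qed
      then show ?thesis unfolding d_le_iff[OF xy(1,2)] by blast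
    qed
    show "\<forall>\<^sub>F n in sequentially. x \<in> \<Union> (V n)" if x: "x \<in> generic_points (shift_top A) left_shift M" for x
    proof -
      have xA: "x \<in> full_shift A" using x by (simp add: generic_points_def)
      let ?R = "\<lambda>i m. \<Sum>t<m. ln (weight i (l i) \<delta> t x)"
      have lnW: "ln (W n x) = (\<Sum>i<k. ?R i (bound n (Suc i)) - ?R i (bound n i))" for n
      proof -
        have "ln (W n x) = (\<Sum>t<bound n k. ln (q n t x))" unfolding W_def
          using qpos by (intro ln_prod) (auto simp: less_imp_neq[THEN not_sym])
        also have "\<dots> = (\<Sum>i<k. ?R i (bound n (Suc i)) - ?R i (bound n i))"
          unfolding q_def by (rule sum_level[where u = "bound n", OF bound_0 bound_mono])
        finally show ?thesis .
      qed
      have "(\<lambda>n. ln (W n x) / real n) \<longlonglongrightarrow> (\<Sum>i<k. (C (Suc i) - C i) * e i)"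
        unfolding lnW
      proof (rule level_sum_limit)
        fix i j assume ij: "i < k" "j \<le> k"
        show "(\<lambda>n. ?R i (bound n j) / real n) \<longlonglongrightarrow> e i * C j"
        proof (cases "j = 0")
          case False
          show ?thesis
            using sum_ln_weight_limit[OF \<delta>(1,2) x, of i "l i"] bound_ratio[OF ij(2)] C_pos[OF _ ij(2)] False
            by (intro tendsto_ratio_compose[where R = "?R i"]) (auto simp: e_def)
        qed (simp add: bound_0 C_def)
      qed
      moreover have "- s < (\<Sum>i<k. (C (Suc i) - C i) * e i)"
      proof -
        have "(\<Sum>i<k. (C (Suc i) - C i) * (- (h i + 2 * \<eta>))) \<le> (\<Sum>i<k. (C (Suc i) - C i) * e i)"
          using e C_mono by (intro sum_mono mult_left_mono) auto
        moreover have "(\<Sum>i<k. (C (Suc i) - C i) * (- (h i + 2 * \<eta>)))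
            = - total - (\<Sum>i<k. C (Suc i) - C i) * (2 * \<eta>)"
          unfolding total_def sum_distrib_right sum_negf[symmetric] sum_subtractf[symmetric]
          by (intro sum.cong) (auto simp: algebra_simps)
        moreover have "(\<Sum>i<k. C (Suc i) - C i) = C k"
          unfolding sum_lessThan_telescope by (simp add: C_def)
        ultimately show ?thesis using \<eta>s by simp
      qed
      ultimately have "\<forall>\<^sub>F n in sequentially. - s < ln (W n x) / real n" by (rule order_tendstoD(1))
      then show ?thesis using eventually_gt_at_top[of 0]
      proof eventually_elim
        case (elim n)
        have Wpos: "0 < W n x" unfolding W_def using qpos by (simp add: prod_pos)
        have "- real n * s \<le> ln (W n x)" using elim by (simp add: field_simps)
        then have "exp (- real n * s) \<le> W n x" using Wpos by (metis exp_le_cancel_iff exp_ln)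
        then have "x \<in> G n" using xA by (simp add: G_def)
        then show ?case unfolding V_def by blast
      qed
    qed
    show "0 \<le> s" using s total_nonneg by simp
  qed (rule d_nonneg)
qed

theorem hausdorff_dim_generic_points_le:
  "hausdorff_dim (full_shift A) d (generic_points (shift_top A) left_shift M) \<le> ereal total"
proof (rule ereal_le_epsilon2)
  fix e :: real assume "e > 0"
  then show "hausdorff_dim (full_shift A) d (generic_points (shift_top A) left_shift M) \<le> ereal total + ereal e"
    using hausdorff_dim_generic_points_less[of "total + e"] by simp
qed

end

section \<open>A law of large numbers for product measures\<close>

text \<open>The coordinates are independent, but the functions \<open>F j\<close> differ; hence the
  individual bounds \<open>B j\<close>.\<close>

lemma (in prob_space) Hoeffding_product:
  fixes F :: "nat \<Rightarrow> 'a \<Rightarrow> real" and B :: "nat \<Rightarrow> real"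
  assumes F: "\<And>j. F j \<in> borel_measurable M" "\<And>j x. x \<in> space M \<Longrightarrow> \<bar>F j x\<bar> \<le> B j"
    and B: "\<And>j. 0 < B j" and \<epsilon>: "0 \<le> \<epsilon>" and n: "n > 0"
  defines "P \<equiv> PiM (UNIV :: nat set) (\<lambda>_. M)"
  shows "measure P {\<omega>\<in>space P. \<bar>(\<Sum>j<n. F j (\<omega> j)) - (\<Sum>j<n. \<integral>x. F j x \<partial>M)\<bar> \<ge> \<epsilon>}
    \<le> 2 * exp (- 2 * \<epsilon>\<^sup>2 / (\<Sum>j<n. (2 * B j)\<^sup>2))"
proof -
  interpret P: product_prob_space "\<lambda>_. M" "UNIV :: nat set"
    by (intro product_prob_spaceI prob_space_axioms)
  let ?X = "\<lambda>j \<omega>. F j (\<omega> j)"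
  have comp: "distr P M (\<lambda>\<omega>. \<omega> j) = M" for j unfolding P_def by (rule P.PiM_component) simp
  have meas: "(\<lambda>\<omega>. \<omega> j) \<in> measurable P M" for j unfolding P_def by simp
  have "P.indep_vars (\<lambda>_. M) (\<lambda>j \<omega>. \<omega> j) {..<n}"
  proof (subst P.indep_vars_iff_distr_eq_PiM')
    show "{..<n} \<noteq> {}" using n by auto
    show "P.random_variable M (\<lambda>\<omega>. \<omega> i)" for i using meas[of i] unfolding P_def .
    show "distr (PiM UNIV (\<lambda>_. M)) (PiM {..<n} (\<lambda>_. M)) (\<lambda>x. \<lambda>i\<in>{..<n}. x i) =
      PiM {..<n} (\<lambda>i. distr (PiM UNIV (\<lambda>_. M)) M (\<lambda>\<omega>. \<omega> i))"
      using P.distr_PiM_restrict_finite[of "{..<n}"] comp[unfolded P_def] by simp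
  qed
  then have indep: "P.indep_vars (\<lambda>_. borel) ?X {..<n}"
    using P.indep_vars_compose2[of "\<lambda>_. M" "\<lambda>j \<omega>. \<omega> j" "{..<n}" F "\<lambda>_. borel"] F(1) by simp
  have "P.expectation (?X j) = (\<integral>x. F j x \<partial>M)" for j
    using integral_distr[OF meas[of j] F(1)[of j]] comp[of j] unfolding P_def by simp
  then have mu: "(\<Sum>j<n. \<integral>x. F j x \<partial>M) = (\<Sum>j<n. P.expectation (?X j))" by simp
  interpret H: Hoeffding_ineq "PiM UNIV (\<lambda>_. M)" "{..<n}" ?X "\<lambda>j. - B j" B "\<Sum>j<n. \<integral>x. F j x \<partial>M"
  proof (unfold_locales)
    show "AE x in PiM UNIV (\<lambda>_. M). F i (x i) \<in> {- B i..B i}" for i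
    proof (rule AE_I2)
      fix x assume "x \<in> space (PiM (UNIV :: nat set) (\<lambda>_. M))"
      then have "x i \<in> space M" by (auto simp: space_PiM)
      then show "F i (x i) \<in> {- B i..B i}" using F(2)[of "x i" i] by (auto simp: abs_le_iff)
    qed
  qed (use indep mu in auto)
  have "(\<Sum>j<n. (B j - - B j)\<^sup>2) > 0"
    using B n by (intro sum_pos) (auto simp: zero_less_power2 less_imp_neq[THEN not_sym])
  from H.Hoeffding_ineq_abs_ge[OF \<epsilon> this] show ?thesis unfolding P_def by simp
qed

text \<open>With bounds of order \<open>j\<close> to the power 1/4 the sum of squares in Hoeffding's
  inequality is of order \<open>n * sqrt n\<close>, so a deviation of \<open>\<epsilon> * n\<close>
  has probability at most \<open>2 * exp (- a * sqrt n)\<close>. This is summable, and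
  Borel-Cantelli applies.\<close>

lemma (in prob_space) strong_law_product:
  fixes F :: "nat \<Rightarrow> 'a \<Rightarrow> real"
  assumes F: "\<And>j. F j \<in> borel_measurable M" "\<And>j x. x \<in> space M \<Longrightarrow> \<bar>F j x\<bar> \<le> K * sqrt (sqrt (real (Suc j)))"
    and K: "K > 0"
  shows "AE \<omega> in PiM (UNIV :: nat set) (\<lambda>_. M).
    (\<lambda>n. ((\<Sum>j<n. F j (\<omega> j)) - (\<Sum>j<n. \<integral>x. F j x \<partial>M)) / real n) \<longlonglongrightarrow> 0"
proof -
  define P where "P = PiM (UNIV :: nat set) (\<lambda>_. M)"
  interpret P: prob_space P unfolding P_def by (intro prob_space_PiM prob_space_axioms)
  define D where "D = (\<lambda>n \<omega>. (\<Sum>j<n. F j (\<omega> j)) - (\<Sum>j<n. \<integral>x. F j x \<partial>M))"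
  have [measurable]: "F j \<in> borel_measurable M" for j by (rule F)
  have [measurable]: "D n \<in> borel_measurable P" for n unfolding D_def P_def by measurable
  have small: "AE \<omega> in P. \<forall>\<^sub>F n in sequentially. \<bar>D n \<omega>\<bar> < \<epsilon> * real n" if \<epsilon>: "\<epsilon> > 0" for \<epsilon>
  proof -
    define E where "E = (\<lambda>n. {\<omega>\<in>space P. \<bar>D n \<omega>\<bar> \<ge> \<epsilon> * real n})"
    have E: "E n \<in> sets P" for n unfolding E_def by measurable
    \<comment> \<open>The value of \<open>2 * \<epsilon>\<^sup>2 * n\<^sup>2 / (4 * K\<^sup>2 * n *
      sqrt n)\<close> divided by \<open>sqrt n\<close>.\<close>
    define a where "a = \<epsilon>\<^sup>2 / (2 * K\<^sup>2)"
    have a: "a > 0" unfolding a_def using \<epsilon> K by simp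
    have le: "measure P (E n) \<le> 2 * exp (- a * sqrt (real n))" if n: "n > 0" for n
    proof -
      let ?S = "\<Sum>j<n. (2 * (K * sqrt (sqrt (real (Suc j)))))\<^sup>2"
      have "measure P (E n) \<le> 2 * exp (- 2 * (\<epsilon> * real n)\<^sup>2 / ?S)"
        unfolding E_def D_def P_def using K \<epsilon> n by (intro Hoeffding_product F) auto
      also have "- 2 * (\<epsilon> * real n)\<^sup>2 / ?S \<le> - a * sqrt (real n)"
      proof -
        have "?S = (\<Sum>j<n. 4 * K\<^sup>2 * sqrt (real (Suc j)))" by (simp add: power_mult_distrib mult.assoc)
        also have "\<dots> \<le> (\<Sum>j<n. 4 * K\<^sup>2 * sqrt (real n))"
          by (intro sum_mono mult_left_mono) auto
        also have "\<dots> = 4 * K\<^sup>2 * sqrt (real n) * real n" by simp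
        finally have S: "?S \<le> 4 * K\<^sup>2 * sqrt (real n) * real n" .
        have Spos: "?S > 0" using n K by (intro sum_pos) auto
        have "a * sqrt (real n) * ?S \<le> a * sqrt (real n) * (4 * K\<^sup>2 * sqrt (real n) * real n)"
          using S a by (intro mult_left_mono) auto
        also have "\<dots> = 4 * a * K\<^sup>2 * (sqrt (real n) * sqrt (real n)) * real n" by (simp add: algebra_simps)
        also have "\<dots> = 2 * (\<epsilon> * real n)\<^sup>2"
          unfolding a_def using K by (simp add: power2_eq_square field_simps)
        finally show ?thesis using Spos by (simp add: pos_le_divide_eq minus_divide_left[symmetric])
      qed
      finally show ?thesis by simp
    qed
    have "summable (\<lambda>n. 2 * exp (- a * sqrt (real n)))"
    proof (rule summable_comparison_test_bigo)
      show "summable (\<lambda>n. norm (1 / real n ^ 2))" using inverse_power_summable[of 2] by (simp add: field_simps)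
      show "(\<lambda>n. 2 * exp (- a * sqrt (real n))) \<in> O(\<lambda>n. 1 / real n ^ 2)" using a by real_asymp
    qed
    moreover have "\<forall>\<^sub>F n in sequentially. norm (measure P (E n)) \<le> 2 * exp (- a * sqrt (real n))"
      using eventually_gt_at_top[of 0] by eventually_elim (use le in simp)
    ultimately have "summable (\<lambda>n. measure P (E n))"
      by (rule summable_comparison_test_ev[rotated])
    then have "AE \<omega> in P. \<forall>\<^sub>F n in sequentially. \<omega> \<in> space P - E n"
      using E by (intro borel_cantelli_AE1) (auto simp: P.emeasure_eq_measure)
    then show ?thesis
      by eventually_elim (auto simp: E_def elim!: eventually_mono)
  qed
  have "AE \<omega> in P. \<forall>m. \<forall>\<^sub>F n in sequentially. \<bar>D n \<omega>\<bar> < 1 / real (Suc m) * real n"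
    unfolding AE_all_countable by (intro allI small) simp
  then have "AE \<omega> in P. (\<lambda>n. D n \<omega> / real n) \<longlonglongrightarrow> 0"
  proof eventually_elim
    case (elim \<omega>)
    show ?case
    proof (rule tendstoI)
      fix e :: real assume "e > 0"
      then obtain m where m: "1 / real (Suc m) < e" using nat_approx_posE by blast
      show "\<forall>\<^sub>F n in sequentially. dist (D n \<omega> / real n) 0 < e"
        using elim[rule_format, of m] eventually_gt_at_top[of 0]
      proof eventually_elim
        case (elim n)
        then have "\<bar>D n \<omega>\<bar> / real n < 1 / real (Suc m)" by (simp add: pos_divide_less_eq)
        with m show ?case by (simp add: dist_real_def)
      qed
    qed
  qed
  then show ?thesis unfolding D_def P_def .
qed

lemma slowly_growing_lengths:
  fixes B :: "nat \<Rightarrow> real"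
  obtains l K where "K > 0" "\<forall>j. 1 \<le> l j" "\<forall>j. B (l j) \<le> K * sqrt (sqrt (real (Suc j)))"
    "filterlim l at_top sequentially"
proof -
  define K where "K = max 1 (B 1)"
  let ?b = "\<lambda>j. K * sqrt (sqrt (real (Suc j)))"
  define S where "S = (\<lambda>j. {n. 1 \<le> n \<and> n \<le> Suc j \<and> B n \<le> ?b j})"
  have K: "K > 0" "B 1 \<le> K" by (auto simp: K_def)
  have fin: "finite (S j)" for j by (rule finite_subset[of _ "{..Suc j}"]) (auto simp: S_def)
  have one: "1 \<in> S j" for j
  proof -
    have "K * 1 \<le> ?b j" using K by (intro mult_left_mono) auto
    with K(2) have "B 1 \<le> ?b j" by linarith
    then show ?thesis by (simp add: S_def)
  qed
  define l where "l = (\<lambda>j. Max (S j))"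
  have l: "l j \<in> S j" for j unfolding l_def using fin one by (intro Max_in) auto
  have "filterlim l at_top sequentially"
    unfolding filterlim_at_top
  proof
    fix Z :: nat
    have "filterlim ?b at_top sequentially" using K by real_asymp
    then have "\<forall>\<^sub>F j in sequentially. B (max 1 Z) \<le> ?b j" unfolding filterlim_at_top by blast
    then show "\<forall>\<^sub>F j in sequentially. Z \<le> l j"
      using eventually_ge_at_top[of "max 1 Z"]
    proof eventually_elim
      case (elim j)
      then have "max 1 Z \<in> S j" by (simp add: S_def)
      then have "max 1 Z \<le> l j" unfolding l_def by (intro Max_ge fin)
      then show ?case by simp
    qed
  qed
  with K(1) l that[of K l] show ?thesis by (auto simp: S_def)
qed

text \<open>The Stolz-Cesaro theorem: weights of at least 1 have a divergent sum, so finitely many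
  early terms do not count.\<close>

lemma weighted_cesaro:
  fixes a w :: "nat \<Rightarrow> real"
  assumes w: "\<And>j. 1 \<le> w j" and lim: "(\<lambda>j. a j / w j) \<longlonglongrightarrow> g"
  shows "(\<lambda>J. (\<Sum>j<J. a j) / (\<Sum>j<J. w j)) \<longlonglongrightarrow> g"
proof (rule LIMSEQ_I)
  fix e :: real assume e: "e > 0"
  obtain N where N: "\<And>j. j \<ge> N \<Longrightarrow> \<bar>a j / w j - g\<bar> < e / 2"
    using LIMSEQ_D[OF lim, of "e / 2"] e by auto
  have tail: "\<bar>a j - g * w j\<bar> \<le> e / 2 * w j" if "j \<ge> N" for j
  proof -
    have wj: "w j > 0" using w[of j] by simp
    then have "\<bar>a j - g * w j\<bar> = \<bar>a j / w j - g\<bar> * w j" by (simp add: abs_mult_pos[symmetric] field_simps)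
    also have "\<dots> \<le> e / 2 * w j" using N[OF that] wj by (intro mult_right_mono) auto
    finally show ?thesis .
  qed
  define K where "K = (\<Sum>j<N. \<bar>a j - g * w j\<bar>)"
  obtain N' where N': "real N' > 2 * K / e" using reals_Archimedean2 by blast
  have "norm ((\<Sum>j<J. a j) / (\<Sum>j<J. w j) - g) < e" if J: "J \<ge> max N (Suc N')" for J
  proof -
    let ?S = "\<Sum>j<J. w j"
    have SJ: "real J \<le> ?S" using sum_mono[of "{..<J}" "\<lambda>_. 1" w] w by simp
    have S0: "?S > 0" using SJ J by simp
    have "\<bar>(\<Sum>j<J. a j) - g * ?S\<bar> = \<bar>\<Sum>j<J. a j - g * w j\<bar>"
      by (simp add: sum_subtractf sum_distrib_left)
    also have "\<dots> \<le> (\<Sum>j<J. \<bar>a j - g * w j\<bar>)" by (rule sum_abs)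
    also have "\<dots> \<le> (\<Sum>j<J. (if j < N then \<bar>a j - g * w j\<bar> else 0) + e / 2 * w j)"
    proof (rule sum_mono)
      fix j
      have "0 \<le> e / 2 * w j" using e w[of j] by simp
      then show "\<bar>a j - g * w j\<bar> \<le> (if j < N then \<bar>a j - g * w j\<bar> else 0) + e / 2 * w j"
        using tail[of j] by simp
    qed
    also have "\<dots> = K + e / 2 * ?S"
    proof -
      have "{..<J} \<inter> {j. j < N} = {..<N}" using J by auto
      then show ?thesis unfolding K_def sum.distrib sum_distrib_left by (simp add: sum.If_cases)
    qed
    also have "K < e / 2 * ?S"
    proof -
      have "2 * K / e < ?S" using N' SJ J by simp
      then show ?thesis using e by (simp add: field_simps)
    qed
    finally have "\<bar>(\<Sum>j<J. a j) - g * ?S\<bar> < e * ?S" by simp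
    moreover have "(\<Sum>j<J. a j) / ?S - g = ((\<Sum>j<J. a j) - g * ?S) / ?S" using S0 by (simp add: field_simps)
    ultimately show ?thesis using S0 by (simp add: pos_divide_less_eq)
  qed
  then show "\<exists>no. \<forall>n\<ge>no. norm ((\<Sum>j<n. a j) / (\<Sum>j<n. w j) - g) < e" by blast
qed

section \<open>Genericity from word frequencies\<close>

context shift_measure
begin

text \<open>A continuous function is uniformly within \<open>e / 3\<close> of a function
  \<open>G\<close> of the prefix, whose averages are finite combinations of word
  frequencies.\<close>

lemma generic_pointI:
  assumes x: "x \<in> full_shift A"
    and freq: "\<And>m v. v \<in> prefix m ` space M \<Longrightarrow>
      (\<lambda>n. (\<Sum>t<n. of_bool (prefix m ((left_shift ^^ t) x) = v)) / real n) \<longlonglongrightarrow> prob {y\<in>space M. prefix m y = v}"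
  shows "x \<in> generic_points (shift_top A) left_shift M"
  unfolding generic_points_def
proof (intro CollectI conjI allI impI x)
  fix g :: "(nat \<Rightarrow> 'a) \<Rightarrow> real" assume g: "continuous_map (shift_top A) euclideanreal g"
  let ?T = "\<lambda>t. (left_shift ^^ t) x"
  have Tx: "?T t \<in> full_shift A" for t using x funpow_T_space unfolding space_M by blast
  show "(\<lambda>n. (1 / real n) * (\<Sum>t<n. g (?T t))) \<longlonglongrightarrow> (\<integral>y. g y \<partial>M)"
  proof (rule LIMSEQ_I)
    fix e :: real assume "e > 0"
    then have e: "e / 3 > 0" by simp
    obtain m where m: "\<And>x y. x \<in> full_shift A \<Longrightarrow> y \<in> full_shift A \<Longrightarrow> (\<And>i. i < m \<Longrightarrow> x i = y i) \<Longrightarrow>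
        \<bar>g x - g y\<bar> < e / 3"
      using continuous_map_shift_top_imp_determined_approx[OF finite_A g e] by blast
    let ?V = "prefix m ` space M"
    have finV: "finite ?V" using simple_function_prefix by (rule simple_functionD)
    define r where "r = inv_into (space M) (prefix m)"
    define G where "G = (\<lambda>v. g (r v))"
    have r: "r v \<in> full_shift A" "prefix m (r v) = v" if "v \<in> ?V" for v
      using that unfolding r_def space_M by (auto intro: inv_into_into simp: f_inv_into_f)
    have close: "\<bar>g y - G (prefix m y)\<bar> < e / 3" if y: "y \<in> full_shift A" for y
    proof -
      have v: "prefix m y \<in> ?V" using y by (simp add: space_M)
      have "prefix m y = prefix m (r (prefix m y))" using r(2)[OF v] by simp
      then have "y i = r (prefix m y) i" if "i < m" for i using that unfolding prefix_eq_iff by blast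
      with m[OF y r(1)[OF v]] show ?thesis by (simp add: G_def)
    qed
    have int': "integrable M (\<lambda>y. G (prefix m y))"
      and val': "(\<integral>y. G (prefix m y) \<partial>M) = (\<Sum>v\<in>?V. prob {y\<in>space M. prefix m y = v} * G v)"
      by (rule integral_simple_function[OF simple_function_prefix])+
    have "g \<in> borel_measurable M"
    proof (rule borel_measurableI)
      fix S :: "real set" assume "open S"
      then have "openin (shift_top A) {y \<in> full_shift A. g y \<in> S}"
        by (intro openin_continuous_map_preimage[OF g]) simp
      then have "{y \<in> full_shift A. g y \<in> S} \<in> sets M" by (rule open_sets_M)
      moreover have "g -` S \<inter> space M = {y \<in> full_shift A. g y \<in> S}" by (auto simp: space_M)
      ultimately show "g -` S \<inter> space M \<in> sets M" by simp
    qed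
    then have int: "integrable M g"
    proof (rule integrable_const_bound[rotated])
      show "AE y in M. norm (g y) \<le> (\<Sum>v\<in>?V. \<bar>G v\<bar>) + e / 3"
      proof (rule AE_I2)
        fix y assume y: "y \<in> space M"
        have "\<bar>G (prefix m y)\<bar> \<le> (\<Sum>v\<in>?V. \<bar>G v\<bar>)"
          using y finV by (intro member_le_sum[of _ ?V "\<lambda>v. \<bar>G v\<bar>"]) auto
        moreover have "\<bar>g y - G (prefix m y)\<bar> < e / 3" using close y by (simp add: space_M)
        ultimately show "norm (g y) \<le> (\<Sum>v\<in>?V. \<bar>G v\<bar>) + e / 3" unfolding real_norm_def by linarith
      qed
    qed
    have "\<bar>(\<integral>y. g y \<partial>M) - (\<integral>y. G (prefix m y) \<partial>M)\<bar> \<le> (\<integral>y. \<bar>g y - G (prefix m y)\<bar> \<partial>M)"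
      using integral_abs_bound[of M "\<lambda>y. g y - G (prefix m y)"] int int' by simp
    also have "\<dots> \<le> (\<integral>y. e / 3 \<partial>M)"
      using int int' close by (intro integral_mono) (auto simp: space_M less_imp_le)
    finally have I: "\<bar>(\<integral>y. g y \<partial>M) - (\<integral>y. G (prefix m y) \<partial>M)\<bar> \<le> e / 3" by (simp add: prob_space)
    have "(\<lambda>n. \<Sum>v\<in>?V. (\<Sum>t<n. of_bool (prefix m (?T t) = v)) / real n * G v)
        \<longlonglongrightarrow> (\<Sum>v\<in>?V. prob {y\<in>space M. prefix m y = v} * G v)"
      using freq by (intro tendsto_sum tendsto_mult_right)
    moreover have "(\<Sum>v\<in>?V. (\<Sum>t<n. of_bool (prefix m (?T t) = v)) / real n * G v)
        = (\<Sum>t<n. G (prefix m (?T t))) / real n" for n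
    proof -
      have "(\<Sum>t<n. G (prefix m (?T t))) = (\<Sum>t<n. \<Sum>v\<in>?V. of_bool (prefix m (?T t) = v) * G v)"
      proof (rule sum.cong)
        fix t
        have "(\<Sum>v\<in>?V. of_bool (prefix m (?T t) = v) * G v) = (\<Sum>v\<in>?V. if v = prefix m (?T t) then G v else 0)"
          by (intro sum.cong) auto
        also have "\<dots> = G (prefix m (?T t))" using finV Tx[of t] by (simp add: space_M)
        finally show "G (prefix m (?T t)) = (\<Sum>v\<in>?V. of_bool (prefix m (?T t) = v) * G v)" ..
      qed simp
      also have "\<dots> = (\<Sum>v\<in>?V. \<Sum>t<n. of_bool (prefix m (?T t) = v) * G v)" by (rule sum.swap)
      finally show ?thesis by (simp add: sum_divide_distrib sum_distrib_right)
    qed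
    ultimately have "(\<lambda>n. (\<Sum>t<n. G (prefix m (?T t))) / real n) \<longlonglongrightarrow> (\<integral>y. G (prefix m y) \<partial>M)"
      unfolding val' by simp
    from LIMSEQ_D[OF this e] obtain N where N: "\<And>n. n \<ge> N \<Longrightarrow>
      \<bar>(\<Sum>t<n. G (prefix m (?T t))) / real n - (\<integral>y. G (prefix m y) \<partial>M)\<bar> < e / 3" by auto
    have "norm ((1 / real n) * (\<Sum>t<n. g (?T t)) - (\<integral>y. g y \<partial>M)) < e" if n: "n \<ge> N" for n
    proof -
      have "\<bar>(\<Sum>t<n. g (?T t)) - (\<Sum>t<n. G (prefix m (?T t)))\<bar> \<le> (\<Sum>t<n. \<bar>g (?T t) - G (prefix m (?T t))\<bar>)"
        unfolding sum_subtractf[symmetric] by (rule sum_abs)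
      also have "\<dots> \<le> (\<Sum>t<n. e / 3)" using close[OF Tx] by (intro sum_mono less_imp_le)
      finally have "\<bar>(\<Sum>t<n. g (?T t)) - (\<Sum>t<n. G (prefix m (?T t)))\<bar> / real n \<le> real n * (e / 3) / real n"
        by (intro divide_right_mono) auto
      also have "\<dots> \<le> e / 3" using e by (cases "n = 0") auto
      finally have "\<bar>(\<Sum>t<n. g (?T t)) / real n - (\<Sum>t<n. G (prefix m (?T t))) / real n\<bar> \<le> e / 3"
        by (simp add: diff_divide_distrib[symmetric])
      with N[OF n] I have "\<bar>(\<Sum>t<n. g (?T t)) / real n - (\<integral>y. g y \<partial>M)\<bar> < e" by linarith
      then show ?thesis by simp
    qed
    then show "\<exists>N. \<forall>n\<ge>N. norm ((1 / real n) * (\<Sum>t<n. g (?T t)) - (\<integral>y. g y \<partial>M)) < e" by blast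
  qed
qed

end

section \<open>Concatenating blocks\<close>

text \<open>\<open>concat_blocks l \<omega>\<close> consists of the first \<open>l 0\<close> symbols of \<open>\<omega> 0\<close>, then the first \<open>l 1\<close>
  symbols of \<open>\<omega> 1\<close>, and so on.\<close>

definition block_start :: "(nat \<Rightarrow> nat) \<Rightarrow> nat \<Rightarrow> nat" where
  "block_start l J = (\<Sum>j<J. l j)"

definition concat_blocks :: "(nat \<Rightarrow> nat) \<Rightarrow> (nat \<Rightarrow> nat \<Rightarrow> 'a) \<Rightarrow> nat \<Rightarrow> 'a" where
  "concat_blocks l \<omega> t = \<omega> (level (block_start l) t) (t - block_start l (level (block_start l) t))"

lemma block_start_0: "block_start l 0 = 0"
  by (simp add: block_start_def)

lemma block_start_Suc: "block_start l (Suc J) = block_start l J + l J"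
  by (simp add: block_start_def)

lemma block_start_mono: "I \<le> J \<Longrightarrow> block_start l I \<le> block_start l J"
  unfolding block_start_def by (intro sum_mono2) auto

text \<open>Slow growth makes a single block negligible against the length before it, and unbounded
  growth makes the number of blocks negligible against their total length. The former controls an
  incomplete last block, the latter the effects at the block ends.\<close>

locale growing_blocks =
  fixes l :: "nat \<Rightarrow> nat" and K :: real
  assumes l_pos: "\<And>j. 1 \<le> l j"
    and l_slow: "\<And>j. real (l j) \<le> K * sqrt (sqrt (real (Suc j)))"
    and l_top: "filterlim l at_top sequentially"
begin

abbreviation S :: "nat \<Rightarrow> nat" where
  "S \<equiv> block_start l"

lemma S_ge: "J \<le> S J"
  unfolding block_start_def using sum_mono[of "{..<J}" "\<lambda>_. 1" l] l_pos by simp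

lemma level_S: "r < l j \<Longrightarrow> level S (S j + r) = j"
proof (rule antisym)
  assume r: "r < l j"
  then show "level S (S j + r) \<le> j" by (intro level_le) (simp add: block_start_Suc)
  have less: "S j + r < S (Suc (level S (S j + r)))"
    by (rule less_level[of _ _ j]) (use r in \<open>simp add: block_start_Suc\<close>)
  show "j \<le> level S (S j + r)"
  proof (rule ccontr)
    assume "\<not> j \<le> level S (S j + r)"
    then have "S (Suc (level S (S j + r))) \<le> S j" by (intro block_start_mono) simp
    with less show False by simp
  qed
qed

lemma concat_blocks_nth: "r < l j \<Longrightarrow> concat_blocks l \<omega> (S j + r) = \<omega> j r"
  by (simp add: concat_blocks_def level_S)

lemma level_S_bounds: "S (level S n) \<le> n" "n < S (Suc (level S n))"
proof -
  have "n < S (Suc n)" using S_ge[of "Suc n"] by simp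
  then show "n < S (Suc (level S n))" by (rule less_level)
  show "S (level S n) \<le> n"
  proof (cases "level S n")
    case (Suc i)
    then have "\<not> n < S (Suc i)" using level_le[of n S i] by auto
    then show ?thesis using Suc by simp
  qed (simp add: block_start_0)
qed

lemma level_S_top: "filterlim (level S) at_top sequentially"
  unfolding filterlim_at_top
proof
  fix Z
  show "\<forall>\<^sub>F n in sequentially. Z \<le> level S n"
    using eventually_ge_at_top[of "S Z"]
  proof eventually_elim
    case (elim n)
    show ?case
    proof (rule ccontr)
      assume "\<not> Z \<le> level S n"
      then have "S (Suc (level S n)) \<le> S Z" by (intro block_start_mono) simp
      with level_S_bounds(2)[of n] elim show False by simp
    qed
  qed
qed

lemma length_ratio: "(\<lambda>J. real (l J) / real (S J)) \<longlonglongrightarrow> 0"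
proof (rule Lim_null_comparison)
  have K: "K > 0"
  proof (rule ccontr)
    assume "\<not> K > 0"
    then have "K * sqrt (sqrt (real (Suc 0))) \<le> 0" by (simp add: mult_nonpos_nonneg)
    with l_slow[of 0] l_pos[of 0] show False by simp
  qed
  show "\<forall>\<^sub>F J in sequentially. norm (real (l J) / real (S J)) \<le> K * sqrt (sqrt (real (Suc J))) / real J"
    using eventually_gt_at_top[of 0]
  proof eventually_elim
    case (elim J)
    then have "real (l J) / real (S J) \<le> K * sqrt (sqrt (real (Suc J))) / real J"
      using l_slow[of J] S_ge[of J] K by (intro frac_le) auto
    then show ?case by simp
  qed
  show "(\<lambda>J. K * sqrt (sqrt (real (Suc J))) / real J) \<longlonglongrightarrow> 0" by real_asymp
qed

lemma count_ratio: "(\<lambda>J. real J / real (S J)) \<longlonglongrightarrow> 0"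
proof -
  have "(\<lambda>J. (\<Sum>j<J. 1) / (\<Sum>j<J. real (l j))) \<longlonglongrightarrow> 0"
  proof (rule weighted_cesaro)
    show "1 \<le> real (l j)" for j using l_pos[of j] by simp
    have "filterlim (\<lambda>j. real (l j)) at_top sequentially"
      using filterlim_compose[OF filterlim_real_sequentially l_top] .
    then show "(\<lambda>j. 1 / real (l j)) \<longlonglongrightarrow> 0" by (rule tendsto_divide_0[OF tendsto_const filterlim_at_top_imp_at_infinity])
  qed
  then show ?thesis by (simp add: block_start_def)
qed

lemma level_S_ratio: "(\<lambda>n. real (S (level S n)) / real n) \<longlonglongrightarrow> 1"
proof (rule tendsto_sandwich)
  have "(\<lambda>n. real (l (level S n)) / real (S (level S n))) \<longlonglongrightarrow> 0"
    by (rule filterlim_compose[OF length_ratio level_S_top])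
  from tendsto_diff[OF tendsto_const[of 1] this]
  show "(\<lambda>n. 1 - real (l (level S n)) / real (S (level S n))) \<longlonglongrightarrow> 1" by simp
  have "\<forall>\<^sub>F n in sequentially. 1 \<le> level S n" using level_S_top unfolding filterlim_at_top by blast
  then show "\<forall>\<^sub>F n in sequentially. 1 - real (l (level S n)) / real (S (level S n)) \<le> real (S (level S n)) / real n"
    using eventually_gt_at_top[of 0]
  proof eventually_elim
    case (elim n)
    let ?J = "level S n"
    have S0: "0 < real (S ?J)" using S_ge[of ?J] elim by simp
    have "real n - real (S ?J) \<le> real (l ?J)" using level_S_bounds(2)[of n] by (simp add: block_start_Suc)
    then have "(real n - real (S ?J)) / real n \<le> real (l ?J) / real (S ?J)"
      using level_S_bounds(1)[of n] S0 elim by (intro frac_le) auto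
    then show ?case using elim by (simp add: diff_divide_distrib)
  qed
  show "\<forall>\<^sub>F n in sequentially. real (S (level S n)) / real n \<le> 1"
    using eventually_gt_at_top[of 0]
    by eventually_elim (use level_S_bounds(1) in \<open>simp add: divide_le_eq\<close>)
qed simp

text \<open>The law of large numbers normalises by the number of blocks, genericity and entropy by
  the number of letters. Fluctuations of order \<open>o(J)\<close> are also \<open>o(S J)\<close>,
  and the means are averaged with weights \<open>l j\<close>.\<close>

lemma tendsto_block_average:
  fixes R e :: "nat \<Rightarrow> real"
  assumes "(\<lambda>J. (R J - (\<Sum>j<J. e j)) / real J) \<longlonglongrightarrow> 0" and "(\<lambda>j. e j / real (l j)) \<longlonglongrightarrow> g"
  shows "(\<lambda>J. R J / real (S J)) \<longlonglongrightarrow> g"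
proof -
  have "(\<lambda>J. (R J - (\<Sum>j<J. e j)) / real J * (real J / real (S J)) + (\<Sum>j<J. e j) / (\<Sum>j<J. real (l j)))
      \<longlonglongrightarrow> 0 * 0 + g"
    using assms l_pos by (intro tendsto_add tendsto_mult count_ratio weighted_cesaro) auto
  moreover have "\<forall>\<^sub>F J in sequentially.
      (R J - (\<Sum>j<J. e j)) / real J * (real J / real (S J)) + (\<Sum>j<J. e j) / (\<Sum>j<J. real (l j)) = R J / real (S J)"
    using eventually_gt_at_top[of 0]
  proof eventually_elim
    case (elim J)
    then have "(R J - (\<Sum>j<J. e j)) / real J * (real J / real (S J)) = (R J - (\<Sum>j<J. e j)) / real (S J)"
      by simp
    then show ?case by (simp add: block_start_def diff_divide_distrib)
  qed
  ultimately show ?thesis by (simp add: tendsto_cong)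
qed

end

context shift_measure
begin

lemma concat_blocks_in_full_shift: "(\<And>j. \<omega> j \<in> full_shift A) \<Longrightarrow> concat_blocks l \<omega> \<in> full_shift A"
  unfolding full_shift_eq concat_blocks_def by blast

end

text \<open>A function of the first \<open>m\<close> coordinates takes the same values along the concatenation and
  along the blocks, except at the last \<open>m\<close> positions of each block.\<close>

lemma (in growing_blocks) tendsto_average_concat_blocks:
  fixes g :: "(nat \<Rightarrow> 'a) \<Rightarrow> real"
  assumes g: "\<And>x y. (\<And>i. i < m \<Longrightarrow> x i = y i) \<Longrightarrow> g x = g y" "\<And>x. 0 \<le> g x" "\<And>x. g x \<le> 1"
    and lim: "(\<lambda>J. (\<Sum>j<J. \<Sum>t<l j. g ((left_shift ^^ t) (\<omega> j))) / real (S J)) \<longlonglongrightarrow> \<gamma>"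
  shows "(\<lambda>n. (\<Sum>t<n. g ((left_shift ^^ t) (concat_blocks l \<omega>))) / real n) \<longlonglongrightarrow> \<gamma>"
proof -
  let ?x = "concat_blocks l \<omega>"
  let ?G = "\<lambda>t. g ((left_shift ^^ t) ?x)"
  define B where "B = (\<lambda>n. \<Sum>t<n. ?G t)"
  have block: "\<bar>(\<Sum>r<l j. ?G (S j + r)) - (\<Sum>t<l j. g ((left_shift ^^ t) (\<omega> j)))\<bar> \<le> real m" for j
  proof -
    have eq: "?G (S j + r) = g ((left_shift ^^ r) (\<omega> j))" if "r + m \<le> l j" for r
    proof (rule g(1))
      fix i assume "i < m"
      then have "r + i < l j" using that by simp
      from concat_blocks_nth[OF this, of \<omega>]
      show "(left_shift ^^ (S j + r)) ?x i = (left_shift ^^ r) (\<omega> j) i"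
        by (simp add: funpow_left_shift add.assoc)
    qed
    have "\<bar>(\<Sum>r<l j. ?G (S j + r)) - (\<Sum>t<l j. g ((left_shift ^^ t) (\<omega> j)))\<bar>
        \<le> (\<Sum>r<l j. \<bar>?G (S j + r) - g ((left_shift ^^ r) (\<omega> j))\<bar>)"
      unfolding sum_subtractf[symmetric] by (rule sum_abs)
    also have "\<dots> \<le> (\<Sum>r<l j. if l j < r + m then 1 else 0)"
    proof (rule sum_mono)
      fix r
      show "\<bar>?G (S j + r) - g ((left_shift ^^ r) (\<omega> j))\<bar> \<le> (if l j < r + m then 1 else 0)"
        using eq[of r] g(2,3)[of "(left_shift ^^ (S j + r)) ?x"] g(2,3)[of "(left_shift ^^ r) (\<omega> j)"]
        by (auto simp: abs_le_iff)
    qed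
    also have "\<dots> = real (card ({..<l j} \<inter> {r. l j < r + m}))" by (simp add: sum.If_cases)
    also have "\<dots> \<le> real m"
    proof -
      have "card ({..<l j} \<inter> {r. l j < r + m}) \<le> card {l j - m..<l j}" by (intro card_mono) auto
      then show ?thesis by simp
    qed
    finally show ?thesis .
  qed
  have B_S: "B (S J) = (\<Sum>j<J. \<Sum>r<l j. ?G (S j + r))" for J
  proof (induction J)
    case (Suc J)
    have "B (S J + L) = B (S J) + (\<Sum>r<L. ?G (S J + r))" for L by (induction L) (auto simp: B_def)
    with Suc show ?case by (simp add: block_start_Suc)
  qed (simp add: B_def block_start_0)
  have "\<bar>B (S J) - (\<Sum>j<J. \<Sum>t<l j. g ((left_shift ^^ t) (\<omega> j)))\<bar> \<le> real J * real m" for J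
  proof -
    have "\<bar>B (S J) - (\<Sum>j<J. \<Sum>t<l j. g ((left_shift ^^ t) (\<omega> j)))\<bar>
        \<le> (\<Sum>j<J. \<bar>(\<Sum>r<l j. ?G (S j + r)) - (\<Sum>t<l j. g ((left_shift ^^ t) (\<omega> j)))\<bar>)"
      unfolding B_S sum_subtractf[symmetric] by (rule sum_abs)
    also have "\<dots> \<le> (\<Sum>j<J. real m)" by (intro sum_mono block)
    finally show ?thesis by simp
  qed
  then have diff: "\<bar>B (S J) / real (S J) - (\<Sum>j<J. \<Sum>t<l j. g ((left_shift ^^ t) (\<omega> j))) / real (S J)\<bar>
      \<le> real J / real (S J) * real m" for J
    unfolding diff_divide_distrib[symmetric] abs_divide by (simp add: divide_right_mono)
  have "(\<lambda>J. B (S J) / real (S J) - (\<Sum>j<J. \<Sum>t<l j. g ((left_shift ^^ t) (\<omega> j))) / real (S J)) \<longlonglongrightarrow> 0"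
  proof (rule Lim_null_comparison)
    show "(\<lambda>J. real J / real (S J) * real m) \<longlonglongrightarrow> 0" using tendsto_mult_left_zero[OF count_ratio] .
  qed (use diff in simp)
  from tendsto_add[OF this lim] have BS: "(\<lambda>J. B (S J) / real (S J)) \<longlonglongrightarrow> \<gamma>" by simp
  have main: "(\<lambda>n. B (S (level S n)) / real (S (level S n)) * (real (S (level S n)) / real n)) \<longlonglongrightarrow> \<gamma> * 1"
    by (intro tendsto_mult level_S_ratio filterlim_compose[OF BS level_S_top])
  \<comment> \<open>The incomplete last block contributes at most one for each of its
    \<open>n - S (level S n)\<close> positions.\<close>
  have "(\<lambda>n. B n / real n - B (S (level S n)) / real (S (level S n)) * (real (S (level S n)) / real n)) \<longlonglongrightarrow> 0"
  proof (rule Lim_null_comparison)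
    show "(\<lambda>n. 1 - real (S (level S n)) / real n) \<longlonglongrightarrow> 0"
      using tendsto_diff[OF tendsto_const[of 1] level_S_ratio] by simp
    show "\<forall>\<^sub>F n in sequentially. norm (B n / real n -
        B (S (level S n)) / real (S (level S n)) * (real (S (level S n)) / real n)) \<le> 1 - real (S (level S n)) / real n"
      using eventually_gt_at_top[of 0]
    proof eventually_elim
      case (elim n)
      let ?s = "S (level S n)"
      have le: "?s \<le> n" by (rule level_S_bounds)
      have "B ?s / real ?s * (real ?s / real n) = B ?s / real n"
        by (cases "?s = 0") (auto simp: B_def)
      then have "B n / real n - B ?s / real ?s * (real ?s / real n) = (B n - B ?s) / real n"
        by (simp only: diff_divide_distrib)
      moreover have "B n - B ?s = (\<Sum>t\<in>{?s..<n}. ?G t)"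
        using sum.atLeastLessThan_concat[of 0 ?s n ?G] le by (simp add: B_def lessThan_atLeast0)
      moreover have "0 \<le> (\<Sum>t\<in>{?s..<n}. ?G t)" by (intro sum_nonneg g)
      moreover have "(\<Sum>t\<in>{?s..<n}. ?G t) \<le> real n - real ?s"
        using sum_mono[of "{?s..<n}" ?G "\<lambda>_. 1"] g(3) le by (simp add: of_nat_diff)
      moreover have "1 - real ?s / real n = (real n - real ?s) / real n" using elim by (simp add: field_simps)
      ultimately show ?case
        by (simp only: real_norm_def abs_divide abs_of_nat abs_of_nonneg) (rule divide_right_mono, simp_all)
    qed
  qed
  from tendsto_add[OF this main] show ?thesis by (simp add: B_def)
qed

section \<open>Lower bound\<close>

context weighted_shift
begin

text \<open>For each length the information takes finitely many values. Including \<open>n\<close>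
  in the bound lets one sequence control both the lengths of the blocks and their
  information.\<close>

lemma word_information_bound:
  obtains b :: "nat \<Rightarrow> real" where
    "\<And>i n x. i < k \<Longrightarrow> x \<in> space M \<Longrightarrow> \<bar>ln (fiber_measure M (word i n) x)\<bar> \<le> b n" "\<And>n. real n \<le> b n"
proof -
  define b where "b = (\<lambda>n. real n + (\<Sum>i<k. \<Sum>v\<in>(\<lambda>x. \<bar>ln (fiber_measure M (word i n) x)\<bar>) ` space M. \<bar>v\<bar>))"
  have "\<bar>ln (fiber_measure M (word i n) x)\<bar> \<le> b n" if i: "i < k" and x: "x \<in> space M" for i n x
  proof -
    let ?I = "\<lambda>i x. \<bar>ln (fiber_measure M (word i n) x)\<bar>"
    have "determined A n (?I i)"
      by (intro determinedI arg_cong[of _ _ "\<lambda>u. \<bar>ln u\<bar>"] fiber_measure_word_cong arg_cong[of _ _ "\<Phi> i"])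
    then have fin: "finite (?I i ` space M)"
      unfolding space_M by (rule finite_image_determined[OF finite_A])
    have "?I i x \<le> (\<Sum>v\<in>?I i ` space M. \<bar>v\<bar>)"
      using member_le_sum[of "?I i x" "?I i ` space M" abs] x fin by simp
    also have "\<dots> \<le> (\<Sum>i<k. \<Sum>v\<in>?I i ` space M. \<bar>v\<bar>)"
      using i by (intro member_le_sum[of i "{..<k}" "\<lambda>i. \<Sum>v\<in>?I i ` space M. \<bar>v\<bar>"]) (auto intro!: sum_nonneg)
    finally show ?thesis unfolding b_def by simp
  qed
  moreover have "real n \<le> b n" for n unfolding b_def by (simp add: sum_nonneg)
  ultimately show ?thesis using that by blast
qed

lemma word_information_mean:
  "(\<integral>x. ln (fiber_measure M (word i n) x) \<partial>M) = - fiber_entropy M (word i n)"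
  unfolding fiber_entropy_def by simp

theorem generic_points_lower_bound:
  "generic_points (shift_top A) left_shift M \<noteq> {} \<and>
   ereal total \<le> hausdorff_dim (full_shift A) d (generic_points (shift_top A) left_shift M)"
proof -
  obtain b where b: "\<And>i n x. i < k \<Longrightarrow> x \<in> space M \<Longrightarrow> \<bar>ln (fiber_measure M (word i n) x)\<bar> \<le> b n"
    "\<And>n. real n \<le> b n"
    by (rule word_information_bound) (rule that; assumption)
  obtain l K where lK: "K > 0" "\<forall>j. 1 \<le> l j" "\<forall>j. b (l j) \<le> K * sqrt (sqrt (real (Suc j)))"
      "filterlim l at_top sequentially"
    by (rule slowly_growing_lengths[of b]) (rule that; assumption)
  \<comment> \<open>\<open>b n\<close> is at least \<open>n\<close>, so the slow growth of
    \<open>b (l j)\<close> is inherited by \<open>l j\<close>.\<close>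
  interpret growing_blocks l K
  proof
    show "real (l j) \<le> K * sqrt (sqrt (real (Suc j)))" for j
      using b(2)[of "l j"] lK(3)[rule_format, of j] by linarith
  qed (use lK in auto)
  define P where "P = PiM (UNIV :: nat set) (\<lambda>_. M)"
  interpret PP: product_prob_space "\<lambda>_. M" "UNIV :: nat set"
    by (intro product_prob_spaceI prob_space_axioms)
  interpret P: prob_space P unfolding P_def by (intro prob_space_PiM prob_space_axioms)
  have spP: "\<omega> j \<in> space M" if "\<omega> \<in> space P" for \<omega> j using that by (auto simp: P_def space_PiM)
  define \<xi> where "\<xi> = (\<lambda>\<omega>. concat_blocks l \<omega> :: nat \<Rightarrow> 'a)"
  have \<xi>A: "\<xi> \<omega> \<in> full_shift A" if "\<omega> \<in> space P" for \<omega>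
    unfolding \<xi>_def using spP[OF that] by (intro concat_blocks_in_full_shift) (simp add: space_M)
  let ?I = "\<lambda>i n x. ln (fiber_measure M (word i n) x)"

  have freq: "AE \<omega> in P. (\<lambda>n. (\<Sum>t<n. of_bool (prefix m ((left_shift ^^ t) (\<xi> \<omega>)) = v)) / real n)
      \<longlonglongrightarrow> prob {y\<in>space M. prefix m y = v}" for m v
  proof -
    define g where "g = (\<lambda>x. of_bool (prefix m x = v) :: real)"
    have gdet: "g x = g y" if "\<And>i. i < m \<Longrightarrow> x i = y i" for x y
    proof -
      have "prefix m x = prefix m y" using that by (simp add: prefix_eq_iff)
      then show ?thesis by (simp add: g_def)
    qed
    have gs: "simple_function M g" by (rule determined_simple_function[OF determinedI]) (rule gdet)
    have gm: "g \<in> borel_measurable M" using gs by (rule borel_measurable_simple_function)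
    have g_int: "(\<integral>x. g x \<partial>M) = prob {y\<in>space M. prefix m y = v}"
    proof -
      have "(\<integral>x. g x \<partial>M) = (\<integral>x. indicator {y\<in>space M. prefix m y = v} x \<partial>M)"
        by (intro Bochner_Integration.integral_cong) (auto simp: g_def)
      also have "\<dots> = prob ({y\<in>space M. prefix m y = v} \<inter> space M)" by simp
      also have "{y\<in>space M. prefix m y = v} \<inter> space M = {y\<in>space M. prefix m y = v}" by auto
      finally show ?thesis .
    qed
    have gTm: "(\<lambda>x. g ((left_shift ^^ t) x)) \<in> borel_measurable M" for t
      by (rule measurable_compose[OF measurable_funpow_T gm])
    have gT: "integrable M (\<lambda>x. g ((left_shift ^^ t) x))" for t
      by (rule integrable_const_bound[of _ 1, OF _ gTm]) (simp add: g_def)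
    \<comment> \<open>Occurrences counted along the orbit of the block's own point, including
      windows that run past position \<open>l j\<close>. Invariance makes the mean exactly
      \<open>l j\<close> times the probability of the word.\<close>
    define F where "F = (\<lambda>j x. \<Sum>t<l j. g ((left_shift ^^ t) x))"
    have F_int: "(\<integral>x. F j x \<partial>M) = real (l j) * prob {y\<in>space M. prefix m y = v}" for j
      unfolding F_def using gT integral_funpow_T[OF gm]
      by (subst Bochner_Integration.integral_sum) (auto simp: g_int)
    have "AE \<omega> in P. (\<lambda>n. ((\<Sum>j<n. F j (\<omega> j)) - (\<Sum>j<n. \<integral>x. F j x \<partial>M)) / real n) \<longlonglongrightarrow> 0"
      unfolding P_def
    proof (rule strong_law_product[OF _ _ lK(1)])
      show "F j \<in> borel_measurable M" for j unfolding F_def using gTm by (intro borel_measurable_sum)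
      show "\<bar>F j x\<bar> \<le> K * sqrt (sqrt (real (Suc j)))" for j x
      proof -
        have "\<bar>F j x\<bar> \<le> (\<Sum>t<l j. \<bar>g ((left_shift ^^ t) x)\<bar>)" unfolding F_def by (rule sum_abs)
        also have "\<dots> \<le> (\<Sum>t<l j. 1)" by (intro sum_mono) (simp add: g_def)
        also have "\<dots> \<le> K * sqrt (sqrt (real (Suc j)))" using l_slow[of j] by simp
        finally show ?thesis .
      qed
    qed
    then show ?thesis
    proof eventually_elim
      case (elim \<omega>)
      have "(\<lambda>J. (\<Sum>j<J. F j (\<omega> j)) / real (S J)) \<longlonglongrightarrow> prob {y\<in>space M. prefix m y = v}"
      proof (rule tendsto_block_average[OF elim])
        have "(\<integral>x. F j x \<partial>M) / real (l j) = prob {y\<in>space M. prefix m y = v}" for j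
          using l_pos[of j] unfolding F_int by simp
        then show "(\<lambda>j. (\<integral>x. F j x \<partial>M) / real (l j)) \<longlonglongrightarrow> prob {y\<in>space M. prefix m y = v}"
          by simp
      qed
      then have "(\<lambda>J. (\<Sum>j<J. \<Sum>t<l j. g ((left_shift ^^ t) (\<omega> j))) / real (S J))
          \<longlonglongrightarrow> prob {y\<in>space M. prefix m y = v}" unfolding F_def .
      then have "(\<lambda>n. (\<Sum>t<n. g ((left_shift ^^ t) (concat_blocks l \<omega>))) / real n)
          \<longlonglongrightarrow> prob {y\<in>space M. prefix m y = v}"
        by (rule tendsto_average_concat_blocks[where g = g, OF gdet, rotated 3]) (simp_all add: g_def)
      then show ?case unfolding g_def \<xi>_def .
    qed
  qed
  have "AE \<omega> in P. \<forall>m. \<forall>v\<in>prefix m ` space M.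
      (\<lambda>n. (\<Sum>t<n. of_bool (prefix m ((left_shift ^^ t) (\<xi> \<omega>)) = v)) / real n) \<longlonglongrightarrow> prob {y\<in>space M. prefix m y = v}"
    unfolding AE_all_countable
    by (intro allI AE_finite_allI simple_functionD(1)[OF simple_function_prefix] freq)
  then have generic: "AE \<omega> in P. \<xi> \<omega> \<in> generic_points (shift_top A) left_shift M"
    using AE_space by eventually_elim (auto intro!: generic_pointI \<xi>A)

  \<comment> \<open>The log-measures of the blocks obey the same law of large numbers. Their means
    are minus the block entropies, which divided by \<open>l j\<close> tend to \<open>- h i\<close>
    because the lengths tend to infinity.\<close>
  have info: "AE \<omega> in P. (\<lambda>J. (\<Sum>j<J. ?I i (l j) (\<omega> j)) / real (S J)) \<longlonglongrightarrow> - h i" if i: "i < k" for i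
  proof -
    have "AE \<omega> in P. (\<lambda>n. ((\<Sum>j<n. ?I i (l j) (\<omega> j)) - (\<Sum>j<n. \<integral>x. ?I i (l j) x \<partial>M)) / real n) \<longlonglongrightarrow> 0"
      unfolding P_def
    proof (rule strong_law_product[OF _ _ lK(1)])
      have "determined A n (?I i n)" for n
        by (intro determinedI arg_cong[of _ _ ln] fiber_measure_word_cong arg_cong[of _ _ "\<Phi> i"])
      then show "?I i (l j) \<in> borel_measurable M" for j
        by (intro borel_measurable_simple_function) (rule determined_simple_function)
      show "\<bar>?I i (l j) x\<bar> \<le> K * sqrt (sqrt (real (Suc j)))" if "x \<in> space M" for j x
        using b(1)[OF i that, of "l j"] lK(3)[rule_format, of j] by linarith
    qed
    then show ?thesis
    proof eventually_elim
      case (elim \<omega>)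
      show ?case
      proof (rule tendsto_block_average[OF elim])
        show "(\<lambda>j. (\<integral>x. ?I i (l j) x \<partial>M) / real (l j)) \<longlonglongrightarrow> - h i"
          unfolding word_information_mean
          using tendsto_minus[OF filterlim_compose[OF entropy_rate[OF i] l_top]] by simp
      qed
    qed
  qed
  have info_all: "AE \<omega> in P. \<forall>i\<in>{..<k}. (\<lambda>J. (\<Sum>j<J. ?I i (l j) (\<omega> j)) / real (S J)) \<longlonglongrightarrow> - h i"
    by (rule AE_finite_allI) (auto intro: info)

  \<comment> \<open>The number of blocks that end by time \<open>bound n i\<close>. A block cut by a
    window boundary is thus assigned to a later, coarser window that contains its end, and a block
    cut by the last boundary is dropped; either choice only enlarges the enclosing set
    \<open>B\<close>.\<close>
  define u where "u = (\<lambda>n i. level S (bound n i))"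
  have u0: "u n 0 = 0" for n
    using level_S_bounds(1)[of 0] S_ge[of "level S 0"] by (simp add: u_def bound_0)
  have u_mono: "u n i \<le> u n j" if "i \<le> j" "j \<le> k" for n i j
    unfolding u_def using bound_mono[OF that, of n] level_S_bounds(2)[of "bound n j"]
    by (intro level_mono) auto
  define T where "T = (\<lambda>n \<omega>. \<Sum>j<u n k. ?I (level (u n) j) (l j) (\<omega> j))"
  have mass: "{\<omega>'\<in>space P. \<xi> \<omega>' \<in> full_shift A \<and> d (\<xi> \<omega>) (\<xi> \<omega>') \<le> exp (- real n)}
      \<subseteq> {\<omega>'\<in>space P. \<forall>j\<in>{..<u n k}. \<omega>' j \<in> {y\<in>space M. word (level (u n) j) (l j) y = word (level (u n) j) (l j) (\<omega> j)}}"
    if \<omega>: "\<omega> \<in> space P" for \<omega> n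
  proof
    fix \<omega>' assume "\<omega>' \<in> {\<omega>'\<in>space P. \<xi> \<omega>' \<in> full_shift A \<and> d (\<xi> \<omega>) (\<xi> \<omega>') \<le> exp (- real n)}"
    then have w': "\<omega>' \<in> space P" "d (\<xi> \<omega>) (\<xi> \<omega>') \<le> exp (- real n)" by auto
    have eq: "\<Phi> i (\<xi> \<omega> t) = \<Phi> i (\<xi> \<omega>' t)" if "i < k" "t < bound n (Suc i)" for i t
      using w'(2) that unfolding d_le_iff[OF \<xi>A[OF \<omega>] \<xi>A[OF w'(1)]] less_bound_iff by blast
    have "\<omega>' j \<in> {y\<in>space M. word (level (u n) j) (l j) y = word (level (u n) j) (l j) (\<omega> j)}" if j: "j < u n k" for j
    proof -
      let ?i = "level (u n) j"
      have i: "?i < k" by (rule level_less[where u = "u n", OF j u0])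
      have "j < u n (Suc (k - 1))" using j i by simp
      then have ju: "j < u n (Suc ?i)" by (rule less_level)
      have "\<Phi> ?i (\<omega> j r) = \<Phi> ?i (\<omega>' j r)" if r: "r < l j" for r
      proof -
        have "S j + r < S (Suc j)" using r by (simp add: block_start_Suc)
        also have "\<dots> \<le> S (u n (Suc ?i))" using ju by (intro block_start_mono) simp
        also have "\<dots> \<le> bound n (Suc ?i)" unfolding u_def by (rule level_S_bounds)
        finally have "\<Phi> ?i (\<xi> \<omega> (S j + r)) = \<Phi> ?i (\<xi> \<omega>' (S j + r))" by (rule eq[OF i])
        then show ?thesis unfolding \<xi>_def concat_blocks_nth[OF r] .
      qed
      then show ?thesis using spP[OF w'(1)] by (simp add: word_eq_iff)
    qed
    with w'(1) show "\<omega>' \<in> {\<omega>'\<in>space P. \<forall>j\<in>{..<u n k}. \<omega>' j \<in>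
        {y\<in>space M. word (level (u n) j) (l j) y = word (level (u n) j) (l j) (\<omega> j)}}" by blast
  qed
  have mass': "\<exists>B\<in>sets P. {\<omega>'\<in>space P. \<xi> \<omega>' \<in> full_shift A \<and> d (\<xi> \<omega>) (\<xi> \<omega>') \<le> exp (- real n)} \<subseteq> B \<and>
      measure P B \<le> exp (T n \<omega>)" if \<omega>: "\<omega> \<in> space P" for \<omega> n
  proof -
    let ?D = "\<lambda>j. {y\<in>space M. word (level (u n) j) (l j) y = word (level (u n) j) (l j) (\<omega> j)}"
    let ?B = "{\<omega>'\<in>space P. \<forall>j\<in>{..<u n k}. \<omega>' j \<in> ?D j}"
    have Ds: "?D j \<in> sets M" for j by (rule simple_function_fiber_sets[OF simple_function_word])
    have "?B \<in> sets P"
      unfolding P_def using Ds by (intro sets.sets_Collect_finite_All sets_Collect_single') auto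
    moreover have "measure P ?B \<le> exp (T n \<omega>)"
    proof -
      \<comment> \<open>Independence: the constraints concern different coordinates of the product
        space.\<close>
      have "emeasure P ?B = (\<Prod>j\<in>{..<u n k}. emeasure M (?D j))"
        unfolding P_def using Ds by (intro PP.emeasure_PiM_Collect) auto
      also have "\<dots> = ennreal (\<Prod>j\<in>{..<u n k}. prob (?D j))"
        by (simp add: emeasure_eq_measure prod_ennreal)
      finally have "measure P ?B = (\<Prod>j\<in>{..<u n k}. prob (?D j))"
        by (simp add: P.emeasure_eq_measure prod_nonneg)
      also have "\<dots> \<le> (\<Prod>j\<in>{..<u n k}. exp (?I (level (u n) j) (l j) (\<omega> j)))"
      proof (rule prod_mono)
        fix j
        \<comment> \<open>Only an inequality, to include fibers of measure 0, where
          \<open>ln\<close> has its conventional value.\<close>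
        have "p \<le> exp (ln p)" if "0 \<le> p" for p :: real using that by (cases "p = 0") auto
        then show "0 \<le> prob (?D j) \<and> prob (?D j) \<le> exp (?I (level (u n) j) (l j) (\<omega> j))"
          unfolding fiber_measure_def by simp
      qed
      also have "\<dots> = exp (T n \<omega>)" unfolding T_def by (simp add: exp_sum)
      finally show ?thesis .
    qed
    ultimately show ?thesis using mass[OF \<omega>, of n] by blast
  qed

  have T_lim: "AE \<omega> in P. (\<lambda>n. T n \<omega> / real n) \<longlonglongrightarrow> - total"
    using info_all
  proof eventually_elim
    case (elim \<omega>)
    let ?R = "\<lambda>i J. \<Sum>j<J. ?I i (l j) (\<omega> j)"
    have T_eq: "T n \<omega> = (\<Sum>i<k. ?R i (u n (Suc i)) - ?R i (u n i))" for n
      unfolding T_def by (rule sum_level[where u = "u n" and F = "\<lambda>i j. ?I i (l j) (\<omega> j)", OF u0 u_mono])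
    have "(\<lambda>n. T n \<omega> / real n) \<longlonglongrightarrow> (\<Sum>i<k. (C (Suc i) - C i) * - h i)"
      unfolding T_eq
    proof (rule level_sum_limit)
      fix i j assume ij: "i < k" "j \<le> k"
      show "(\<lambda>n. ?R i (u n j) / real n) \<longlonglongrightarrow> - h i * C j"
      proof (cases "j = 0")
        case False
        have "(\<lambda>m. ?R i (level S m) / real (S (level S m)) * (real (S (level S m)) / real m)) \<longlonglongrightarrow> - h i * 1"
          using elim ij(1) by (intro tendsto_mult level_S_ratio filterlim_compose[OF _ level_S_top, of "\<lambda>J. ?R i J / real (S J)"]) auto
        moreover have "(\<lambda>m. ?R i (level S m) / real (S (level S m)) * (real (S (level S m)) / real m))
            = (\<lambda>m. ?R i (level S m) / real m)"
        proof
          show "?R i (level S m) / real (S (level S m)) * (real (S (level S m)) / real m)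
              = ?R i (level S m) / real m" for m
            using S_ge[of "level S m"] by (cases "S (level S m) = 0") auto
        qed
        ultimately have "(\<lambda>m. ?R i (level S m) / real m) \<longlonglongrightarrow> - h i" by (simp only: mult_1_right)
        then show ?thesis
          unfolding u_def using bound_ratio[OF ij(2)] C_pos[OF _ ij(2)] False u0[of 0]
          by (intro tendsto_ratio_compose[where R = "\<lambda>m. ?R i (level S m)"]) (auto simp: u_def bound_0)
      qed (simp add: u0 C_def)
    qed
    then show ?case by (simp add: total_def sum_negf)
  qed

  have "ereal total \<le> hausdorff_dim (full_shift A) d (generic_points (shift_top A) left_shift M)"
  proof (rule P.hausdorff_dim_ge[OF generic])
    show "generic_points (shift_top A) left_shift M \<subseteq> full_shift A" by (auto simp: generic_points_def)
    fix s assume "0 \<le> s" "s < total"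
    show "AE \<omega> in P. \<forall>\<^sub>F n in sequentially. \<exists>B\<in>sets P.
      {\<omega>'\<in>space P. \<xi> \<omega>' \<in> full_shift A \<and> d (\<xi> \<omega>) (\<xi> \<omega>') \<le> exp (- real n)} \<subseteq> B \<and> P.prob B \<le> exp (- real n * s)"
      using T_lim AE_space
    proof eventually_elim
      case (elim \<omega>)
      then have "\<forall>\<^sub>F n in sequentially. T n \<omega> / real n < - s"
        using \<open>s < total\<close> by (intro order_tendstoD(2)) auto
      then show ?case
        using eventually_gt_at_top[of 0]
      proof eventually_elim
        case (elim n)
        then have "T n \<omega> \<le> - real n * s" by (simp add: divide_less_eq algebra_simps)
        then have "exp (T n \<omega>) \<le> exp (- real n * s)" by simp
        with mass'[OF \<open>\<omega> \<in> space P\<close>, of n] show ?case by (meson order_trans)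
      qed
    qed
  qed (rule d_nonneg)
  moreover have "generic_points (shift_top A) left_shift M \<noteq> {}"
  proof
    assume "generic_points (shift_top A) left_shift M = {}"
    with generic have "AE \<omega> in P. False" by simp
    then show False by simp
  qed
  ultimately show ?thesis by blast
qed

end

section \<open>Factor maps\<close>

lemma continuous_map_factor_comp:
  assumes "\<And>j. j \<in> {1..i} \<Longrightarrow> continuous_map (shift_top (A j)) (shift_top (A (j + 1))) (\<pi> j)"
  shows "continuous_map (shift_top (A 1)) (shift_top (A (Suc i))) (factor_comp \<pi> i)"
  using assms
proof (induction i)
  case 0
  show ?case by (simp add: id_def)
next
  case (Suc i)
  have "continuous_map (shift_top (A 1)) (shift_top (A (Suc i))) (factor_comp \<pi> i)"
    using Suc.prems by (intro Suc.IH) simp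
  moreover have "continuous_map (shift_top (A (Suc i))) (shift_top (A (Suc (Suc i)))) (\<pi> (Suc i))"
    using Suc.prems[of "Suc i"] by simp
  ultimately show ?case unfolding factor_comp.simps by (rule continuous_map_compose)
qed

text \<open>Composing the letter maps step by step makes each \<open>\<Phi> j\<close> factor through
  all earlier \<open>\<Phi> i\<close>; this is what lets finer letters determine coarser
  ones.\<close>

lemma factor_comp_letter_maps:
  assumes "\<And>i. i \<in> {1..k - 1} \<Longrightarrow> one_block_factor_map (A i) (A (i + 1)) (\<pi> i)"
  obtains \<Phi> where
    "\<And>i x n. i < k \<Longrightarrow> x \<in> full_shift (A 1) \<Longrightarrow> factor_comp \<pi> i x n = \<Phi> i (x n)"
    "\<And>i j b b'. i \<le> j \<Longrightarrow> \<Phi> i b = \<Phi> i b' \<Longrightarrow> \<Phi> j b = \<Phi> j b'"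
proof -
  have cont: "continuous_map (shift_top (A i)) (shift_top (A (i + 1))) (\<pi> i)" if "i \<in> {1..k - 1}" for i
    using assms[OF that] by (simp add: one_block_factor_map_def)
  have "\<forall>i. \<exists>\<phi>. i \<in> {1..k - 1} \<longrightarrow> (\<forall>x\<in>full_shift (A i). \<forall>n. \<pi> i x n = \<phi> (x n))"
    using assms unfolding one_block_factor_map_def by blast
  then have "\<exists>\<phi>. \<forall>i. i \<in> {1..k - 1} \<longrightarrow> (\<forall>x\<in>full_shift (A i). \<forall>n. \<pi> i x n = \<phi> i (x n))"
    by (rule choice)
  then obtain \<phi> where \<phi>: "\<And>i x n. i \<in> {1..k - 1} \<Longrightarrow> x \<in> full_shift (A i) \<Longrightarrow> \<pi> i x n = \<phi> i (x n)"
    by blast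
  define \<Phi> where "\<Phi> = rec_nat id (\<lambda>i f. \<phi> (Suc i) \<circ> f)"
  have \<Phi>: "\<Phi> 0 = id" "\<Phi> (Suc i) = \<phi> (Suc i) \<circ> \<Phi> i" for i by (simp_all add: \<Phi>_def)
  have "factor_comp \<pi> i x n = \<Phi> i (x n)" if "i < k" "x \<in> full_shift (A 1)" for i x n
    using that(1)
  proof (induction i arbitrary: n)
    case (Suc i)
    have "continuous_map (shift_top (A 1)) (shift_top (A (Suc i))) (factor_comp \<pi> i)"
      using Suc.prems by (intro continuous_map_factor_comp cont) auto
    then have "factor_comp \<pi> i x \<in> full_shift (A (Suc i))"
      using that(2) by (auto simp: continuous_map_def)
    moreover have "Suc i \<in> {1..k - 1}" using Suc.prems by simp
    ultimately have "\<pi> (Suc i) (factor_comp \<pi> i x) n = \<phi> (Suc i) (factor_comp \<pi> i x n)" by (rule \<phi>[rotated])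
    then show ?case using Suc.IH[of n] Suc.prems by (simp add: \<Phi>)
  qed (simp add: \<Phi>)
  moreover have "\<Phi> j b = \<Phi> j b'" if "i \<le> j" "\<Phi> i b = \<Phi> i b'" for i j b b'
    using that by (induction j rule: dec_induct) (simp_all add: \<Phi>)
  ultimately show ?thesis using that by blast
qed

lemma invariant_measures_distr:
  assumes M: "M \<in> invariant_measures (shift_top A) left_shift"
    and f: "continuous_map (shift_top A) (shift_top B) f"
    and comm: "\<And>x. x \<in> full_shift A \<Longrightarrow> f (left_shift x) = left_shift (f x)"
  shows "distr M (borel_on (shift_top B)) f \<in> invariant_measures (shift_top B) left_shift"
proof -
  let ?N = "borel_on (shift_top B)"
  have M': "prob_space M" "space M = full_shift A" "sets M = sets (borel_on (shift_top A))"
    "\<And>S. S \<in> sets M \<Longrightarrow> emeasure M (left_shift -` S \<inter> space M) = emeasure M S"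
    using M by (auto simp: invariant_measures_def)
  have fm: "f \<in> measurable M ?N" by (rule measurable_borel_on[OF f M'(2,3)])
  have Tm: "left_shift \<in> measurable ?N ?N"
    by (rule measurable_borel_on[OF continuous_map_left_shift]) (simp_all add: space_borel_on)
  have Tx: "left_shift x \<in> full_shift A" if "x \<in> full_shift A" for x :: "nat \<Rightarrow> 'a"
    using that by (auto simp: full_shift_eq left_shift_def)
  have "emeasure (distr M ?N f) (left_shift -` S \<inter> full_shift B) = emeasure (distr M ?N f) S" if S: "S \<in> sets ?N" for S
  proof -
    have TS: "left_shift -` S \<inter> full_shift B \<in> sets ?N" using measurable_sets[OF Tm S] by (simp add: space_borel_on)
    have fS: "f -` S \<inter> space M \<in> sets M" by (rule measurable_sets[OF fm S])
    have "f x \<in> full_shift B" if "x \<in> full_shift A" for x using f that by (auto simp: continuous_map_def)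
    then have "f -` (left_shift -` S \<inter> full_shift B) \<inter> space M = left_shift -` (f -` S \<inter> space M) \<inter> space M"
      using comm Tx unfolding M'(2) by auto
    then show ?thesis using M'(4)[OF fS] by (simp add: emeasure_distr[OF fm] TS S)
  qed
  then show ?thesis
    using prob_space.prob_space_distr[OF M'(1) fm] by (simp add: invariant_measures_def space_borel_on)
qed

theorem theorem5p4:
  fixes k :: nat
    and A :: "nat \<Rightarrow> 'a set"
    and \<pi> :: "nat \<Rightarrow> (nat \<Rightarrow> 'a) \<Rightarrow> nat \<Rightarrow> 'a"
    and a :: "nat \<Rightarrow> real"
    and \<mu> :: "(nat \<Rightarrow> 'a) measure"
  assumes "k \<ge> 2"
    and "\<And>i. i \<in> {1..k} \<Longrightarrow> finite (A i)"
    and "\<And>i. i \<in> {1..k - 1} \<Longrightarrow> one_block_factor_map (A i) (A (i + 1)) (\<pi> i)"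
    and "a 1 > 0"
    and "\<And>i. i \<in> {2..k} \<Longrightarrow> a i \<ge> 0"
    and "\<mu> \<in> invariant_measures (shift_top (A 1)) left_shift"
  shows "generic_points (shift_top (A 1)) left_shift \<mu> \<noteq> {} \<and>
    hausdorff_dim (full_shift (A 1)) (weighted_dist k \<pi> a)
        (generic_points (shift_top (A 1)) left_shift \<mu>)
      = weighted_entropy k A \<pi> a \<mu>"
proof -
  let ?\<mu> = "\<lambda>i. distr \<mu> (borel_on (shift_top (A (Suc i)))) (factor_comp \<pi> i)"
  obtain \<Phi> where \<Phi>: "\<And>i x n. i < k \<Longrightarrow> x \<in> full_shift (A 1) \<Longrightarrow> factor_comp \<pi> i x n = \<Phi> i (x n)"
    "\<And>i j b b'. i \<le> j \<Longrightarrow> \<Phi> i b = \<Phi> i b' \<Longrightarrow> \<Phi> j b = \<Phi> j b'"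
    by (rule factor_comp_letter_maps[where k = k and A = A and \<pi> = \<pi>]) (rule assms(3) that; assumption)+
  have fin: "finite (A 1)" using assms(1) by (intro assms(2)) simp
  interpret \<mu>: shift_measure "A 1" \<mu> by (unfold_locales) (rule fin, rule assms(6))
  \<comment> \<open>The entropy of level \<open>i\<close> is identified on its own shift and its
    rate is then expressed by words of \<open>\<mu>\<close>, so that all levels live on one
    probability space.\<close>
  have "\<exists>h. (\<lambda>n. fiber_entropy \<mu> (itinerary (\<lambda>x. \<Phi> i (x 0)) left_shift n) / real n) \<longlonglongrightarrow> h
      \<and> measure_entropy (?\<mu> i) left_shift = ereal h" if i: "i < k" for i
  proof -
    have cont: "continuous_map (shift_top (A 1)) (shift_top (A (Suc i))) (factor_comp \<pi> i)"
    proof (rule continuous_map_factor_comp)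
      show "continuous_map (shift_top (A j)) (shift_top (A (j + 1))) (\<pi> j)" if "j \<in> {1..i}" for j
        using assms(3)[of j] i that by (auto simp: one_block_factor_map_def)
    qed
    have comm: "factor_comp \<pi> i (left_shift x) = left_shift (factor_comp \<pi> i x)" if x: "x \<in> full_shift (A 1)" for x
    proof -
      have "left_shift x \<in> full_shift (A 1)" using x by (auto simp: full_shift_eq left_shift_def)
      from \<Phi>(1)[OF i this] \<Phi>(1)[OF i x] show ?thesis by (simp add: left_shift_def fun_eq_iff)
    qed
    interpret N: shift_measure "A (Suc i)" "?\<mu> i"
    proof
      show "finite (A (Suc i))" using i by (intro assms(2)) simp
      show "?\<mu> i \<in> invariant_measures (shift_top (A (Suc i))) left_shift"
        by (rule invariant_measures_distr[OF assms(6) cont comm])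
    qed
    obtain h where h: "(\<lambda>n. fiber_entropy (?\<mu> i) (N.prefix n) / real n) \<longlonglongrightarrow> h"
        "measure_entropy (?\<mu> i) left_shift = ereal h"
      by (rule N.kolmogorov_sinai)
    have "fiber_entropy (?\<mu> i) (N.prefix n) = fiber_entropy \<mu> (itinerary (\<lambda>x. \<Phi> i (x 0)) left_shift n)" for n
    proof -
      have m: "factor_comp \<pi> i \<in> measurable \<mu> (borel_on (shift_top (A (Suc i))))"
        by (rule measurable_borel_on[OF cont \<mu>.space_M]) (simp add: \<mu>.sets_M sets_borel_on)
      have "simple_function (borel_on (shift_top (A (Suc i)))) (N.prefix n)"
        using N.simple_function_prefix[of n] by (simp add: simple_function_def)
      from fiber_entropy_distr[OF m this]
      have "fiber_entropy (?\<mu> i) (N.prefix n) = fiber_entropy \<mu> (N.prefix n \<circ> factor_comp \<pi> i)" .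
      also have "\<dots> = fiber_entropy \<mu> (itinerary (\<lambda>x. \<Phi> i (x 0)) left_shift n)"
        by (rule \<mu>.fiber_entropy_cong)
          (simp add: N.prefix_eq_iff itinerary_eq_iff funpow_left_shift \<Phi>(1)[OF i] \<mu>.space_M)
      finally show ?thesis .
    qed
    with h show ?thesis by auto
  qed
  then have "\<forall>i. \<exists>h. i < k \<longrightarrow> (\<lambda>n. fiber_entropy \<mu> (itinerary (\<lambda>x. \<Phi> i (x 0)) left_shift n) / real n) \<longlonglongrightarrow> h
      \<and> measure_entropy (?\<mu> i) left_shift = ereal h" by blast
  then have "\<exists>h. \<forall>i. i < k \<longrightarrow>
      (\<lambda>n. fiber_entropy \<mu> (itinerary (\<lambda>x. \<Phi> i (x 0)) left_shift n) / real n) \<longlonglongrightarrow> h i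
      \<and> measure_entropy (?\<mu> i) left_shift = ereal (h i)" by (rule choice)
  then obtain h where h: "\<And>i. i < k \<Longrightarrow> (\<lambda>n. fiber_entropy \<mu> (itinerary (\<lambda>x. \<Phi> i (x 0)) left_shift n) / real n) \<longlonglongrightarrow> h i"
      "\<And>i. i < k \<Longrightarrow> measure_entropy (?\<mu> i) left_shift = ereal (h i)"
    by blast
  define c where "c = (\<lambda>i. \<Sum>j=1..Suc i. a j)"
  have a: "0 \<le> a i" if "i \<in> {1..k}" for i
    using assms(4) assms(5)[of i] that by (cases "i = 1") auto
  have c_0: "c 0 = a 1" and c_Suc: "c (Suc i) = c i + a (Suc (Suc i))" for i by (simp_all add: c_def)
  have c_mono: "c i \<le> c j" if "i \<le> j" "j < k" for i j
    using that
  proof (induction j rule: dec_induct)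
    case (step n)
    then show ?case using a[of "Suc (Suc n)"] by (simp add: c_Suc)
  qed simp
  have c_pos: "0 < c i" if "i < k" for i
    using c_mono[of 0 i] that assms(4) by (simp add: c_0)
  have k: "{1..k} = Suc ` {..<k}"
    by (simp add: lessThan_atLeast0 image_Suc_atLeastLessThan atLeastLessThanSuc_atLeastAtMost)
  have d_le: "weighted_dist k \<pi> a x y \<le> exp (- r) \<longleftrightarrow> (\<forall>i<k. \<forall>t. real t < c i * r \<longrightarrow> \<Phi> i (x t) = \<Phi> i (y t))"
    if "x \<in> full_shift (A 1)" "y \<in> full_shift (A 1)" for x y r
  proof -
    have "weighted_dist k \<pi> a x y \<le> exp (- r) \<longleftrightarrow> (\<forall>i\<in>{1..k}. \<forall>t. real t < (\<Sum>j=1..i. a j) * r \<longrightarrow>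
        factor_comp \<pi> (i - 1) x t = factor_comp \<pi> (i - 1) y t)"
    proof (rule weighted_dist_le_iff)
      show "0 < (\<Sum>j=1..i. a j)" if i: "i \<in> {1..k}" for i
      proof -
        obtain i' where "i = Suc i'" "i' < k" using i unfolding k by auto
        then show ?thesis using c_pos[of i'] unfolding c_def by (simp only:)
      qed
    qed (use assms(1) in simp)
    also have "\<dots> \<longleftrightarrow> (\<forall>i<k. \<forall>t. real t < c i * r \<longrightarrow> \<Phi> i (x t) = \<Phi> i (y t))"
      unfolding k c_def using \<Phi>(1) that by auto
    finally show ?thesis .
  qed
  interpret weighted_shift "A 1" \<mu> k \<Phi> c "weighted_dist k \<pi> a" h
  proof
    show "\<Phi> j b = \<Phi> j b'" if "i \<le> j" "\<Phi> i b = \<Phi> i b'" for i j b b' using that by (rule \<Phi>(2))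
    show "0 \<le> weighted_dist k \<pi> a x y" for x y using assms(1) by (intro weighted_dist_nonneg) simp
  qed (fact c_pos c_mono d_le h(1))+
  have "weighted_entropy k A \<pi> a \<mu> = (\<Sum>i<k. ereal (a (Suc i)) * measure_entropy (?\<mu> i) left_shift)"
    unfolding weighted_entropy_def k by (simp add: sum.reindex)
  also have "\<dots> = (\<Sum>i<k. ereal (a (Suc i) * h i))" using h(2) by (intro sum.cong) auto
  also have "\<dots> = ereal (\<Sum>i<k. a (Suc i) * h i)" by (rule sum_ereal)
  \<comment> \<open>The window lengths per unit of \<open>n\<close> are the weights
    themselves.\<close>
  also have "(\<Sum>i<k. a (Suc i) * h i) = total"
  proof -
    have "C (Suc i) - C i = a (Suc i)" for i
      by (cases i) (simp_all add: C_def c_0 c_Suc)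
    then show ?thesis by (simp add: total_def)
  qed
  finally show ?thesis
    using generic_points_lower_bound hausdorff_dim_generic_points_le by (simp add: antisym)
qed

end
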